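(* Let $n,h\ge1$, let $\lambda\vdash h$, and let $(i_1,\dots,i_h),(j_1,\dots,j_h)\in\{1,\dots,n\}^h$. Then the Capelli immanant $Cimm_\lambda[i_1i_2\cdots i_h;j_1j_2\cdots j_h]\in\mathbf U(gl(n))$ can be written as a linear combination of standard Young–Capelli bitableaux of the same shape $\lambda$: $$Cimm_\lambda[i_1i_2\cdots i_h;j_1j_2\cdots j_h]=\sum_{U,V}\varrho_{U,V}\,[U|\boxed{V}],\qquad\varrho_{U,V}\in\mathbb C,$$ where $U,V$ range over standard tableaux on $\{1,\dots,n\}$ with $sh(U)=sh(V)=\lambda$.
   Context: **Virtual variables.** Let $A_0=\{\alpha_1,\dots,\alpha_{m_0}\}$, $A_1=\{\beta_1,\dots,\beta_{m_1}\}$, $L=\{1,\dots,n\}$ be disjoint sets of symbols ($m_0,m_1$ sufficiently large), with parities $|\alpha_s|=0$, $|\beta_t|=|i|=1$ in $\mathbb Z_2$. $gl(m_0|m_1+n)$ is the complex Lie superalgebra with basis $e_{a,b}$, $a,b\in A_0\cup A_1\cup L$, $|e_{a,b}|=|a|+|b|$, and superbracket $[e_{a,b},e_{c,d}]=\delta_{bc}e_{a,d}-(-1)^{(|a|+|b|)(|c|+|d|)}\delta_{ad}e_{c,b}$; $gl(n)$ is its Lie subalgebra spanned by $e_{ij}=e_{i,j}$, $i,j\in L$. A product $e_{a_m,b_m}\cdots e_{a_1,b_1}$ in $\mathbf U(gl(m_0|m_1+n))$ is irregular if there are $i\le m$ and $\gamma\in A_0\cup A_1$ with $\#\{j\le i: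 b_j=\gamma\}>\#\{j<i: a_j=\gamma\}$. $\mathbf{Irr}$ is the left ideal generated by irregular products. It is known that $\mathbf U(gl(n))\cap\mathbf{Irr}=0$ and that $Virt(m_0+m_1,n)=\mathbf U(gl(n))\oplus\mathbf{Irr}$ is a subalgebra in which $\mathbf{Irr}$ is a two-sided ideal; $\mathfrak p:Virt(m_0+m_1,n)\to\mathbf U(gl(n))$ is the projection with kernel $\mathbf{Irr}$. **Capelli and Young–Capelli bitableaux.** A tableau of shape $\lambda\vdash h$ over an alphabet is an arbitrary filling of the diagram of $\lambda$; its cells are numbered $1,\dots,h$ row by row from left to right, top to bottom, and $S(k)$ is the entry in cell $k$; $sh(S)=\lambda$ is its shape. A tableau on $\{1,\dots,n\}$ is standard if its rows are strictly increasing from left to right and its columns are non-decreasing from top to bottom. For tableaux $S,T$ of the same shape over $A_0\cup A_1\cup L$ put $e_{S,T}=e_{S(1),T(1)}\cdots e_{S(h),T(h)}$. $C^*_\lambda$ is the tableau of shape $\lambda$ all of whose entries in row $r$ equal $\alpha_r$, and $D^*_\lambda$ is the tableau of shape $\lambda$ all of whose entries in column $c$ equal $\beta_c$. For tableaux $S,T$ of shape $\lambda$ on $\{1,\dots,n\}$, the Capelli bitableau and the Young–Capelli bitableau are $$[S|T]=\mathfrak p\big(e_{S,C^*_\lambda}\,e_{C^*_\lambda,T}\big),\qquad [S|\boxed{T}]=\mathfrak p\big(e_{S,C^*_\lambda}\,e_{C^*_\lambda,D^*_\lambda}\,e_{D^*_\lambda,T}\big)\in\mathbf U(gl(n))$$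 (the arguments of $\mathfrak p$ lie in $Virt(m_0+m_1,n)$). A column Capelli bitableau is a Capelli bitableau of shape $(1^h)$. **Capelli immanants.** For $\lambda\vdash h$, $\chi^\lambda$ denotes the irreducible character of the symmetric group $\mathbf S_h$ labelled so that $\lambda=(1^h)$ gives the trivial and $\lambda=(h)$ the sign character (i.e. $\chi^\lambda$ is the character usually attached to the conjugate partition). Put $$Cimm_\lambda[i_1\cdots i_h;j_1\cdots j_h]=\sum_{\sigma\in\mathbf S_h}\chi^\lambda(\sigma)\left[\begin{array}{c}i_{\sigma(1)}\\ \vdots\\ i_{\sigma(h)}\end{array}\right|\left.\begin{array}{c}j_1\\ \vdots\\ j_h\end{array}\right].$$ *)

theory Defs
  imports
    Complex_Main
    "HOL-Library.FuncSet"
    "HOL-Library.Poly_Mapping"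
    "HOL-Combinatorics.Permutations"
    "HOL-Algebra.QuotRing"
begin

section \<open>Complex vector spaces with a given basis\<close>

text \<open>
  The complex vector space with basis \<open>'a\<close> is the type \<open>'a \<Rightarrow>\<^sub>0 complex\<close> of finitely
  supported functions; the basis vector belonging to \<open>x\<close> is \<open>Poly_Mapping.single x 1\<close>.
\<close>

definition cscale :: "complex \<Rightarrow> ('a \<Rightarrow>\<^sub>0 complex) \<Rightarrow> ('a \<Rightarrow>\<^sub>0 complex)" where
  "cscale c = Poly_Mapping.map ((*) c)"

lemma lookup_cscale [simp]: "Poly_Mapping.lookup (cscale c p) x = c * Poly_Mapping.lookup p x"
  by (simp add: cscale_def Poly_Mapping.map.rep_eq when_def)

interpretation cvs: vector_space "cscale :: complex \<Rightarrow> ('a \<Rightarrow>\<^sub>0 complex) \<Rightarrow> _"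
  by unfold_locales (simp_all add: poly_mapping_eq_iff fun_eq_iff lookup_add algebra_simps)

text \<open>The linear extension of a map between bases.\<close>

definition pushforward :: "('a \<Rightarrow> 'b) \<Rightarrow> ('a \<Rightarrow>\<^sub>0 complex) \<Rightarrow> ('b \<Rightarrow>\<^sub>0 complex)" where
  "pushforward f p =
     (\<Sum>x\<in>Poly_Mapping.keys p. Poly_Mapping.single (f x) (Poly_Mapping.lookup p x))"

text \<open>
  The trace of a linear endomorphism \<open>f\<close> of a finite-dimensional invariant subspace \<open>V\<close>,
  computed in some basis of \<open>V\<close>.
\<close>

definition trace_on ::
    "('a \<Rightarrow>\<^sub>0 complex) set \<Rightarrow> (('a \<Rightarrow>\<^sub>0 complex) \<Rightarrow> ('a \<Rightarrow>\<^sub>0 complex)) \<Rightarrow> complex" where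
  "trace_on V f =
     (let B = (SOME B. B \<subseteq> V \<and> cvs.independent B \<and> cvs.span B = V)
      in \<Sum>b\<in>B. cvs.representation B (f b) b)"


section \<open>Free algebras and enveloping algebras of Lie superalgebras\<close>

text \<open>
  Words form a monoid under concatenation, so that \<open>'a word \<Rightarrow>\<^sub>0 complex\<close>, with the
  convolution product of \<open>Poly_Mapping\<close>, is the free associative algebra on \<open>'a\<close>.
\<close>

datatype 'a word = Word (letters: "'a list")

instantiation word :: (type) monoid_add
begin

definition zero_word :: "'a word" where "0 = Word []"

definition plus_word :: "'a word \<Rightarrow> 'a word \<Rightarrow> 'a word" where
  "v + w = Word (letters v @ letters w)"

instance
  by standard (simp_all add: zero_word_def plus_word_def)

end

definition word_monom :: "'a list \<Rightarrow> ('a word \<Rightarrow>\<^sub>0 complex)" where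
  "word_monom xs = Poly_Mapping.single (Word xs) 1"

definition free_alg :: "'a set \<Rightarrow> ('a word \<Rightarrow>\<^sub>0 complex) ring" where
  "free_alg X =
     \<lparr>carrier = {p. \<forall>w\<in>Poly_Mapping.keys p. set (letters w) \<subseteq> X},
      mult = (*), one = 1, zero = 0, add = (+)\<rparr>"

lemma ring_free_alg: "ring (free_alg X)"
proof (rule ringI)
  show "abelian_group (free_alg X)"
  proof (rule abelian_groupI)
    fix x y assume xy: "x \<in> carrier (free_alg X)" "y \<in> carrier (free_alg X)"
    show "x \<oplus>\<^bsub>free_alg X\<^esub> y \<in> carrier (free_alg X)"
      using xy Poly_Mapping.keys_add[of x y] by (fastforce simp: free_alg_def)
  next
    fix x assume x: "x \<in> carrier (free_alg X)"
    have "- x \<in> carrier (free_alg X)" using x by (simp add: free_alg_def keys_minus)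
    then show "\<exists>y\<in>carrier (free_alg X). y \<oplus>\<^bsub>free_alg X\<^esub> x = \<zero>\<^bsub>free_alg X\<^esub>"
      by (intro bexI[of _ "- x"]) (simp_all add: free_alg_def)
  qed (simp_all add: free_alg_def algebra_simps)
  show "Group.monoid (free_alg X)"
  proof (rule monoidI)
    fix x y assume xy: "x \<in> carrier (free_alg X)" "y \<in> carrier (free_alg X)"
    show "x \<otimes>\<^bsub>free_alg X\<^esub> y \<in> carrier (free_alg X)"
      using xy keys_mult[of x y] by (fastforce simp: free_alg_def plus_word_def)
  qed (simp_all add: free_alg_def mult.assoc zero_word_def)
qed (simp_all add: free_alg_def algebra_simps)

text \<open>
  A Lie superalgebra is given here by a homogeneous basis \<open>B\<close>, the parities \<open>p\<close> of the basis
  elements and the superbracket \<open>br\<close> on the basis.  Its enveloping algebra is the tensor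
  algebra, i.e. the free algebra on \<open>B\<close>, modulo the two-sided ideal generated by the elements
  \<open>x y - (-1)\<^bsup>|x||y|\<^esup> y x - [x, y]\<close>.
\<close>

definition env_ideal ::
    "'a set \<Rightarrow> ('a \<Rightarrow> nat) \<Rightarrow> ('a \<Rightarrow> 'a \<Rightarrow> ('a \<Rightarrow>\<^sub>0 complex)) \<Rightarrow> ('a word \<Rightarrow>\<^sub>0 complex) set" where
  "env_ideal B p br =
     Idl\<^bsub>free_alg B\<^esub>
       {word_monom [x, y] - cscale ((-1) ^ (p x * p y)) (word_monom [y, x])
          - pushforward (\<lambda>z. Word [z]) (br x y) | x y. x \<in> B \<and> y \<in> B}"

definition env_alg ::
    "'a set \<Rightarrow> ('a \<Rightarrow> nat) \<Rightarrow> ('a \<Rightarrow> 'a \<Rightarrow> ('a \<Rightarrow>\<^sub>0 complex)) \<Rightarrow> ('a word \<Rightarrow>\<^sub>0 complex) set ring" where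
  "env_alg B p br = free_alg B Quot env_ideal B p br"


section \<open>The Lie superalgebra \<open>gl(m0|m1+n)\<close>\<close>

datatype symb = Alpha nat | Beta nat | Letter nat

fun symb_parity :: "symb \<Rightarrow> nat" where
  "symb_parity (Alpha _) = 0"
| "symb_parity (Beta _) = 1"
| "symb_parity (Letter _) = 1"

definition symb_A0 :: "nat \<Rightarrow> symb set" where "symb_A0 m0 = Alpha ` {1..m0}"
definition symb_A1 :: "nat \<Rightarrow> symb set" where "symb_A1 m1 = Beta ` {1..m1}"
definition symb_L :: "nat \<Rightarrow> symb set" where "symb_L n = Letter ` {1..n}"

text \<open>The pair \<open>(a, b)\<close> stands for the basis element \<open>e\<^bsub>a,b\<^esub>\<close>.\<close>

definition gl_basis :: "nat \<Rightarrow> nat \<Rightarrow> nat \<Rightarrow> (symb \<times> symb) set" where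
  "gl_basis m0 m1 n = (symb_A0 m0 \<union> symb_A1 m1 \<union> symb_L n) \<times> (symb_A0 m0 \<union> symb_A1 m1 \<union> symb_L n)"

definition gl_parity :: "symb \<times> symb \<Rightarrow> nat" where
  "gl_parity x = (symb_parity (fst x) + symb_parity (snd x)) mod 2"

definition gl_bracket :: "symb \<times> symb \<Rightarrow> symb \<times> symb \<Rightarrow> (symb \<times> symb \<Rightarrow>\<^sub>0 complex)" where
  "gl_bracket x y =
     (case (x, y) of ((a, b), (c, d)) \<Rightarrow>
       (if b = c then Poly_Mapping.single (a, d) 1 else 0)
       - cscale ((-1) ^ (gl_parity (a, b) * gl_parity (c, d)))
           (if a = d then Poly_Mapping.single (c, b) 1 else 0))"

definition U_gl :: "nat \<Rightarrow> nat \<Rightarrow> nat \<Rightarrow> ((symb \<times> symb) word \<Rightarrow>\<^sub>0 complex) set ring" where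
  "U_gl m0 m1 n = env_alg (gl_basis m0 m1 n) gl_parity gl_bracket"

definition U_class ::
    "nat \<Rightarrow> nat \<Rightarrow> nat \<Rightarrow> ((symb \<times> symb) word \<Rightarrow>\<^sub>0 complex) \<Rightarrow> ((symb \<times> symb) word \<Rightarrow>\<^sub>0 complex) set" where
  "U_class m0 m1 n p =
     env_ideal (gl_basis m0 m1 n) gl_parity gl_bracket +>\<^bsub>free_alg (gl_basis m0 m1 n)\<^esub> p"

text \<open>Multiplication by a complex scalar, i.e. by the class of a constant.\<close>

definition U_smult ::
    "nat \<Rightarrow> nat \<Rightarrow> nat \<Rightarrow> complex \<Rightarrow> ((symb \<times> symb) word \<Rightarrow>\<^sub>0 complex) set
       \<Rightarrow> ((symb \<times> symb) word \<Rightarrow>\<^sub>0 complex) set" where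
  "U_smult m0 m1 n c u = U_class m0 m1 n (cscale c 1) \<otimes>\<^bsub>U_gl m0 m1 n\<^esub> u"

text \<open>
  \<open>U(gl(n))\<close>, regarded as the subalgebra of \<open>U(gl(m0|m1+n))\<close> generated by the
  \<open>e\<^bsub>i,j\<^esub>\<close> with \<open>i, j \<in> symb_L n\<close>.
\<close>

definition U_gln :: "nat \<Rightarrow> nat \<Rightarrow> nat \<Rightarrow> ((symb \<times> symb) word \<Rightarrow>\<^sub>0 complex) set set" where
  "U_gln m0 m1 n = U_class m0 m1 n ` carrier (free_alg (symb_L n \<times> symb_L n))"


section \<open>Irregular products and the projection\<close>

definition left_ideal :: "('a, 'b) ring_scheme \<Rightarrow> 'a set \<Rightarrow> bool" where
  "left_ideal R J \<longleftrightarrow>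
     additive_subgroup J R \<and> (\<forall>r\<in>carrier R. \<forall>x\<in>J. r \<otimes>\<^bsub>R\<^esub> x \<in> J)"

definition left_ideal_gen :: "('a, 'b) ring_scheme \<Rightarrow> 'a set \<Rightarrow> 'a set" where
  "left_ideal_gen R S = \<Inter>{J. left_ideal R J \<and> S \<subseteq> J}"

text \<open>
  The list \<open>[(a\<^sub>m, b\<^sub>m), \<dots>, (a\<^sub>1, b\<^sub>1)]\<close> stands for the product
  \<open>e\<^bsub>a_m,b_m\<^esub> \<dots> e\<^bsub>a_1,b_1\<^esub>\<close>, whose factors are counted from right to left.
  The index \<open>k\<close> below is zero-based and corresponds to \<open>i = k + 1\<close>.
\<close>

definition irregular :: "nat \<Rightarrow> nat \<Rightarrow> (symb \<times> symb) list \<Rightarrow> bool" where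
  "irregular m0 m1 xs \<longleftrightarrow>
     (\<exists>k<length xs. \<exists>g\<in>symb_A0 m0 \<union> symb_A1 m1.
        card {j. j \<le> k \<and> snd (rev xs ! j) = g} > card {j. j < k \<and> fst (rev xs ! j) = g})"

definition Irr :: "nat \<Rightarrow> nat \<Rightarrow> nat \<Rightarrow> ((symb \<times> symb) word \<Rightarrow>\<^sub>0 complex) set set" where
  "Irr m0 m1 n =
     left_ideal_gen (U_gl m0 m1 n)
       {U_class m0 m1 n (word_monom xs) | xs. set xs \<subseteq> gl_basis m0 m1 n \<and> irregular m0 m1 xs}"

text \<open>
  The projection of \<open>U(gl(n)) \<oplus> Irr\<close> onto \<open>U(gl(n))\<close> with kernel \<open>Irr\<close>; the
  value is unspecified outside \<open>U(gl(n)) \<oplus> Irr\<close>.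
\<close>

definition virt_proj ::
    "nat \<Rightarrow> nat \<Rightarrow> nat \<Rightarrow> ((symb \<times> symb) word \<Rightarrow>\<^sub>0 complex) set
       \<Rightarrow> ((symb \<times> symb) word \<Rightarrow>\<^sub>0 complex) set" where
  "virt_proj m0 m1 n x =
     (THE y. y \<in> U_gln m0 m1 n \<and> (\<exists>z\<in>Irr m0 m1 n. x = y \<oplus>\<^bsub>U_gl m0 m1 n\<^esub> z))"


section \<open>Partitions and tableaux\<close>

definition partition_of :: "nat list \<Rightarrow> nat \<Rightarrow> bool" where
  "partition_of lam h \<longleftrightarrow>
     sorted_wrt (\<ge>) lam \<and> (\<forall>x\<in>set lam. x > 0) \<and> sum_list lam = h"

definition conjugate_partition :: "nat list \<Rightarrow> nat list" where
  "conjugate_partition lam =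
     map (\<lambda>c. length (filter (\<lambda>r. c < r) lam)) [0..<(if lam = [] then 0 else hd lam)]"

text \<open>
  A tableau is the list of its rows, so that its cells in reading order are listed by
  \<open>concat\<close>.
\<close>

definition shape :: "'a list list \<Rightarrow> nat list" where
  "shape T = map length T"

definition standard_tableau :: "nat list list \<Rightarrow> bool" where
  "standard_tableau T \<longleftrightarrow>
     (\<forall>row\<in>set T. sorted_wrt (<) row) \<and>
     (\<forall>r r' c. r < r' \<and> r' < length T \<and> c < length (T ! r) \<and> c < length (T ! r')
        \<longrightarrow> T ! r ! c \<le> T ! r' ! c)"

definition standard_tableaux :: "nat \<Rightarrow> nat list \<Rightarrow> nat list list set" where
  "standard_tableaux n lam =
     {T. shape T = lam \<and> set (concat T) \<subseteq> {1..n} \<and> standard_tableau T}"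

lemma finite_standard_tableaux: "finite (standard_tableaux n lam)"
proof (rule finite_subset)
  let ?R = "{xs. set xs \<subseteq> {1..n} \<and> length xs \<le> sum_list lam}"
  show "standard_tableaux n lam \<subseteq> {T. set T \<subseteq> ?R \<and> length T = length lam}"
    by (auto simp: standard_tableaux_def shape_def intro!: member_le_sum_list)
  show "finite {T. set T \<subseteq> ?R \<and> length T = length lam}"
    by (intro finite_lists_length_eq finite_lists_length_le) auto
qed

definition tab_C :: "nat list \<Rightarrow> symb list list" where
  "tab_C lam = map (\<lambda>r. replicate (lam ! r) (Alpha (Suc r))) [0..<length lam]"

definition tab_D :: "nat list \<Rightarrow> symb list list" where
  "tab_D lam = map (\<lambda>l. map (\<lambda>c. Beta (Suc c)) [0..<l]) lam"


section \<open>Capelli and Young-Capelli bitableaux\<close>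

definition e_bitab ::
    "nat \<Rightarrow> nat \<Rightarrow> nat \<Rightarrow> symb list list \<Rightarrow> symb list list \<Rightarrow> ((symb \<times> symb) word \<Rightarrow>\<^sub>0 complex) set" where
  "e_bitab m0 m1 n S T = U_class m0 m1 n (word_monom (zip (concat S) (concat T)))"

definition capelli_bitab ::
    "nat \<Rightarrow> nat \<Rightarrow> nat \<Rightarrow> nat list list \<Rightarrow> nat list list \<Rightarrow> ((symb \<times> symb) word \<Rightarrow>\<^sub>0 complex) set" where
  "capelli_bitab m0 m1 n S T =
     virt_proj m0 m1 n
       (e_bitab m0 m1 n (map (map Letter) S) (tab_C (shape S))
        \<otimes>\<^bsub>U_gl m0 m1 n\<^esub> e_bitab m0 m1 n (tab_C (shape S)) (map (map Letter) T))"

definition young_capelli_bitab ::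
    "nat \<Rightarrow> nat \<Rightarrow> nat \<Rightarrow> nat list list \<Rightarrow> nat list list \<Rightarrow> ((symb \<times> symb) word \<Rightarrow>\<^sub>0 complex) set" where
  "young_capelli_bitab m0 m1 n S T =
     virt_proj m0 m1 n
       (e_bitab m0 m1 n (map (map Letter) S) (tab_C (shape S))
        \<otimes>\<^bsub>U_gl m0 m1 n\<^esub> e_bitab m0 m1 n (tab_C (shape S)) (tab_D (shape S))
        \<otimes>\<^bsub>U_gl m0 m1 n\<^esub> e_bitab m0 m1 n (tab_D (shape S)) (map (map Letter) T))"


section \<open>Irreducible characters of the symmetric group\<close>

text \<open>
  A numbering is a bijective filling of the diagram of \<open>mu\<close> with \<open>1, \<dots>, h\<close>; its tabloid is
  the list of the sets of entries of its rows.
\<close>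

definition numbering :: "nat \<Rightarrow> nat list \<Rightarrow> nat list list \<Rightarrow> bool" where
  "numbering h mu t \<longleftrightarrow> shape t = mu \<and> distinct (concat t) \<and> set (concat t) = {1..h}"

definition tabloid :: "nat list list \<Rightarrow> nat set list" where
  "tabloid t = map set t"

definition column_set :: "nat list list \<Rightarrow> nat \<Rightarrow> nat set" where
  "column_set t c = {t ! r ! c | r. r < length t \<and> c < length (t ! r)}"

definition column_group :: "nat \<Rightarrow> nat list list \<Rightarrow> (nat \<Rightarrow> nat) set" where
  "column_group h t = {\<pi>. \<pi> permutes {1..h} \<and> (\<forall>c. \<pi> ` column_set t c = column_set t c)}"

definition polytabloid :: "nat \<Rightarrow> nat list list \<Rightarrow> (nat set list \<Rightarrow>\<^sub>0 complex)" where
  "polytabloid h t =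
     (\<Sum>\<pi>\<in>column_group h t.
        Poly_Mapping.single (tabloid (map (map \<pi>) t)) (of_int (sign \<pi>)))"

definition specht_module :: "nat \<Rightarrow> nat list \<Rightarrow> (nat set list \<Rightarrow>\<^sub>0 complex) set" where
  "specht_module h mu = cvs.span {polytabloid h t | t. numbering h mu t}"

definition tabloid_action ::
    "(nat \<Rightarrow> nat) \<Rightarrow> (nat set list \<Rightarrow>\<^sub>0 complex) \<Rightarrow> (nat set list \<Rightarrow>\<^sub>0 complex)" where
  "tabloid_action \<sigma> = pushforward (map (image \<sigma>))"

text \<open>
  The usual irreducible character attached to \<open>mu\<close>, namely that of the Specht module:
  \<open>(h)\<close> gives the trivial and \<open>(1\<^sup>h)\<close> the sign character.
\<close>

definition specht_character :: "nat \<Rightarrow> nat list \<Rightarrow> (nat \<Rightarrow> nat) \<Rightarrow> complex" where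
  "specht_character h mu \<sigma> = trace_on (specht_module h mu) (tabloid_action \<sigma>)"

text \<open>In the labelling used for immanants, \<open>(1\<^sup>h)\<close> gives the trivial and \<open>(h)\<close> the sign character.\<close>

definition irr_character :: "nat \<Rightarrow> nat list \<Rightarrow> (nat \<Rightarrow> nat) \<Rightarrow> complex" where
  "irr_character h lam = specht_character h (conjugate_partition lam)"


section \<open>Capelli immanants\<close>

text \<open>A sequence \<open>i\<^sub>1, \<dots>, i\<^sub>h\<close> is a function on \<open>{1..h}\<close>; it fills the column of shape \<open>(1\<^sup>h)\<close>.\<close>

definition column_tab :: "nat \<Rightarrow> (nat \<Rightarrow> nat) \<Rightarrow> nat list list" where
  "column_tab h i = map (\<lambda>k. [i k]) [1..<Suc h]"

definition Cimm ::
    "nat \<Rightarrow> nat \<Rightarrow> nat \<Rightarrow> nat \<Rightarrow> nat list \<Rightarrow> (nat \<Rightarrow> nat) \<Rightarrow> (nat \<Rightarrow> nat)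
       \<Rightarrow> ((symb \<times> symb) word \<Rightarrow>\<^sub>0 complex) set" where
  "Cimm m0 m1 n h lam i j =
     (\<Oplus>\<^bsub>U_gl m0 m1 n\<^esub>\<sigma>\<in>{\<sigma>. \<sigma> permutes {1..h}}.
        U_smult m0 m1 n (irr_character h lam \<sigma>)
          (capelli_bitab m0 m1 n (column_tab h (i \<circ> \<sigma>)) (column_tab h j)))"

end

theory Submission
  imports Defs "HOL-Library.Multiset" "HOL-Library.Nat_Bijection"
begin

text \<open>
  On polynomials in variables \<open>(a|k)\<close>, \<open>e\<^bsub>a,b\<^esub>\<close> acts as the polarization
  \<open>\<Sum>\<^sub>k (a|k) \<partial>/\<partial>(b|k)\<close>.  Irregular products annihilate the polynomials in the proper
  variables \<open>(i|k)\<close>, and \<open>U(gl(n))\<close> acts faithfully on these, so that the projection of an element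
  of the virtual algebra is determined by its action there.  By Wick's rule, column Capelli
  bitableaux act as normally ordered operators and Young--Capelli bitableaux as their Young
  symmetrizations.  Up to a nonzero scalar the character of a Specht module is the sum of the
  coefficient functions of the Young symmetrizers of all numberings.  The immanant is therefore a
  combination of Young--Capelli bitableaux of shape \<open>\<lambda>\<close> with arbitrary fillings, which
  Garnir relations in rows and columns reduce to standard ones.
\<close>

section \<open>Straightening of symmetrized fillings\<close>

text \<open>The projection is a definite description, so it says nothing until a decomposition
  exists and is unique; neither is assumed. Existence is shown for the words that occur, in which
  every virtual symbol is a lower index as often as an upper one. Uniqueness is a consequence of
  faithfulness, so that equality in the enveloping algebra becomes equality of all matrix
  coefficients \<open>N\<close>.

  Of \<open>N\<close> only two properties enter: it sees \<open>h\<close> pairs of letters, and it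
  does not change when these pairs are permuted. The coefficients of the final combination must not
  depend on \<open>N\<close>; therefore straightening is stated for all functionals at once.

  The alphas have parity 0 but anticommuting variables: polarizations see only sums of two parities,
  so all parities may be shifted by one, and the letters get ordinary commuting variables.
  Contracting alphas, which mark rows, yields alternating row sums. This agrees with the conjugate
  labelling of characters: the Specht module of the conjugate partition is built from sums
  alternating along its columns, that is along the rows of \<open>lam\<close>. The sign from
  reordering \<open>h\<close> factors is common to both kinds of bitableaux.\<close>

abbreviation finv :: "('a \<Rightarrow> 'b) \<Rightarrow> 'b \<Rightarrow> 'a" where
  "finv \<equiv> inv_into UNIV"

text \<open>The two linear characters of a symmetric group. One flag for both lets the same
  straightening argument treat the left tableau, with signs along rows, and the right one, without
  signs along columns.\<close>

definition char1 :: "bool \<Rightarrow> ('a \<Rightarrow> 'a) \<Rightarrow> complex" where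
  "char1 b p = (if b then of_int (sign p) else 1)"

section \<open>Row and column groups of a set of cells\<close>

definition line_perms :: "'a set \<Rightarrow> ('a \<Rightarrow> nat) \<Rightarrow> ('a \<Rightarrow> 'a) set" where
  "line_perms D line = {p. p permutes D \<and> (\<forall>x\<in>D. line (p x) = line x)}"

lemma char1_id [simp]: "char1 b id = 1"
  by (simp add: char1_def)

lemma char1_compose:
  "finite D \<Longrightarrow> p permutes D \<Longrightarrow> q permutes D \<Longrightarrow> char1 b (p \<circ> q) = char1 b p * char1 b q"
  by (simp add: char1_def sign_compose[OF permutes_imp_permutation[of D p] permutes_imp_permutation[of D q]])

lemma char1_square [simp]: "char1 b p * char1 b p = 1"
  by (simp add: char1_def flip: of_int_mult)

lemma char1_inv: "finite D \<Longrightarrow> p permutes D \<Longrightarrow> char1 b (finv p) = char1 b p"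
  by (simp add: char1_def sign_inverse[OF permutes_imp_permutation[of D p]])

lemma char1_transpose: "x \<noteq> y \<Longrightarrow> char1 b (Transposition.transpose x y) = (if b then -1 else 1)"
  by (simp add: char1_def sign_swap_id)

lemma line_perms_permutes: "p \<in> line_perms D line \<Longrightarrow> p permutes D"
  by (simp add: line_perms_def)

lemma finite_line_perms: "finite D \<Longrightarrow> finite (line_perms D line)"
  by (rule finite_subset[OF _ finite_permutations[of D]]) (auto simp: line_perms_def)

lemma id_line_perms [simp]: "id \<in> line_perms D line"
  by (simp add: line_perms_def permutes_id)

lemma line_perms_compose:
  "p \<in> line_perms D line \<Longrightarrow> q \<in> line_perms D line \<Longrightarrow> p \<circ> q \<in> line_perms D line"
  by (auto simp: line_perms_def permutes_compose permutes_in_image)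

lemma line_perms_inv: "p \<in> line_perms D line \<Longrightarrow> finv p \<in> line_perms D line"
proof -
  assume p: "p \<in> line_perms D line"
  then have pD: "p permutes D" by (rule line_perms_permutes)
  have "line (finv p x) = line x" if "x \<in> D" for x
  proof -
    have "finv p x \<in> D" using permutes_in_image[OF permutes_inv[OF pD]] that by simp
    then have "line (p (finv p x)) = line (finv p x)" using p by (simp add: line_perms_def)
    then show ?thesis by (simp add: permutes_inverses(1)[OF pD])
  qed
  then show "finv p \<in> line_perms D line" using permutes_inv[OF pD] by (simp add: line_perms_def)
qed

lemma transpose_line_perms:
  "x \<in> D \<Longrightarrow> y \<in> D \<Longrightarrow> line x = line y \<Longrightarrow> Transposition.transpose x y \<in> line_perms D line"
  by (auto simp: line_perms_def permutes_swap_id Transposition.transpose_def)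

lemma sum_line_perms_left:
  assumes "p \<in> line_perms D line"
  shows "(\<Sum>q\<in>line_perms D line. f (p \<circ> q)) = (\<Sum>q\<in>line_perms D line. f q)"
proof (rule sum.reindex_bij_witness[of _ "\<lambda>q. finv p \<circ> q" "\<lambda>q. p \<circ> q"])
  have p: "p permutes D" using assms by (rule line_perms_permutes)
  show "finv p \<circ> (p \<circ> q) = q" for q
    using permutes_inv_o(2)[OF p] by (metis comp_assoc id_comp)
  show "p \<circ> (finv p \<circ> q) = q" for q
    using permutes_inv_o(1)[OF p] by (metis comp_assoc id_comp)
qed (use assms in \<open>auto intro: line_perms_compose line_perms_inv\<close>)

lemma sum_permutes_transpose:
  assumes "finite E" "x \<in> E" "y \<in> E"
  shows "(\<Sum>q\<in>{q. q permutes E}. f (q \<circ> Transposition.transpose x y)) = (\<Sum>q\<in>{q. q permutes E}. f q)"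
  by (rule sum.reindex_bij_witness[of _ "\<lambda>q. q \<circ> Transposition.transpose x y" "\<lambda>q. q \<circ> Transposition.transpose x y"])
     (use assms in \<open>auto simp: comp_assoc intro: permutes_compose permutes_swap_id\<close>)

text \<open>The functional \<open>N\<close> evaluated on \<open>S\<close> times a Young symmetrizer;
  an identity for all \<open>N\<close> is one between formal sums of fillings. The group standing
  next to \<open>S\<close> is the one whose elements are absorbed up to their character, see
  \<open>symmetrized_line\<close>.\<close>

definition symmetrized ::
    "'a set \<Rightarrow> ('a \<Rightarrow> nat) \<Rightarrow> ('a \<Rightarrow> nat) \<Rightarrow> bool \<Rightarrow> (('a \<Rightarrow> 'b) \<Rightarrow> complex) \<Rightarrow> ('a \<Rightarrow> 'b) \<Rightarrow> complex" where
  "symmetrized D row col b N S =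
     (\<Sum>p\<in>line_perms D row. \<Sum>q\<in>line_perms D col. char1 b p * char1 (\<not> b) q * N (S \<circ> p \<circ> q))"

text \<open>Exchanging \<open>row\<close> with \<open>col\<close> and negating \<open>b\<close>
  gives the same condition, so both tableaux are straightened into the same set of fillings.\<close>

definition std_filling ::
    "'a set \<Rightarrow> ('a \<Rightarrow> nat) \<Rightarrow> ('a \<Rightarrow> nat) \<Rightarrow> bool \<Rightarrow> ('a \<Rightarrow> nat) \<Rightarrow> bool" where
  "std_filling D row col b S \<longleftrightarrow>
     (\<forall>x\<in>D. \<forall>y\<in>D. row x = row y \<and> col x < col y \<longrightarrow> (if b then S x < S y else S x \<le> S y)) \<and>
     (\<forall>x\<in>D. \<forall>y\<in>D. col x = col y \<and> row x < row y \<longrightarrow> (if b then S x \<le> S y else S x < S y))"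

lemma compose_PiE:
  assumes "p permutes D" "k \<in> PiE D (\<lambda>_. K)"
  shows "k \<circ> p \<in> PiE D (\<lambda>_. K)"
proof (rule PiE_I)
  fix x assume "x \<in> D"
  then have "p x \<in> D" using permutes_in_image[OF assms(1)] by simp
  then show "(k \<circ> p) x \<in> K" using assms(2) by (auto simp: PiE_def)
next
  fix x assume "x \<notin> D"
  then show "(k \<circ> p) x = undefined" using permutes_not_in[OF assms(1)] assms(2)
    by (auto simp: PiE_def extensional_def)
qed

text \<open>Young diagrams as sets of positions with coordinates: transposition merely exchanges two
  parameters, and the positions may be the numbers of the cells in reading order.\<close>

locale young_cells =
  fixes D :: "'a set" and row col :: "'a \<Rightarrow> nat"
  assumes fin: "finite D"
    and cell_inj: "x \<in> D \<Longrightarrow> y \<in> D \<Longrightarrow> row x = row y \<Longrightarrow> col x = col y \<Longrightarrow> x = y"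
    and down: "x \<in> D \<Longrightarrow> r \<le> row x \<Longrightarrow> c \<le> col x \<Longrightarrow> \<exists>y\<in>D. row y = r \<and> col y = c"
begin

lemma transposed: "young_cells D col row"
  using fin cell_inj down by unfold_locales metis+

lemma symmetrized_line:
  assumes p: "p \<in> line_perms D row"
  shows "symmetrized D row col b N (S \<circ> p) = char1 b p * symmetrized D row col b N S"
proof -
  let ?g = "\<lambda>r. \<Sum>q\<in>line_perms D col. char1 b p * char1 b r * char1 (\<not> b) q * N (S \<circ> r \<circ> q)"
  have "symmetrized D row col b N (S \<circ> p) = (\<Sum>r\<in>line_perms D row. ?g (p \<circ> r))"
    unfolding symmetrized_def
  proof (intro sum.cong refl)
    fix r q assume r: "r \<in> line_perms D row"
    have "char1 b p * char1 b (p \<circ> r) = char1 b r"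
      using char1_compose[OF fin line_perms_permutes[OF p] line_perms_permutes[OF r], of b]
      by (simp add: mult.assoc[symmetric])
    then show "char1 b r * char1 (\<not> b) q * N (S \<circ> p \<circ> r \<circ> q) =
         char1 b p * char1 b (p \<circ> r) * char1 (\<not> b) q * N (S \<circ> (p \<circ> r) \<circ> q)"
      by (simp add: comp_assoc)
  qed
  also have "\<dots> = (\<Sum>r\<in>line_perms D row. ?g r)" by (rule sum_line_perms_left[OF p])
  also have "\<dots> = char1 b p * symmetrized D row col b N S"
    by (simp add: symmetrized_def sum_distrib_left mult_ac)
  finally show ?thesis .
qed

text \<open>
  Pigeonhole: after any permutation \<open>p\<close> of the lines, two cells of \<open>A \<union> B\<close> lie in the same
  column, and their transposition is weighted by opposite signs in the two sums.
\<close>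

lemma symmetrized_garnir:
  assumes A: "A \<subseteq> {x\<in>D. row x = r}" and B: "B \<subseteq> {x\<in>D. row x = Suc r}"
    and card: "card A + card B > card {x\<in>D. row x = r}"
  shows "(\<Sum>s\<in>{s. s permutes A \<union> B}. char1 b s * symmetrized D row col b N (S \<circ> s)) = 0"
proof -
  let ?P = "{s. s permutes A \<union> B}"
  have finAB: "finite (A \<union> B)" "A \<union> B \<subseteq> D"
    using A B fin by (auto intro: finite_subset[of _ D])
  have main: "(\<Sum>s\<in>?P. \<Sum>q\<in>line_perms D col. char1 b s * (char1 b p * char1 (\<not> b) q * N (S \<circ> s \<circ> p \<circ> q))) = 0"
    (is "?X = 0") if p: "p \<in> line_perms D row" for p
  proof -
    have pD: "p permutes D" using p by (rule line_perms_permutes)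
    have ip: "finv p \<in> line_perms D row" using p by (rule line_perms_inv)
    have ipD: "finv p permutes D" using ip by (rule line_perms_permutes)
    have inD: "finv p x \<in> D" "row (finv p x) = row x" if "x \<in> D" for x
      using ip that permutes_in_image[OF ipD] by (auto simp: line_perms_def)
    have rA: "row z = r" if "z \<in> A" for z using that A by auto
    have rB: "row z = Suc r" if "z \<in> B" for z using that B by auto
    have disj: "A \<inter> B = {}"
    proof (rule equals0I)
      fix z assume "z \<in> A \<inter> B"
      then show False using rA[of z] rB[of z] by simp
    qed
    let ?R = "{x\<in>D. row x = r}"
    have "\<exists>x\<in>A. \<exists>y\<in>B. col (finv p x) = col (finv p y)"
    proof (rule ccontr)
      assume no: "\<not> ?thesis"
      have cAB: "card ((\<lambda>x. col (finv p x)) ` (A \<union> B)) = card (A \<union> B)"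
      proof (rule card_image, rule inj_onI)
        fix x y assume xy: "x \<in> A \<union> B" "y \<in> A \<union> B" and e: "col (finv p x) = col (finv p y)"
        have "row x = row y"
        proof -
          consider "x \<in> A" "y \<in> A" | "x \<in> B" "y \<in> B" | "x \<in> A" "y \<in> B" | "x \<in> B" "y \<in> A"
            using xy by blast
          then show ?thesis
          proof cases
            case 3 then show ?thesis using no e by blast
          next
            case 4 then show ?thesis using no e[symmetric] by blast
          qed (simp_all add: rA rB)
        qed
        have D: "x \<in> D" "y \<in> D" using xy finAB(2) by blast+
        have "finv p x = finv p y"
          using inD(1)[OF D(1)] inD(1)[OF D(2)] _ e
          by (rule cell_inj) (simp only: inD(2)[OF D(1)] inD(2)[OF D(2)] \<open>row x = row y\<close>)
        then show "x = y" using permutes_inj[OF ipD] by (simp add: inj_eq)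
      qed
      \<comment> \<open>The permuted cells stay in rows \<open>r\<close> and \<open>Suc r\<close>,
        and the diagram is closed upwards, so all their columns meet row \<open>r\<close>.\<close>
      have "(\<lambda>x. col (finv p x)) ` (A \<union> B) \<subseteq> col ` ?R"
      proof
        fix c assume "c \<in> (\<lambda>x. col (finv p x)) ` (A \<union> B)"
        then obtain x where x: "x \<in> A \<union> B" "c = col (finv p x)" by auto
        have xD: "x \<in> D" "r \<le> row x" using x(1) A B by auto
        have "r \<le> row (finv p x)" using inD(2)[OF xD(1)] xD(2) by simp
        then obtain y where "y \<in> D" "row y = r" "col y = c"
          using down[OF inD(1)[OF xD(1)], of r c] x(2) by blast
        then show "c \<in> col ` ?R" by auto
      qed
      then have "card ((\<lambda>x. col (finv p x)) ` (A \<union> B)) \<le> card (col ` ?R)"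
        using fin by (intro card_mono) auto
      also have "\<dots> \<le> card ?R" using fin by (intro card_image_le) auto
      finally have "card (A \<union> B) \<le> card ?R" using cAB by simp
      moreover have "card (A \<union> B) = card A + card B"
        using finAB disj by (intro card_Un_disjoint) auto
      ultimately show False using card by simp
    qed
    then obtain x y where xy: "x \<in> A" "y \<in> B" "col (finv p x) = col (finv p y)" by auto
    define x' y' where "x' = finv p x" and "y' = finv p y"
    have xyD: "x \<in> D" "y \<in> D" "x \<noteq> y" using xy A B disj by auto
    have ne': "x' \<noteq> y'" using xyD(3) permutes_inj[OF ipD] by (auto simp: x'_def y'_def inj_eq)
    have conj: "Transposition.transpose x y \<circ> p = p \<circ> Transposition.transpose x' y'"
      using permutes_inverses[OF pD] permutes_inj[OF pD]
      by (auto simp: fun_eq_iff Transposition.transpose_def x'_def y'_def inj_eq)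
    have t': "Transposition.transpose x' y' \<in> line_perms D col"
      unfolding x'_def y'_def using inD(1)[OF xyD(1)] inD(1)[OF xyD(2)] xy(3)
      by (rule transpose_line_perms)
    have tD: "Transposition.transpose x y permutes A \<union> B"
      using xy by (intro permutes_swap_id) auto
    have "?X = (\<Sum>s\<in>?P. \<Sum>q\<in>line_perms D col. char1 b (s \<circ> Transposition.transpose x y) *
          (char1 b p * char1 (\<not> b) q * N (S \<circ> (s \<circ> Transposition.transpose x y) \<circ> p \<circ> q)))"
      by (rule sum_permutes_transpose[symmetric]) (use finAB xy in auto)
    also have "\<dots> = (\<Sum>s\<in>?P. \<Sum>q\<in>line_perms D col.
        - (char1 b s * (char1 b p * char1 (\<not> b) (Transposition.transpose x' y' \<circ> q) *
            N (S \<circ> s \<circ> p \<circ> (Transposition.transpose x' y' \<circ> q)))))"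
    proof (intro sum.cong refl)
      fix s q assume s: "s \<in> ?P" and q: "q \<in> line_perms D col"
      have 1: "char1 b (s \<circ> Transposition.transpose x y) = char1 b s * char1 b (Transposition.transpose x y)"
        using s tD finAB by (intro char1_compose[of "A \<union> B"]) auto
      have 2: "char1 (\<not> b) (Transposition.transpose x' y' \<circ> q) =
          char1 (\<not> b) (Transposition.transpose x' y') * char1 (\<not> b) q"
        using t' q fin by (intro char1_compose[of D]) (auto intro: line_perms_permutes)
      have 3: "S \<circ> (s \<circ> Transposition.transpose x y) \<circ> p \<circ> q =
          S \<circ> s \<circ> p \<circ> (Transposition.transpose x' y' \<circ> q)"
        using conj by (metis comp_assoc)
      show "char1 b (s \<circ> Transposition.transpose x y) *
          (char1 b p * char1 (\<not> b) q * N (S \<circ> (s \<circ> Transposition.transpose x y) \<circ> p \<circ> q)) =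
          - (char1 b s * (char1 b p * char1 (\<not> b) (Transposition.transpose x' y' \<circ> q) *
            N (S \<circ> s \<circ> p \<circ> (Transposition.transpose x' y' \<circ> q))))"
        unfolding 1 2 3 char1_transpose[OF xyD(3)] char1_transpose[OF ne'] by (cases b) auto
    qed
    also have "\<dots> = - ?X"
      by (simp only: sum_negf sum_line_perms_left[OF t',
        where f = "\<lambda>q. char1 b _ * (char1 b p * char1 (\<not> b) q * N (S \<circ> _ \<circ> p \<circ> q))"])
    finally show "?X = 0" by simp
  qed
  have "(\<Sum>s\<in>?P. char1 b s * symmetrized D row col b N (S \<circ> s)) =
     (\<Sum>p\<in>line_perms D row. \<Sum>s\<in>?P. \<Sum>q\<in>line_perms D col.
        char1 b s * (char1 b p * char1 (\<not> b) q * N (S \<circ> s \<circ> p \<circ> q)))"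
    unfolding symmetrized_def sum_distrib_left by (rule sum.swap)
  also have "\<dots> = 0" using main by simp
  finally show ?thesis .
qed

text \<open>The coefficients are chosen before \<open>N\<close>. Later \<open>N\<close> runs through
  all matrix coefficients of an operator, and one combination has to serve them all.\<close>

definition reducible :: "bool \<Rightarrow> nat \<Rightarrow> ('a \<Rightarrow> nat) \<Rightarrow> bool" where
  "reducible b n S \<longleftrightarrow>
     (\<exists>\<rho>. \<forall>N. symmetrized D row col b N S =
        (\<Sum>S'\<in>{S' \<in> PiE D (\<lambda>_. {1..n}). std_filling D row col b S'}. \<rho> S' * symmetrized D row col b N S'))"

lemma reducible_std:
  assumes "S \<in> PiE D (\<lambda>_. {1..n})" "std_filling D row col b S"
  shows "reducible b n S"
proof -
  let ?Std = "{S' \<in> PiE D (\<lambda>_. {1..n}). std_filling D row col b S'}"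
  have fin_std: "finite ?Std" using fin by (simp add: finite_PiE)
  have "symmetrized D row col b N S =
      (\<Sum>S'\<in>?Std. (if S' = S then 1 else 0) * symmetrized D row col b N S')" for N
  proof -
    have "(\<Sum>S'\<in>?Std. (if S' = S then 1 else 0) * symmetrized D row col b N S') =
        (\<Sum>S'\<in>?Std. if S' = S then symmetrized D row col b N S' else 0)"
      by (intro sum.cong) auto
    also have "\<dots> = symmetrized D row col b N S"
      using assms by (subst sum.delta[OF fin_std]) auto
    finally show ?thesis by (rule sym)
  qed
  then show ?thesis
    unfolding reducible_def by (intro exI[of _ "\<lambda>S'. if S' = S then 1 else 0"] allI)
qed

lemma reducible_combination:
  assumes "\<And>k. k \<in> K \<Longrightarrow> reducible b n (T k)"
    and "\<And>N. symmetrized D row col b N S = (\<Sum>k\<in>K. a k * symmetrized D row col b N (T k))"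
  shows "reducible b n S"
proof -
  let ?Std = "{S' \<in> PiE D (\<lambda>_. {1..n}). std_filling D row col b S'}"
  have "\<forall>k\<in>K. \<exists>\<rho>. \<forall>N. symmetrized D row col b N (T k) = (\<Sum>S'\<in>?Std. \<rho> S' * symmetrized D row col b N S')"
    using assms(1) unfolding reducible_def by blast
  from bchoice[OF this] obtain \<rho> where \<rho>: "\<And>k N. k \<in> K \<Longrightarrow>
      symmetrized D row col b N (T k) = (\<Sum>S'\<in>?Std. \<rho> k S' * symmetrized D row col b N S')"
    by blast
  have "symmetrized D row col b N S = (\<Sum>S'\<in>?Std. (\<Sum>k\<in>K. a k * \<rho> k S') * symmetrized D row col b N S')" for N
  proof -
    have "symmetrized D row col b N S =
        (\<Sum>k\<in>K. \<Sum>S'\<in>?Std. a k * (\<rho> k S' * symmetrized D row col b N S'))"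
      unfolding assms(2) by (intro sum.cong refl) (simp only: \<rho> sum_distrib_left)
    also have "\<dots> = (\<Sum>S'\<in>?Std. \<Sum>k\<in>K. a k * (\<rho> k S' * symmetrized D row col b N S'))"
      by (rule sum.swap)
    finally show ?thesis by (simp only: sum_distrib_right mult.assoc)
  qed
  then show ?thesis
    unfolding reducible_def by (intro exI[of _ "\<lambda>S'. \<Sum>k\<in>K. a k * \<rho> k S'"] allI)
qed

text \<open>
  If a permutation of \<open>A \<union> B\<close> does not change the sum of the entries in \<open>A\<close>, it exchanges
  only entries equal to the common bound \<open>v\<close>; composing it with an exchange of their positions
  gives a permutation of the lines.
\<close>

lemma garnir_term:
  fixes S :: "'a \<Rightarrow> nat"
  assumes A: "A \<subseteq> {x\<in>D. row x = r}" and B: "B \<subseteq> {x\<in>D. row x = Suc r}"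
    and lo: "\<And>x. x \<in> A \<Longrightarrow> v \<le> S x" and hi: "\<And>x. x \<in> B \<Longrightarrow> if b then S x < v else S x \<le> v"
    and s: "s permutes A \<union> B"
  shows "(\<Sum>x\<in>A. S (s x)) \<le> (\<Sum>x\<in>A. S x)" (is ?le)
    and "(\<Sum>x\<in>A. S (s x)) = (\<Sum>x\<in>A. S x) \<Longrightarrow>
           char1 b s * symmetrized D row col b N (S \<circ> s) = symmetrized D row col b N S"
proof -
  have finA: "finite A" "finite B" using A B fin by (auto intro: finite_subset[of _ D])
  have rA: "z \<in> D" "row z = r" if "z \<in> A" for z using that A by auto
  have rB: "z \<in> D" "row z = Suc r" if "z \<in> B" for z using that B by auto
  have disj: "A \<inter> B = {}"
  proof (rule equals0I)
    fix z assume "z \<in> A \<inter> B"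
    then show False using rA(2)[of z] rB(2)[of z] by simp
  qed
  define P where "P = {x\<in>A. s x \<in> B}"
  define Q where "Q = {x\<in>B. s x \<in> A}"
  have finPQ: "finite P" "finite Q" using finA by (auto simp: P_def Q_def)
  have sin: "s x \<in> A \<union> B \<longleftrightarrow> x \<in> A \<union> B" for x using permutes_in_image[OF s] .
  have inj: "inj s" using s by (rule permutes_inj)
  have imA: "s ` ((A - P) \<union> Q) = A"
  proof
    show "s ` ((A - P) \<union> Q) \<subseteq> A" using sin by (auto simp: P_def Q_def)
    show "A \<subseteq> s ` ((A - P) \<union> Q)"
    proof
      fix y assume y: "y \<in> A"
      then obtain x where x: "y = s x" using permutes_surj[OF s] by (metis surjD)
      then have "x \<in> A \<union> B" using y sin[of x] by auto
      then have "x \<in> (A - P) \<union> Q" using x y disj by (auto simp: P_def Q_def)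
      then show "y \<in> s ` ((A - P) \<union> Q)" using x by auto
    qed
  qed
  have dj: "(A - P) \<inter> Q = {}" using disj by (auto simp: P_def Q_def)
  have "card A = card (A - P) + card Q"
    using arg_cong[OF imA, of card] inj finA finPQ dj
    by (simp add: card_image inj_on_subset card_Un_disjoint)
  moreover have "card A = card (A - P) + card P"
    using finA finPQ by (simp add: P_def card_Diff_subset card_mono)
  ultimately have cPQ: "card P = card Q" by simp
  have sA: "(\<Sum>x\<in>A. S x) = (\<Sum>x\<in>A - P. S (s x)) + (\<Sum>x\<in>Q. S (s x))"
  proof -
    have "(\<Sum>x\<in>A. S x) = (\<Sum>x\<in>s ` ((A - P) \<union> Q). S x)" by (simp add: imA)
    also have "\<dots> = (\<Sum>x\<in>(A - P) \<union> Q. S (s x))"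
      using inj by (subst sum.reindex) (auto intro: inj_on_subset)
    finally show ?thesis using finA finPQ dj by (simp add: sum.union_disjoint)
  qed
  have sAs: "(\<Sum>x\<in>A. S (s x)) = (\<Sum>x\<in>A - P. S (s x)) + (\<Sum>x\<in>P. S (s x))"
    using finA by (subst sum.subset_diff[of P A]) (auto simp: P_def)
  have P_hi: "S (s x) \<le> v" if "x \<in> P" for x using that hi[of "s x"] by (auto simp: P_def split: if_splits)
  have Q_lo: "v \<le> S (s x)" if "x \<in> Q" for x using that lo[of "s x"] by (auto simp: Q_def)
  have P_sum: "(\<Sum>x\<in>P. S (s x)) \<le> card P * v" using P_hi sum_bounded_above[of P "\<lambda>x. S (s x)" v] by simp
  have Q_sum: "card Q * v \<le> (\<Sum>x\<in>Q. S (s x))" using Q_lo sum_bounded_below[of Q v "\<lambda>x. S (s x)"] by simp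
  show ?le using sA sAs P_sum Q_sum cPQ by simp
  assume eq: "(\<Sum>x\<in>A. S (s x)) = (\<Sum>x\<in>A. S x)"
  have Pv: "(\<Sum>x\<in>P. S (s x)) = (\<Sum>x\<in>P. v)" and Qv: "(\<Sum>x\<in>Q. v) = (\<Sum>x\<in>Q. S (s x))"
    using eq sA sAs P_sum Q_sum cPQ by auto
  have Pv': "S (s x) = v" if "x \<in> P" for x
    using sum_mono_inv[OF Pv P_hi that finPQ(1)] .
  have Qv': "S (s x) = v" if "x \<in> Q" for x
    using sum_mono_inv[OF Qv Q_lo that finPQ(2)] by simp
  have AB: "A \<union> B \<subseteq> D" using A B by auto
  have sD: "s permutes D" using s AB by (rule permutes_subset)
  obtain f where f: "bij_betw f P Q"
    using finPQ cPQ by (metis bij_betw_iff_card)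
  define w where "w = (\<lambda>x. if x \<in> P then f x else if x \<in> Q then inv_into P f x else x)"
  have PQ: "P \<inter> Q = {}" "P \<subseteq> A" "Q \<subseteq> B" using disj by (auto simp: P_def Q_def)
  have wP: "w x \<in> Q" if "x \<in> P" for x using that f by (auto simp: w_def bij_betw_def)
  have wQ: "w x \<in> P" if "x \<in> Q" for x
    using that f PQ by (auto simp: w_def bij_betw_def intro: inv_into_into)
  have w0: "w x = x" if "x \<notin> P \<union> Q" for x using that by (simp add: w_def)
  have ww: "w (w x) = x" for x
  proof -
    consider "x \<in> P" | "x \<in> Q" | "x \<notin> P \<union> Q" by auto
    then show ?thesis
    proof cases
      case 1 then show ?thesis using f PQ wP[OF 1] by (auto simp: w_def bij_betw_def)
    next
      case 2
      then have "f (inv_into P f x) = x" using f by (auto simp: bij_betw_def f_inv_into_f)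
      then show ?thesis using 2 PQ wQ[OF 2] by (auto simp: w_def)
    qed (simp add: w0)
  qed
  have wAB: "w permutes A \<union> B"
    unfolding permutes_def using w0 PQ ww by (metis Un_iff subsetD)
  have wD: "w permutes D" using wAB AB by (rule permutes_subset)
  have Ssw: "S \<circ> s \<circ> w = S \<circ> s"
  proof
    fix x
    consider "x \<in> P" | "x \<in> Q" | "x \<notin> P \<union> Q" by auto
    then show "(S \<circ> s \<circ> w) x = (S \<circ> s) x"
      by cases (auto simp: Pv' Qv' w0 dest: wP wQ)
  qed
  have line: "s \<circ> w \<in> line_perms D row"
  proof -
    have "row (s (w x)) = row x" if "x \<in> D" for x
    proof -
      consider "x \<in> P" | "x \<in> Q" | "x \<in> A - P" | "x \<in> B - Q" | "x \<notin> A \<union> B" by auto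
      then show ?thesis
      proof cases
        case 1
        then have "s (w x) \<in> A" "x \<in> A" using wP[OF 1] by (auto simp: P_def Q_def)
        then show ?thesis by (simp add: rA)
      next
        case 2
        then have "s (w x) \<in> B" "x \<in> B" using wQ[OF 2] by (auto simp: P_def Q_def)
        then show ?thesis by (simp add: rB)
      next
        case 3
        then have "x \<notin> P \<union> Q" using PQ disj by auto
        then have "s (w x) \<in> A" using w0[of x] sin[of x] 3 by (auto simp: P_def)
        then show ?thesis using 3 by (simp add: rA)
      next
        case 4
        then have "x \<notin> P \<union> Q" using PQ disj by auto
        then have "s (w x) \<in> B" using w0[of x] sin[of x] 4 by (auto simp: Q_def)
        then show ?thesis using 4 by (simp add: rB)
      next
        case 5
        then have "x \<notin> P \<union> Q" using PQ by auto
        then show ?thesis using w0[of x] permutes_not_in[OF s, of x] 5 by simp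
      qed
    qed
    then show ?thesis using permutes_compose[OF wD sD] by (auto simp: line_perms_def)
  qed
  \<comment> \<open>With \<open>b\<close> the entries of \<open>B\<close> lie strictly below
    \<open>v\<close>, so nothing is exchanged and \<open>w\<close> is the identity; otherwise the
    character is trivial.\<close>
  have cw: "char1 b w = 1"
  proof (cases b)
    case True
    have "P = {}"
    proof (rule ccontr)
      assume "P \<noteq> {}"
      then obtain x where "x \<in> P" by auto
      then show False using Pv'[of x] hi[of "s x"] True by (auto simp: P_def)
    qed
    moreover have "Q = {}" using cPQ calculation finPQ by simp
    ultimately have "w = id" using w0 by auto
    then show ?thesis by simp
  qed (simp add: char1_def)
  have "symmetrized D row col b N (S \<circ> s) = symmetrized D row col b N (S \<circ> (s \<circ> w))"
    by (metis Ssw comp_assoc)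
  also have "\<dots> = char1 b (s \<circ> w) * symmetrized D row col b N S" by (rule symmetrized_line[OF line])
  also have "char1 b (s \<circ> w) = char1 b s" using char1_compose[OF fin sD wD] cw by simp
  finally have e: "symmetrized D row col b N (S \<circ> s) = char1 b s * symmetrized D row col b N S" .
  show "char1 b s * symmetrized D row col b N (S \<circ> s) = symmetrized D row col b N S"
    unfolding e mult.assoc[symmetric] char1_square by simp
qed

text \<open>The two segments overlap in the column of \<open>x\<close>: the lower one has
  \<open>Suc (col x)\<close> cells, while the upper one omits at most \<open>col x\<close> cells of
  its row.\<close>

lemma card_line_segments:
  assumes "x \<in> D" "y \<in> D" "row y = Suc (row x)" "col y = col x"
  shows "card {z\<in>D. row z = row x \<and> col x \<le> col z} + card {z\<in>D. row z = Suc (row x) \<and> col z \<le> col x}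
           > card {z\<in>D. row z = row x}"
proof -
  let ?R = "{z\<in>D. row z = row x}"
  have inj: "inj_on col {z\<in>D. row z = r}" for r by (auto intro!: inj_onI cell_inj)
  have eq: "col ` {z\<in>D. row z = Suc (row x) \<and> col z \<le> col x} = {..col x}"
    using down[OF assms(2), of "Suc (row x)"] assms by (auto simp: image_iff)
  have "card {z\<in>D. row z = Suc (row x) \<and> col z \<le> col x} = Suc (col x)"
  proof -
    have "inj_on col {z\<in>D. row z = Suc (row x) \<and> col z \<le> col x}"
      by (rule inj_on_subset[OF inj[of "Suc (row x)"]]) blast
    from card_image[OF this] show ?thesis unfolding eq by simp
  qed
  moreover have "card {z\<in>D. row z = row x \<and> col z < col x} \<le> card {..<col x}"
    by (rule card_inj_on_le[of col]) (auto intro!: inj_onI cell_inj)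
  moreover have "card ?R = card {z\<in>D. row z = row x \<and> col x \<le> col z} + card {z\<in>D. row z = row x \<and> col z < col x}"
    using fin by (subst card_Un_disjoint[symmetric]) (auto intro!: arg_cong[of _ _ card])
  ultimately show ?thesis by simp
qed

text \<open>The total over \<open>A \<union> B\<close> is invariant, so what leaves row
  \<open>r\<close> arrives in row \<open>Suc r\<close>, where it counts once more: the row weight
  grows by exactly the loss of \<open>A\<close>.\<close>

lemma sum_row_weight:
  fixes S :: "'a \<Rightarrow> nat"
  assumes A: "A \<subseteq> {x\<in>D. row x = r}" and B: "B \<subseteq> {x\<in>D. row x = Suc r}"
    and s: "s permutes A \<union> B"
  shows "(\<Sum>x\<in>D. row x * S (s x)) + (\<Sum>x\<in>A. S (s x)) = (\<Sum>x\<in>D. row x * S x) + (\<Sum>x\<in>A. S x)"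
proof -
  have finA: "finite A" "finite B" using A B fin by (auto intro: finite_subset[of _ D])
  have rA: "z \<in> D" "row z = r" if "z \<in> A" for z using that A by auto
  have rB: "z \<in> D" "row z = Suc r" if "z \<in> B" for z using that B by auto
  have disj: "A \<inter> B = {}"
  proof (rule equals0I)
    fix z assume "z \<in> A \<inter> B"
    then show False using rA(2)[of z] rB(2)[of z] by simp
  qed
  have split: "(\<Sum>x\<in>D. row x * g x) + (\<Sum>x\<in>A. g x) =
      (\<Sum>x\<in>D - (A \<union> B). row x * g x) + Suc r * (\<Sum>x\<in>A \<union> B. g x)" for g :: "'a \<Rightarrow> nat"
  proof -
    have "(\<Sum>x\<in>D. row x * g x) = (\<Sum>x\<in>D - (A \<union> B). row x * g x) + (\<Sum>x\<in>A \<union> B. row x * g x)"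
      using A B fin by (intro sum.subset_diff) auto
    also have "(\<Sum>x\<in>A \<union> B. row x * g x) = (\<Sum>x\<in>A. row x * g x) + (\<Sum>x\<in>B. row x * g x)"
      using disj finA by (intro sum.union_disjoint) auto
    also have "(\<Sum>x\<in>A. row x * g x) = r * (\<Sum>x\<in>A. g x)"
      unfolding sum_distrib_left by (intro sum.cong) (simp_all add: rA)
    also have "(\<Sum>x\<in>B. row x * g x) = Suc r * (\<Sum>x\<in>B. g x)"
      unfolding sum_distrib_left by (intro sum.cong) (simp_all add: rB)
    finally show ?thesis
      using disj finA by (subst sum.union_disjoint[of A B]) (auto simp: algebra_simps)
  qed
  have "(\<Sum>x\<in>A \<union> B. S (s x)) = (\<Sum>x\<in>A \<union> B. S x)"
    using sum.permute[OF s, of S] by (simp add: comp_def)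
  moreover have "(\<Sum>x\<in>D - (A \<union> B). row x * S (s x)) = (\<Sum>x\<in>D - (A \<union> B). row x * S x)"
    using permutes_not_in[OF s] by (intro sum.cong) auto
  ultimately show ?thesis by (simp only: split)
qed

lemma weight_bound:
  assumes "S \<in> PiE D (\<lambda>_. {1..n})"
  shows "(\<Sum>x\<in>D. row x * S x) \<le> (\<Sum>x\<in>D. row x * n)" "(\<Sum>x\<in>D. col x * S x) \<le> (\<Sum>x\<in>D. col x * n)"
  using assms by (auto intro!: sum_mono mult_left_mono simp: PiE_def Pi_def)

text \<open>Undoing an inversion within a row costs only a character value. The row weight stays,
  and moving the larger entry to the right raises the column weight.\<close>

lemma exchange_reducible:
  assumes S: "S \<in> PiE D (\<lambda>_. {1..n})"
    and xy: "x \<in> D" "y \<in> D" "row x = row y" "col x < col y" "S y < S x"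
    and IH: "\<And>T. T \<in> PiE D (\<lambda>_. {1..n}) \<Longrightarrow> (\<Sum>z\<in>D. row z * T z) = (\<Sum>z\<in>D. row z * S z) \<Longrightarrow>
        (\<Sum>z\<in>D. col z * T z) > (\<Sum>z\<in>D. col z * S z) \<Longrightarrow> reducible b n T"
  shows "reducible b n S"
proof -
  let ?t = "Transposition.transpose x y"
  have tl: "?t \<in> line_perms D row" using xy by (intro transpose_line_perms) auto
  have tp: "?t permutes D" using tl by (rule line_perms_permutes)
  have ne: "x \<noteq> y" using xy by auto
  have row: "(\<Sum>z\<in>D. row z * (S \<circ> ?t) z) = (\<Sum>z\<in>D. row z * S z)"
  proof -
    have "(\<Sum>z\<in>D. row z * (S \<circ> ?t) z) = (\<Sum>z\<in>D. row (?t z) * S (?t z))"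
      using tl by (intro sum.cong) (auto simp: line_perms_def)
    also have "\<dots> = (\<Sum>z\<in>D. row z * S z)"
      using sum.permute[OF tp, of "\<lambda>z. row z * S z"] by (simp add: comp_def)
    finally show ?thesis .
  qed
  have split: "(\<Sum>z\<in>D. col z * T z) = (\<Sum>z\<in>D - {x, y}. col z * T z) + (col x * T x + col y * T y)" for T :: "'a \<Rightarrow> nat"
    using fin xy ne by (subst sum.subset_diff[of "{x, y}" D]) auto
  have "col x * S x + col y * S y < col x * S y + col y * S x"
  proof -
    obtain d e where "col y = col x + Suc d" "S x = S y + Suc e"
      using xy(4,5) by (metis add_Suc_right less_imp_Suc_add)
    then show ?thesis by (simp add: algebra_simps)
  qed
  then have col: "(\<Sum>z\<in>D. col z * (S \<circ> ?t) z) > (\<Sum>z\<in>D. col z * S z)"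
    unfolding split by (simp add: Transposition.transpose_def)
  have "reducible b n (S \<circ> ?t)"
    using compose_PiE[OF tp S] row col by (rule IH)
  moreover have "symmetrized D row col b N S = char1 b ?t * symmetrized D row col b N (S \<circ> ?t)" for N
    by (simp add: symmetrized_line[OF tl] mult.assoc[symmetric])
  ultimately show ?thesis
    by (rule_tac reducible_combination[of "{()}" b n "\<lambda>_. S \<circ> ?t" S "\<lambda>_. char1 b ?t"]) auto
qed

text \<open>In the vanishing Garnir sum the permutations of \<open>G\<close>, those keeping the sum
  of the entries in \<open>A\<close>, each reproduce the term of \<open>S\<close>, so
  \<open>S\<close> occurs with the nonzero factor \<open>card G\<close>. All other terms shift
  weight to the lower row and are covered by induction.\<close>

lemma garnir_reducible:
  assumes S: "S \<in> PiE D (\<lambda>_. {1..n})"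
    and sorted: "\<And>x y. x \<in> D \<Longrightarrow> y \<in> D \<Longrightarrow> row x = row y \<Longrightarrow> col x \<le> col y \<Longrightarrow> S x \<le> S y"
    and xy: "x \<in> D" "y \<in> D" "col x = col y" "row y = Suc (row x)" "if b then S y < S x else S y \<le> S x"
    and IH: "\<And>T. T \<in> PiE D (\<lambda>_. {1..n}) \<Longrightarrow> (\<Sum>z\<in>D. row z * T z) > (\<Sum>z\<in>D. row z * S z) \<Longrightarrow> reducible b n T"
  shows "reducible b n S"
proof -
  define A where "A = {z\<in>D. row z = row x \<and> col x \<le> col z}"
  define B where "B = {z\<in>D. row z = Suc (row x) \<and> col z \<le> col x}"
  have A: "A \<subseteq> {z\<in>D. row z = row x}" and B: "B \<subseteq> {z\<in>D. row z = Suc (row x)}"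
    by (auto simp: A_def B_def)
  have finAB: "finite (A \<union> B)" "A \<union> B \<subseteq> D" using fin by (auto simp: A_def B_def)
  have lo: "S x \<le> S z" if "z \<in> A" for z using that sorted xy by (auto simp: A_def)
  have hi: "if b then S z < S x else S z \<le> S x" if "z \<in> B" for z
  proof -
    have "S z \<le> S y" using that sorted[of z y] xy by (auto simp: B_def)
    then show ?thesis using xy(5) by (auto split: if_splits)
  qed
  let ?P = "{s. s permutes A \<union> B}"
  define G where "G = {s\<in>?P. (\<Sum>z\<in>A. S (s z)) = (\<Sum>z\<in>A. S z)}"
  have finP: "finite ?P" using finAB by (intro finite_permutations)
  have finG: "finite G" "G \<subseteq> ?P" using finP by (auto simp: G_def)
  have "id \<in> G" by (simp add: G_def permutes_id)
  then have cG: "card G > 0" using finG by (auto simp: card_gt_0_iff)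
  have "symmetrized D row col b N S =
      (\<Sum>s\<in>?P - G. (- char1 b s / of_nat (card G)) * symmetrized D row col b N (S \<circ> s))" for N
  proof -
    have "0 = (\<Sum>s\<in>?P. char1 b s * symmetrized D row col b N (S \<circ> s))"
      using symmetrized_garnir[OF A B] card_line_segments[OF xy(1,2,4) xy(3)[symmetric]]
      by (simp add: A_def B_def)
    also have "\<dots> = (\<Sum>s\<in>?P - G. char1 b s * symmetrized D row col b N (S \<circ> s)) +
        (\<Sum>s\<in>G. char1 b s * symmetrized D row col b N (S \<circ> s))"
      using finG finP by (intro sum.subset_diff)
    also have "(\<Sum>s\<in>G. char1 b s * symmetrized D row col b N (S \<circ> s)) = (\<Sum>s\<in>G. symmetrized D row col b N S)"
      by (rule sum.cong[OF refl], rule garnir_term(2)[OF A B lo hi]) (auto simp: G_def)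
    also have "\<dots> = of_nat (card G) * symmetrized D row col b N S" by (rule sum_constant)
    finally have z: "0 = (\<Sum>s\<in>?P - G. char1 b s * symmetrized D row col b N (S \<circ> s)) +
        of_nat (card G) * symmetrized D row col b N S" .
    have "of_nat (card G) * symmetrized D row col b N S =
        - (\<Sum>s\<in>?P - G. char1 b s * symmetrized D row col b N (S \<circ> s))"
      by (rule minus_unique[OF z[symmetric], symmetric])
    then have "of_nat (card G) * symmetrized D row col b N S = of_nat (card G) *
        (\<Sum>s\<in>?P - G. (- char1 b s / of_nat (card G)) * symmetrized D row col b N (S \<circ> s))"
      unfolding sum_distrib_left sum_negf[symmetric] using cG
      by (simp only: times_divide_eq_right times_divide_eq_left) (simp add: field_simps)
    then show ?thesis using cG by (simp only: mult_cancel_left of_nat_eq_0_iff) simp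
  qed
  moreover have "reducible b n (S \<circ> s)" if s: "s \<in> ?P - G" for s
  proof -
    have sp: "s permutes A \<union> B" using s by auto
    have sD: "s permutes D" using sp finAB(2) by (rule permutes_subset)
    have "(\<Sum>z\<in>A. S (s z)) \<le> (\<Sum>z\<in>A. S z)"
      by (rule garnir_term(1)[OF A B lo hi sp])
    then have "(\<Sum>z\<in>A. S (s z)) < (\<Sum>z\<in>A. S z)" using s by (auto simp: G_def)
    then have "(\<Sum>z\<in>D. row z * (S \<circ> s) z) > (\<Sum>z\<in>D. row z * S z)"
      using sum_row_weight[OF A B sp, of S] by simp
    then show ?thesis by (rule IH[OF compose_PiE[OF sD S]])
  qed
  ultimately show ?thesis
    by (rule_tac reducible_combination[of "?P - G" b n "\<lambda>s. S \<circ> s" S "\<lambda>s. - char1 b s / of_nat (card G)"])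
qed

text \<open>The diagram has no gaps in a column, so if all neighbours were in order, the order would
  propagate to every pair.\<close>

lemma column_violation:
  fixes S :: "'a \<Rightarrow> nat"
  assumes x: "x \<in> D" and y: "y \<in> D" "col x = col y" "row x < row y" "\<not> (if b then S x \<le> S y else S x < S y)"
  shows "\<exists>x\<in>D. \<exists>y\<in>D. col x = col y \<and> row y = Suc (row x) \<and> (if b then S y < S x else S y \<le> S x)"
proof (rule ccontr)
  assume no: "\<not> ?thesis"
  have "row x + Suc k = row z \<Longrightarrow> z \<in> D \<Longrightarrow> col z = col x \<Longrightarrow> (if b then S x \<le> S z else S x < S z)" for k z
  proof (induction k arbitrary: z)
    case 0
    then have "\<not> (if b then S z < S x else S z \<le> S x)" using no x by auto
    then show ?case by (auto split: if_splits)
  next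
    case (Suc k)
    obtain u where u: "u \<in> D" "row u = row x + Suc k" "col u = col x"
      using down[OF Suc.prems(2), of "row x + Suc k" "col x"] Suc.prems by auto
    have "\<not> (if b then S z < S u else S z \<le> S u)" using no u Suc.prems by auto
    then show ?case using Suc.IH[of u] u by (auto split: if_splits)
  qed
  from this[of "row y - Suc (row x)" y] show False using y by auto
qed

text \<open>Lexicographic descent on the defects of the row weight and of the column weight, which
  are bounded because entries are at most \<open>n\<close>. Garnir exchanges raise the row weight;
  sorting a row keeps it and raises the column weight.\<close>

theorem straightening:
  assumes "S \<in> PiE D (\<lambda>_. {1..n})"
  shows "reducible b n S"
  using assms
proof (induction S rule: wf_induct_rule[OF wf_measures[of "[\<lambda>S. (\<Sum>x\<in>D. row x * n) - (\<Sum>x\<in>D. row x * S x),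
      \<lambda>S. (\<Sum>x\<in>D. col x * n) - (\<Sum>x\<in>D. col x * S x)]"], case_names less])
  case (less S)
  have IH1: "reducible b n T" if T: "T \<in> PiE D (\<lambda>_. {1..n})" and lt: "(\<Sum>z\<in>D. row z * T z) > (\<Sum>z\<in>D. row z * S z)" for T
    using diff_less_mono2[OF lt order.strict_trans2[OF lt weight_bound(1)[OF T]]] T
    by (intro less.IH) (simp_all only: in_measures simp_thms)
  have IH2: "reducible b n T" if T: "T \<in> PiE D (\<lambda>_. {1..n})" and eq: "(\<Sum>z\<in>D. row z * T z) = (\<Sum>z\<in>D. row z * S z)"
    and lt: "(\<Sum>z\<in>D. col z * T z) > (\<Sum>z\<in>D. col z * S z)" for T
    using diff_less_mono2[OF lt order.strict_trans2[OF lt weight_bound(2)[OF T]]] T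
    by (intro less.IH) (simp_all only: in_measures simp_thms eq)
  show ?case
  proof (cases "\<exists>x\<in>D. \<exists>y\<in>D. row x = row y \<and> col x < col y \<and> S y < S x")
    case True
    then obtain x y where xy: "x \<in> D" "y \<in> D" "row x = row y" "col x < col y" "S y < S x" by blast
    show ?thesis by (rule exchange_reducible[OF less.prems xy IH2])
  next
    case sorted: False
    have srt: "S x \<le> S y" if "x \<in> D" "y \<in> D" "row x = row y" "col x \<le> col y" for x y
    proof (cases "col x = col y")
      case True
      then show ?thesis using cell_inj[OF that(1-3)] by simp
    next
      case False
      then have "col x < col y" using that(4) by simp
      then have "\<not> S y < S x" using that(1-3) sorted by blast
      then show ?thesis by simp
    qed
    show ?thesis
    proof (cases "\<exists>x\<in>D. \<exists>y\<in>D. col x = col y \<and> row y = Suc (row x) \<and> (if b then S y < S x else S y \<le> S x)")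
      case True
      then obtain x y where xy: "x \<in> D" "y \<in> D" "col x = col y" "row y = Suc (row x)"
        "if b then S y < S x else S y \<le> S x" by blast
      show ?thesis by (rule garnir_reducible[OF less.prems srt xy IH1])
    next
      case cols: False
      show ?thesis
      \<comment> \<open>With \<open>b\<close>, a sorted row may still repeat an entry. Exchanging
        the two cells fixes \<open>S\<close> and changes the sign, so the sum vanishes and the empty
        combination serves.\<close>
      proof (cases "b \<and> (\<exists>x\<in>D. \<exists>y\<in>D. row x = row y \<and> col x < col y \<and> S x = S y)")
        case True
        then obtain x y where xy: "x \<in> D" "y \<in> D" "row x = row y" "col x < col y" "S x = S y" and b: b by auto
        let ?t = "Transposition.transpose x y"
        have tl: "?t \<in> line_perms D row" using xy by (intro transpose_line_perms) auto
        have ne: "x \<noteq> y" using xy(4) by auto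
        have st: "S \<circ> ?t = S" using xy by (auto simp: fun_eq_iff Transposition.transpose_def)
        have "char1 b ?t = -1" using char1_transpose[OF ne, of b] b by simp
        then have "symmetrized D row col b N S = -1 * symmetrized D row col b N S" for N
          using symmetrized_line[OF tl, of b N S] unfolding st by (simp only:)
        moreover have "z = -1 * z \<Longrightarrow> z = 0" for z :: complex by (simp add: complex_eq_iff)
        ultimately have "symmetrized D row col b N S = 0" for N by blast
        then show ?thesis by (rule_tac reducible_combination[of "{}" b n "\<lambda>_. S" S "\<lambda>_. 0"]) simp_all
      next
        case False
        have "std_filling D row col b S"
          unfolding std_filling_def
        proof (intro conjI ballI impI)
          fix x y assume "x \<in> D" "y \<in> D" "row x = row y \<and> col x < col y"
          then show "if b then S x < S y else S x \<le> S y" using False srt[of x y] by (simp add: le_less) blast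
        next
          fix x y assume "x \<in> D" "y \<in> D" "col x = col y \<and> row x < row y"
          then show "if b then S x \<le> S y else S x < S y"
            using column_violation[of x y b S] cols by (rule_tac ccontr) blast
        qed
        then show ?thesis using less.prems by (intro reducible_std)
      qed
    qed
  qed
qed

end

section \<open>Linear extension\<close>

definition clinear :: "(('a \<Rightarrow>\<^sub>0 complex) \<Rightarrow> ('b \<Rightarrow>\<^sub>0 complex)) \<Rightarrow> bool" where
  "clinear f \<longleftrightarrow> (\<forall>p q. f (p + q) = f p + f q) \<and> (\<forall>c p. f (cscale c p) = cscale c (f p))"

definition lift :: "('a \<Rightarrow> ('b \<Rightarrow>\<^sub>0 complex)) \<Rightarrow> ('a \<Rightarrow>\<^sub>0 complex) \<Rightarrow> ('b \<Rightarrow>\<^sub>0 complex)" where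
  "lift g p = (\<Sum>x\<in>Poly_Mapping.keys p. cscale (Poly_Mapping.lookup p x) (g x))"

lemma clinearI:
  assumes "\<And>p q. f (p + q) = f p + f q" "\<And>c p. f (cscale c p) = cscale c (f p)"
  shows "clinear f"
  using assms by (simp add: clinear_def)

lemma clinear_add: "clinear f \<Longrightarrow> f (p + q) = f p + f q"
  by (simp add: clinear_def)

lemma clinear_cscale: "clinear f \<Longrightarrow> f (cscale c p) = cscale c (f p)"
  by (simp add: clinear_def)

lemma clinear_0: "clinear f \<Longrightarrow> f 0 = 0"
  using clinear_cscale[of f 0 0] by simp

lemma clinear_uminus: "clinear f \<Longrightarrow> f (- p) = - f p"
  using clinear_cscale[of f "-1" p] by simp

lemma clinear_diff: "clinear f \<Longrightarrow> f (p - q) = f p - f q"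
  using clinear_add[of f p "- q"] by (simp add: clinear_uminus)

lemma clinear_sum: "clinear f \<Longrightarrow> f (\<Sum>i\<in>I. g i) = (\<Sum>i\<in>I. f (g i))"
  by (induction I rule: infinite_finite_induct) (simp_all add: clinear_0 clinear_add)

lemma clinear_compose: "clinear f \<Longrightarrow> clinear g \<Longrightarrow> clinear (\<lambda>p. f (g p))"
  by (rule clinearI) (simp_all add: clinear_add clinear_cscale)

lemma clinear_plus: "clinear f \<Longrightarrow> clinear g \<Longrightarrow> clinear (\<lambda>p. f p + g p)"
  by (rule clinearI) (simp_all add: clinear_add clinear_cscale cvs.scale_right_distrib)

lemma clinear_scaled: "clinear f \<Longrightarrow> clinear (\<lambda>p. cscale c (f p))"
  by (rule clinearI) (simp_all add: clinear_add clinear_cscale cvs.scale_right_distrib mult.commute)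

lemma clinear_setsum: "(\<And>i. i \<in> I \<Longrightarrow> clinear (f i)) \<Longrightarrow> clinear (\<lambda>p. \<Sum>i\<in>I. f i p)"
  by (rule clinearI) (simp_all add: clinear_add clinear_cscale sum.distrib cvs.scale_sum_right cong: sum.cong)

lemma clinear_ident: "clinear (\<lambda>p. p)"
  by (rule clinearI) auto

lemma cscale_single: "cscale c (Poly_Mapping.single x d) = Poly_Mapping.single x (c * d)"
  by (rule poly_mapping_eqI) (simp add: lookup_single when_def)

lemma lift_superset:
  assumes "finite A" "Poly_Mapping.keys p \<subseteq> A"
  shows "lift g p = (\<Sum>x\<in>A. cscale (Poly_Mapping.lookup p x) (g x))"
  unfolding lift_def using assms by (intro sum.mono_neutral_left) (auto simp: in_keys_iff)

lemma clinear_lift: "clinear (lift g)"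
proof (rule clinearI)
  fix p q :: "'a \<Rightarrow>\<^sub>0 complex"
  let ?A = "Poly_Mapping.keys p \<union> Poly_Mapping.keys q"
  have "lift g (p + q) = (\<Sum>x\<in>?A. cscale (Poly_Mapping.lookup (p + q) x) (g x))"
    using Poly_Mapping.keys_add[of p q] by (intro lift_superset) auto
  also have "\<dots> = (\<Sum>x\<in>?A. cscale (Poly_Mapping.lookup p x) (g x)) + (\<Sum>x\<in>?A. cscale (Poly_Mapping.lookup q x) (g x))"
    by (simp add: lookup_add cvs.scale_left_distrib sum.distrib)
  also have "\<dots> = lift g p + lift g q"
    by (simp add: lift_superset[of ?A])
  finally show "lift g (p + q) = lift g p + lift g q" .
next
  fix c and p :: "'a \<Rightarrow>\<^sub>0 complex"
  have "lift g (cscale c p) = (\<Sum>x\<in>Poly_Mapping.keys p. cscale (Poly_Mapping.lookup (cscale c p) x) (g x))"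
    by (intro lift_superset) (auto simp: in_keys_iff)
  then show "lift g (cscale c p) = cscale c (lift g p)"
    by (simp add: lift_def cvs.scale_sum_right)
qed

lemma lift_single [simp]: "lift g (Poly_Mapping.single x c) = cscale c (g x)"
  by (simp add: lift_superset[of "{x}"])

lemma poly_mapping_sum_single:
  assumes "finite A" "Poly_Mapping.keys p \<subseteq> A"
  shows "p = (\<Sum>x\<in>A. cscale (Poly_Mapping.lookup p x) (Poly_Mapping.single x 1))"
proof (rule poly_mapping_eqI)
  fix y
  have "(\<Sum>x\<in>A. Poly_Mapping.lookup p x * (1 when x = y)) = (\<Sum>x\<in>A. if x = y then Poly_Mapping.lookup p x else 0)"
    by (intro sum.cong) (auto simp: when_def)
  also have "\<dots> = Poly_Mapping.lookup p y"
    using assms by (auto simp: sum.delta in_keys_iff)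
  finally show "Poly_Mapping.lookup p y =
      Poly_Mapping.lookup (\<Sum>x\<in>A. cscale (Poly_Mapping.lookup p x) (Poly_Mapping.single x 1)) y"
    by (simp add: lookup_sum lookup_single)
qed

lemma clinear_expand:
  assumes "clinear f" "finite A" "Poly_Mapping.keys p \<subseteq> A"
  shows "f p = (\<Sum>x\<in>A. cscale (Poly_Mapping.lookup p x) (f (Poly_Mapping.single x 1)))"
proof -
  have "f p = f (\<Sum>x\<in>A. cscale (Poly_Mapping.lookup p x) (Poly_Mapping.single x 1))"
    by (rule arg_cong[OF poly_mapping_sum_single[OF assms(2,3)]])
  then show ?thesis by (simp only: clinear_sum[OF assms(1)] clinear_cscale[OF assms(1)])
qed

lemma clinear_eqI:
  assumes "clinear f" "clinear g"
    and "\<And>x. x \<in> Poly_Mapping.keys p \<Longrightarrow> f (Poly_Mapping.single x 1) = g (Poly_Mapping.single x 1)"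
  shows "f p = g p"
  unfolding clinear_expand[OF assms(1) finite_keys subset_refl, of p]
    clinear_expand[OF assms(2) finite_keys subset_refl, of p]
  using assms(3) by simp

lemma keys_lift: "Poly_Mapping.keys (lift g p) \<subseteq> (\<Union>x\<in>Poly_Mapping.keys p. Poly_Mapping.keys (g x))"
proof -
  have "Poly_Mapping.keys (lift g p) \<subseteq>
      (\<Union>x\<in>Poly_Mapping.keys p. Poly_Mapping.keys (cscale (Poly_Mapping.lookup p x) (g x)))"
    unfolding lift_def by (rule Poly_Mapping.keys_sum)
  also have "\<dots> \<subseteq> (\<Union>x\<in>Poly_Mapping.keys p. Poly_Mapping.keys (g x))"
    by (auto simp: in_keys_iff)
  finally show ?thesis .
qed

lemma pushforward_eq_lift: "pushforward f = lift (\<lambda>x. Poly_Mapping.single (f x) 1)"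
  by (rule ext) (simp add: pushforward_def lift_def cscale_single)

lemma sum_single_span:
  assumes "finite A" "Poly_Mapping.keys p \<subseteq> A"
  shows "p \<in> cvs.span ((\<lambda>x. Poly_Mapping.single x 1) ` A)"
  by (subst poly_mapping_sum_single[OF assms]) (rule cvs.span_sum, rule cvs.span_scale, rule cvs.span_base, rule imageI)

text \<open>A map of the ambient space into \<open>V\<close> has the same trace there as on
  \<open>V\<close>: expanding its values in a basis of \<open>V\<close> and the basis in
  coordinates, this is tr(XY) = tr(YX). No complement of \<open>V\<close> is chosen.\<close>

lemma trace_on_projection:
  assumes T: "finite T" "\<And>v. v \<in> V \<Longrightarrow> Poly_Mapping.keys v \<subseteq> T"
    and V: "cvs.subspace V"
    and Q: "clinear Q" "\<And>X. X \<in> T \<Longrightarrow> Q (Poly_Mapping.single X 1) \<in> V"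
    and f: "\<And>v. v \<in> V \<Longrightarrow> Q v = cscale d (f v)"
  shows "(\<Sum>X\<in>T. Poly_Mapping.lookup (Q (Poly_Mapping.single X 1)) X) = d * trace_on V f"
proof -
  define B where "B = (SOME B. B \<subseteq> V \<and> cvs.independent B \<and> cvs.span B = V)"
  have "\<exists>B. B \<subseteq> V \<and> cvs.independent B \<and> cvs.span B = V"
    by (metis V cvs.basis_exists cvs.span_minimal subset_antisym)
  then have B: "B \<subseteq> V" "cvs.independent B" "cvs.span B = V"
    unfolding B_def by (rule someI2_ex, blast)+
  have "V \<subseteq> cvs.span ((\<lambda>x. Poly_Mapping.single x 1) ` T)"
    using T sum_single_span by blast
  then have finB: "finite B"
    using B cvs.independent_span_bound[of "(\<lambda>x. Poly_Mapping.single x 1) ` T" B] T(1) by auto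
  let ?r = "cvs.representation B"
  have rsum: "(\<Sum>b\<in>B. cscale (?r v b) b) = v" if "v \<in> V" for v
    using cvs.sum_representation_eq[OF B(2), of v B] finB that B(3) by simp
  have QV: "Q v \<in> V" if "Poly_Mapping.keys v \<subseteq> T" for v
    unfolding clinear_expand[OF Q(1) T(1) that]
    by (intro cvs.subspace_sum cvs.subspace_scale V Q(2))
  \<comment> \<open>Invariance of \<open>V\<close> under \<open>f\<close> comes from that under
    \<open>Q\<close> by dividing by \<open>d\<close>; the case \<open>d = 0\<close>, where both
    sides vanish, is treated separately.\<close>
  have fV: "d \<noteq> 0 \<Longrightarrow> f v \<in> V" if "v \<in> V" for v
    using cvs.subspace_scale[OF V QV[OF T(2)[OF that]], of "1/d"] f[OF that] by simp
  have "(\<Sum>X\<in>T. Poly_Mapping.lookup (Q (Poly_Mapping.single X 1)) X) =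
      (\<Sum>X\<in>T. \<Sum>b\<in>B. ?r (Q (Poly_Mapping.single X 1)) b * Poly_Mapping.lookup b X)"
  proof (rule sum.cong[OF refl])
    fix X assume "X \<in> T"
    from rsum[OF Q(2)[OF this]]
    have "Poly_Mapping.lookup (Q (Poly_Mapping.single X 1)) X =
        Poly_Mapping.lookup (\<Sum>b\<in>B. cscale (?r (Q (Poly_Mapping.single X 1)) b) b) X" by simp
    then show "Poly_Mapping.lookup (Q (Poly_Mapping.single X 1)) X =
        (\<Sum>b\<in>B. ?r (Q (Poly_Mapping.single X 1)) b * Poly_Mapping.lookup b X)"
      by (simp add: lookup_sum)
  qed
  also have "\<dots> = (\<Sum>b\<in>B. \<Sum>X\<in>T. Poly_Mapping.lookup b X * ?r (Q (Poly_Mapping.single X 1)) b)"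
    by (subst sum.swap) (simp add: mult.commute)
  also have "\<dots> = (\<Sum>b\<in>B. ?r (Q b) b)"
  proof (rule sum.cong[OF refl])
    fix b assume b: "b \<in> B"
    then have kb: "Poly_Mapping.keys b \<subseteq> T" using B T by blast
    have "Q b = (\<Sum>X\<in>T. cscale (Poly_Mapping.lookup b X) (Q (Poly_Mapping.single X 1)))"
      by (rule clinear_expand[OF Q(1) T(1) kb])
    also have "?r \<dots> b = (\<Sum>X\<in>T. Poly_Mapping.lookup b X * ?r (Q (Poly_Mapping.single X 1)) b)"
      using B Q(2) by (subst cvs.representation_sum)
        (auto simp: cvs.representation_scale intro!: cvs.span_scale)
    finally show "(\<Sum>X\<in>T. Poly_Mapping.lookup b X * ?r (Q (Poly_Mapping.single X 1)) b) = ?r (Q b) b" by simp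
  qed
  also have "\<dots> = (\<Sum>b\<in>B. d * ?r (f b) b)"
  proof (rule sum.cong[OF refl])
    fix b assume b: "b \<in> B"
    show "?r (Q b) b = d * ?r (f b) b"
    proof (cases "d = 0")
      case True then show ?thesis using f[of b] b B by (auto simp: cvs.representation_zero)
    next
      case False
      then show ?thesis using f[of b] b B fV[of b] by (auto simp: cvs.representation_scale)
    qed
  qed
  also have "\<dots> = d * trace_on V f"
    by (simp add: trace_on_def B_def[symmetric] sum_distrib_left)
  finally show ?thesis .
qed

section \<open>The character of a Specht module\<close>

definition diagram :: "nat list \<Rightarrow> (nat \<times> nat) set" where
  "diagram mu = {(r, c). r < length mu \<and> c < mu ! r}"

definition entry :: "'a list list \<Rightarrow> nat \<times> nat \<Rightarrow> 'a" where
  "entry t = (\<lambda>(r, c). t ! r ! c)"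

definition row_of :: "nat list \<Rightarrow> nat list list \<Rightarrow> nat \<Rightarrow> nat" where
  "row_of mu t a = fst (inv_into (diagram mu) (entry t) a)"

definition col_of :: "nat list \<Rightarrow> nat list list \<Rightarrow> nat \<Rightarrow> nat" where
  "col_of mu t a = snd (inv_into (diagram mu) (entry t) a)"

abbreviation map_tab :: "('a \<Rightarrow> 'b) \<Rightarrow> 'a list list \<Rightarrow> 'b list list" where
  "map_tab f \<equiv> map (map f)"

lemma sum_line_perms_right:
  assumes "p \<in> line_perms D line"
  shows "(\<Sum>q\<in>line_perms D line. f (q \<circ> p)) = (\<Sum>q\<in>line_perms D line. f q)"
proof (rule sum.reindex_bij_witness[of _ "\<lambda>q. q \<circ> finv p" "\<lambda>q. q \<circ> p"])
  have p: "p permutes D" using assms by (rule line_perms_permutes)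
  fix q
  show "q \<circ> p \<circ> finv p = q" by (simp only: comp_assoc permutes_inv_o(1)[OF p] comp_id)
  show "q \<circ> finv p \<circ> p = q" by (simp only: comp_assoc permutes_inv_o(2)[OF p] comp_id)
qed (use assms in \<open>auto intro: line_perms_compose line_perms_inv\<close>)

lemma finite_diagram [simp]: "finite (diagram mu)" and card_diagram: "card (diagram mu) = sum_list mu"
proof -
  have eq: "diagram mu = Sigma {..<length mu} (\<lambda>r. {..<mu ! r})" by (auto simp: diagram_def)
  show "finite (diagram mu)" "card (diagram mu) = sum_list mu"
    unfolding eq by (auto simp: sum_list_sum_nth atLeast0LessThan)
qed

lemma set_concat_entry:
  assumes "shape t = mu"
  shows "set (concat t) = entry t ` diagram mu"
proof -
  have len: "length t = length mu" "\<And>r. r < length mu \<Longrightarrow> length (t ! r) = mu ! r"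
    using assms by (auto simp: shape_def)
  show ?thesis
  proof (intro equalityI subsetI)
    fix a assume "a \<in> set (concat t)"
    then obtain r c where "r < length t" "c < length (t ! r)" "a = t ! r ! c"
      by (auto simp: in_set_conv_nth)
    then show "a \<in> entry t ` diagram mu"
      using len by (auto simp: diagram_def entry_def intro!: image_eqI[of _ _ "(r, c)"])
  next
    fix a assume "a \<in> entry t ` diagram mu"
    then obtain r c where "r < length mu" "c < mu ! r" "a = t ! r ! c"
      by (auto simp: diagram_def entry_def)
    then show "a \<in> set (concat t)"
      using len by (auto intro!: bexI[of _ "t ! r"])
  qed
qed

locale numbered_tableau =
  fixes h :: nat and mu :: "nat list" and t :: "nat list list"
  assumes numbering: "numbering h mu t"
begin

lemma len: "length t = length mu" "\<And>r. r < length mu \<Longrightarrow> length (t ! r) = mu ! r"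
  using numbering by (auto simp: numbering_def shape_def)

lemma entry_bij: "bij_betw (entry t) (diagram mu) {1..h}"
proof -
  have sh: "shape t = mu" and dist: "distinct (concat t)" and set: "set (concat t) = {1..h}"
    using numbering by (auto simp: numbering_def)
  have im: "entry t ` diagram mu = {1..h}" using set set_concat_entry[OF sh] by simp
  have "card (set (concat t)) = sum_list mu"
    unfolding distinct_card[OF dist] using sh by (simp add: length_concat shape_def)
  then have "card (diagram mu) = card (entry t ` diagram mu)"
    using set im card_diagram by simp
  then have "inj_on (entry t) (diagram mu)" by (intro eq_card_imp_inj_on) simp_all
  then show ?thesis using im by (simp add: bij_betw_def)
qed

lemma entry_in: "x \<in> diagram mu \<Longrightarrow> entry t x \<in> {1..h}"
  using entry_bij by (auto simp: bij_betw_def)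

lemma row_of_entry: "x \<in> diagram mu \<Longrightarrow> row_of mu t (entry t x) = fst x"
  and col_of_entry: "x \<in> diagram mu \<Longrightarrow> col_of mu t (entry t x) = snd x"
  using entry_bij by (auto simp: bij_betw_def row_of_def col_of_def)

lemma entryE:
  assumes "a \<in> {1..h}"
  obtains x where "x \<in> diagram mu" "a = entry t x"
  using entry_bij assms unfolding bij_betw_def by (metis imageE)

lemma position: "a \<in> {1..h} \<Longrightarrow> (row_of mu t a, col_of mu t a) \<in> diagram mu"
  by (elim entryE) (simp add: row_of_entry col_of_entry)

lemma entry_position: "a \<in> {1..h} \<Longrightarrow> entry t (row_of mu t a, col_of mu t a) = a"
  by (elim entryE) (simp add: row_of_entry col_of_entry)

lemma tabloid_eq: "tabloid t = map (\<lambda>r. {a\<in>{1..h}. row_of mu t a = r}) [0..<length mu]"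
proof (rule nth_equalityI)
  show "length (tabloid t) = length (map (\<lambda>r. {a\<in>{1..h}. row_of mu t a = r}) [0..<length mu])"
    by (simp add: tabloid_def len)
  fix r assume "r < length (tabloid t)"
  then have r: "r < length mu" by (simp add: tabloid_def len)
  have "set (t ! r) = {a\<in>{1..h}. row_of mu t a = r}"
  proof (intro equalityI subsetI)
    fix a assume "a \<in> set (t ! r)"
    then obtain c where "c < length (t ! r)" "a = t ! r ! c" by (auto simp: in_set_conv_nth)
    then have "(r, c) \<in> diagram mu" "a = entry t (r, c)" using r by (auto simp: diagram_def entry_def len)
    then show "a \<in> {a\<in>{1..h}. row_of mu t a = r}" using row_of_entry[of "(r, c)"] entry_in[of "(r, c)"] by simp
  next
    fix a assume "a \<in> {a\<in>{1..h}. row_of mu t a = r}"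
    then have "(r, col_of mu t a) \<in> diagram mu" "a = t ! r ! col_of mu t a"
      using position[of a] entry_position[of a] by (auto simp: entry_def)
    then show "a \<in> set (t ! r)" using len(2)[OF r] by (metis (mono_tags, lifting) case_prodD diagram_def mem_Collect_eq nth_mem)
  qed
  then show "tabloid t ! r = map (\<lambda>r. {a\<in>{1..h}. row_of mu t a = r}) [0..<length mu] ! r"
    using r by (simp add: tabloid_def len)
qed

lemma column_set_eq: "column_set t c = {a\<in>{1..h}. col_of mu t a = c}"
proof (intro equalityI subsetI)
  fix a assume "a \<in> column_set t c"
  then obtain r where "r < length t" "c < length (t ! r)" "a = t ! r ! c" by (auto simp: column_set_def)
  then have "(r, c) \<in> diagram mu" "a = entry t (r, c)" by (auto simp: diagram_def entry_def len)
  then show "a \<in> {a\<in>{1..h}. col_of mu t a = c}" using col_of_entry[of "(r, c)"] entry_in[of "(r, c)"] by simp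
next
  fix a assume "a \<in> {a\<in>{1..h}. col_of mu t a = c}"
  then have "(row_of mu t a, c) \<in> diagram mu" "a = t ! row_of mu t a ! c"
    using position[of a] entry_position[of a] by (auto simp: entry_def)
  then show "a \<in> column_set t c" unfolding column_set_def diagram_def
    by (auto simp: len intro!: exI[of _ "row_of mu t a"])
qed

lemma column_group_eq: "column_group h t = line_perms {1..h} (col_of mu t)"
proof (intro equalityI subsetI)
  fix p assume p: "p \<in> column_group h t"
  have "col_of mu t (p a) = col_of mu t a" if "a \<in> {1..h}" for a
  proof -
    have "p a \<in> p ` column_set t (col_of mu t a)" using that by (auto simp: column_set_eq)
    then have "p a \<in> column_set t (col_of mu t a)" using p by (simp add: column_group_def)
    then show ?thesis by (simp add: column_set_eq)
  qed
  then show "p \<in> line_perms {1..h} (col_of mu t)" using p by (simp add: line_perms_def column_group_def)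
next
  fix p assume p: "p \<in> line_perms {1..h} (col_of mu t)"
  have sub: "q ` column_set t c \<subseteq> column_set t c" if "q \<in> line_perms {1..h} (col_of mu t)" for q c
    using that permutes_in_image[of q "{1..h}"] by (auto simp: column_set_eq line_perms_def)
  have pI: "p permutes {1..h}" using p by (rule line_perms_permutes)
  have "p ` column_set t c = column_set t c" for c
  proof (rule equalityI[OF sub[OF p]])
    have "p ` finv p ` column_set t c \<subseteq> p ` column_set t c"
      by (rule image_mono[OF sub[OF line_perms_inv[OF p]]])
    then show "column_set t c \<subseteq> p ` column_set t c"
      by (simp add: image_image permutes_inverses(1)[OF pI])
  qed
  then show "p \<in> column_group h t" using pI by (simp add: column_group_def)
qed

lemma tabloid_map: "tabloid (map_tab s t) = map (image s) (tabloid t)"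
  by (simp add: tabloid_def)

lemma permuted:
  assumes "s permutes {1..h}"
  shows "numbered_tableau h mu (map_tab s t)"
proof
  have "inj_on s (set (concat t))" by (rule inj_on_subset[OF permutes_inj[OF assms] subset_UNIV])
  moreover have "concat (map_tab s t) = map s (concat t)" by (simp add: map_concat)
  moreover have "shape (map_tab s t) = shape t" by (simp add: shape_def)
  ultimately show "numbering h mu (map_tab s t)"
    using numbering permutes_image[OF assms] unfolding numbering_def
    by (simp only: distinct_map set_map)
qed

lemma entry_map: "x \<in> diagram mu \<Longrightarrow> entry (map_tab s t) x = s (entry t x)"
  by (auto simp: diagram_def entry_def len)

lemma row_of_map:
  assumes "s permutes {1..h}" "a \<in> {1..h}"
  shows "row_of mu (map_tab s t) (s a) = row_of mu t a"
  using assms(2)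
proof (elim entryE)
  fix x assume x: "x \<in> diagram mu" "a = entry t x"
  interpret s: numbered_tableau h mu "map_tab s t" by (rule permuted[OF assms(1)])
  show ?thesis using s.row_of_entry[OF x(1)] x by (simp add: entry_map row_of_entry)
qed

lemma col_of_map:
  assumes "s permutes {1..h}" "a \<in> {1..h}"
  shows "col_of mu (map_tab s t) (s a) = col_of mu t a"
  using assms(2)
proof (elim entryE)
  fix x assume x: "x \<in> diagram mu" "a = entry t x"
  interpret s: numbered_tableau h mu "map_tab s t" by (rule permuted[OF assms(1)])
  show ?thesis using s.col_of_entry[OF x(1)] x by (simp add: entry_map col_of_entry)
qed

end

lemma tabloid_eq_iff:
  assumes "numbering h mu t" "numbering h mu t'"
  shows "tabloid t = tabloid t' \<longleftrightarrow> (\<forall>a\<in>{1..h}. row_of mu t a = row_of mu t' a)"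
proof -
  interpret t: numbered_tableau h mu t using assms by unfold_locales
  interpret t': numbered_tableau h mu t' using assms by unfold_locales
  show ?thesis
  proof
    assume eq: "tabloid t = tabloid t'"
    show "\<forall>a\<in>{1..h}. row_of mu t a = row_of mu t' a"
    proof
      fix a assume a: "a \<in> {1..h}"
      have r: "row_of mu t a < length mu" using t.position[OF a] by (simp add: diagram_def)
      have "tabloid t ! row_of mu t a = tabloid t' ! row_of mu t a" using eq by simp
      then have "{b\<in>{1..h}. row_of mu t b = row_of mu t a} = {b\<in>{1..h}. row_of mu t' b = row_of mu t a}"
        using r by (simp add: t.tabloid_eq t'.tabloid_eq)
      then have "a \<in> {b\<in>{1..h}. row_of mu t' b = row_of mu t a}" using a by blast
      then show "row_of mu t a = row_of mu t' a" by simp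
    qed
  next
    assume "\<forall>a\<in>{1..h}. row_of mu t a = row_of mu t' a"
    then show "tabloid t = tabloid t'" unfolding t.tabloid_eq t'.tabloid_eq
      by (intro map_cong refl Collect_cong) auto
  qed
qed

lemma finite_numberings: "finite {t. numbering h mu t}"
proof (rule finite_subset)
  let ?R = "{xs. set xs \<subseteq> {1..h} \<and> length xs \<le> sum_list mu}"
  show "{t. numbering h mu t} \<subseteq> {t. set t \<subseteq> ?R \<and> length t = length mu}"
    by (auto simp: numbering_def shape_def intro!: member_le_sum_list)
  show "finite {t. set t \<subseteq> ?R \<and> length t = length mu}"
    by (intro finite_lists_length_eq finite_lists_length_le) auto
qed

text \<open>
  The counting argument below compares, in every column of \<open>t\<close>, the number of entries that
  lie in the first \<open>m\<close> rows of \<open>t'\<close> and of \<open>t\<close>; equality of the totals forces all entries of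
  a column of length \<open>m\<close> into the first \<open>m\<close> rows of \<open>t'\<close>.
\<close>

lemma column_sort_exists:
  assumes mu: "partition_of mu h"
    and t: "numbering h mu t" and t': "numbering h mu t'"
    and no: "\<And>a b. a \<in> {1..h} \<Longrightarrow> b \<in> {1..h} \<Longrightarrow> col_of mu t a = col_of mu t b \<Longrightarrow>
      row_of mu t' a = row_of mu t' b \<Longrightarrow> a = b"
  shows "\<exists>p\<in>column_group h t. tabloid t' = tabloid (map_tab p t)"
proof -
  interpret t: numbered_tableau h mu t using t by unfold_locales
  interpret t': numbered_tableau h mu t' using t' by unfold_locales
  let ?I = "{1..h}"
  let ?c = "col_of mu t" and ?f = "row_of mu t'" and ?g = "row_of mu t"
  have down: "(r, c) \<in> diagram mu" if "(r', c) \<in> diagram mu" "r \<le> r'" for r r' c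
    using that mu sorted_wrt_nth_less[of "(\<ge>)" mu r r']
    by (cases "r = r'") (auto simp: diagram_def partition_of_def)
  have sizes: "card {a\<in>?I. row_of mu s a < m} = (\<Sum>r\<in>{..<m}. card {x\<in>diagram mu. fst x = r})"
    if "numbering h mu s" for s m
  proof -
    interpret s: numbered_tableau h mu s using that by unfold_locales
    have "{a\<in>?I. row_of mu s a < m} = entry s ` {x\<in>diagram mu. fst x < m}"
    proof (intro equalityI subsetI)
      fix a assume a: "a \<in> {a\<in>?I. row_of mu s a < m}"
      then have "a = entry s (row_of mu s a, col_of mu s a)" "(row_of mu s a, col_of mu s a) \<in> diagram mu"
        using s.entry_position s.position by simp_all
      then show "a \<in> entry s ` {x \<in> diagram mu. fst x < m}" using a by (intro image_eqI) auto
    next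
      fix a assume "a \<in> entry s ` {x \<in> diagram mu. fst x < m}"
      then show "a \<in> {a\<in>?I. row_of mu s a < m}" using s.entry_in s.row_of_entry by fastforce
    qed
    then have "card {a\<in>?I. row_of mu s a < m} = card {x\<in>diagram mu. fst x < m}"
      using s.entry_bij by (auto simp: bij_betw_def intro!: card_image intro: inj_on_subset)
    also have "{x\<in>diagram mu. fst x < m} = (\<Union>r\<in>{..<m}. {x\<in>diagram mu. fst x = r})" by auto
    also have "card \<dots> = (\<Sum>r\<in>{..<m}. card {x\<in>diagram mu. fst x = r})"
      by (rule card_UN_disjoint) auto
    finally show ?thesis .
  qed
  have by_column: "card {a\<in>?I. k a < m} = (\<Sum>c\<in>?c ` ?I. card {a\<in>?I. ?c a = c \<and> k a < m})"
    for k :: "nat \<Rightarrow> nat" and m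
  proof -
    have "{a\<in>?I. k a < m} = (\<Union>c\<in>?c ` ?I. {a\<in>?I. ?c a = c \<and> k a < m})" by auto
    also have "card \<dots> = (\<Sum>c\<in>?c ` ?I. card {a\<in>?I. ?c a = c \<and> k a < m})"
      by (rule card_UN_disjoint) auto
    finally show ?thesis .
  qed
  \<comment> \<open>A column of \<open>t\<close> has its entries in distinct rows of
    \<open>t'\<close>, hence at most \<open>m\<close> of them in the first \<open>m\<close> rows. In
    \<open>t\<close> itself a column is filled from the top, so it attains \<open>m\<close> or its
    full length.\<close>
  have col_le: "card {a\<in>?I. ?c a = c \<and> ?f a < m} \<le> card {a\<in>?I. ?c a = c \<and> ?g a < m}" for c m
  proof (cases "\<exists>a\<in>?I. ?c a = c \<and> m \<le> ?g a")
    case True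
    then obtain a where a: "a \<in> ?I" "?c a = c" "m \<le> ?g a" by blast
    have "card {a\<in>?I. ?c a = c \<and> ?f a < m} \<le> card {..<m}"
    proof (rule card_inj_on_le[of ?f])
      show "inj_on ?f {a\<in>?I. ?c a = c \<and> ?f a < m}"
      proof (rule inj_onI)
        fix x y assume "x \<in> {a\<in>?I. ?c a = c \<and> ?f a < m}" "y \<in> {a\<in>?I. ?c a = c \<and> ?f a < m}" "?f x = ?f y"
        then show "x = y" by (intro no[of x y]) simp_all
      qed
    qed auto
    also have "\<dots> \<le> card {a\<in>?I. ?c a = c \<and> ?g a < m}"
    proof (rule card_inj_on_le[of "\<lambda>r. entry t (r, c)"])
      have in_d: "(r, c) \<in> diagram mu" if "r < m" for r
        using down[of "?g a" c r] t.position[OF a(1)] a that by simp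
      then show "inj_on (\<lambda>r. entry t (r, c)) {..<m}"
      proof (intro inj_onI)
        fix r r' assume r: "r \<in> {..<m}" "r' \<in> {..<m}" and e: "entry t (r, c) = entry t (r', c)"
        from t.row_of_entry[OF in_d, of r] t.row_of_entry[OF in_d, of r'] r show "r = r'" unfolding e by simp
      qed
      show "(\<lambda>r. entry t (r, c)) ` {..<m} \<subseteq> {a\<in>?I. ?c a = c \<and> ?g a < m}"
      proof (rule image_subsetI)
        fix r assume "r \<in> {..<m}"
        then have d: "(r, c) \<in> diagram mu" "r < m" using in_d by auto
        show "entry t (r, c) \<in> {a\<in>?I. ?c a = c \<and> ?g a < m}"
          using t.entry_in[OF d(1)] t.row_of_entry[OF d(1)] t.col_of_entry[OF d(1)] d(2) by simp
      qed
    qed simp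
    finally show ?thesis .
  next
    case False
    then show ?thesis by (intro card_mono) (auto simp: not_le)
  qed
  have in_diagram: "(?f a, ?c a) \<in> diagram mu" if a: "a \<in> ?I" for a
  proof -
    define m where "m = card {b\<in>?I. ?c b = ?c a}"
    have less_m: "?g b < m" if b: "b \<in> ?I" "?c b = ?c a" for b
    proof -
      have in_d: "(r, ?c a) \<in> diagram mu" if "r \<le> ?g b" for r
        using down[of "?g b" "?c a" r] t.position[OF b(1)] b(2) that by simp
      have "card {..?g b} \<le> card {b\<in>?I. ?c b = ?c a}"
      proof (rule card_inj_on_le[of "\<lambda>r. entry t (r, ?c a)"])
        show "inj_on (\<lambda>r. entry t (r, ?c a)) {..?g b}"
        proof (rule inj_onI)
          fix r r' assume r: "r \<in> {..?g b}" "r' \<in> {..?g b}" and e: "entry t (r, ?c a) = entry t (r', ?c a)"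
          from t.row_of_entry[OF in_d, of r] t.row_of_entry[OF in_d, of r'] r show "r = r'" unfolding e by simp
        qed
        show "(\<lambda>r. entry t (r, ?c a)) ` {..?g b} \<subseteq> {b\<in>?I. ?c b = ?c a}"
        proof (rule image_subsetI)
          fix r assume "r \<in> {..?g b}"
          then have d: "(r, ?c a) \<in> diagram mu" using in_d by auto
          show "entry t (r, ?c a) \<in> {b\<in>?I. ?c b = ?c a}"
            using t.entry_in[OF d] t.col_of_entry[OF d] by simp
        qed
      qed simp
      then show ?thesis by (simp add: m_def)
    qed
    have tot: "(\<Sum>c\<in>?c ` ?I. card {b\<in>?I. ?c b = c \<and> ?f b < m}) = (\<Sum>c\<in>?c ` ?I. card {b\<in>?I. ?c b = c \<and> ?g b < m})"
      using sizes[OF t, of m] sizes[OF t', of m] unfolding by_column by simp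
    have "card {b\<in>?I. ?c b = ?c a \<and> ?f b < m} = card {b\<in>?I. ?c b = ?c a \<and> ?g b < m}"
      by (rule sum_mono_inv[OF tot]) (use col_le a in auto)
    also have "{b\<in>?I. ?c b = ?c a \<and> ?g b < m} = {b\<in>?I. ?c b = ?c a}" using less_m by auto
    finally have "{b\<in>?I. ?c b = ?c a \<and> ?f b < m} = {b\<in>?I. ?c b = ?c a}"
      by (intro card_subset_eq) auto
    then have fa: "?f a < m" using a by blast
    have "card {..<m} \<le> card (?g ` {b\<in>?I. ?c b = ?c a})"
    proof -
      have "inj_on ?g {b\<in>?I. ?c b = ?c a}"
      proof (rule inj_onI)
        fix x y assume "x \<in> {b\<in>?I. ?c b = ?c a}" "y \<in> {b\<in>?I. ?c b = ?c a}" "?g x = ?g y"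
        then show "x = y" using t.entry_position[of x] t.entry_position[of y] by simp
      qed
      then show ?thesis by (simp add: card_image m_def)
    qed
    moreover have "?g ` {b\<in>?I. ?c b = ?c a} \<subseteq> {..<m}" using less_m by auto
    ultimately have "?g ` {b\<in>?I. ?c b = ?c a} = {..<m}"
      by (intro card_seteq finite_lessThan)
    then have "?f a \<in> ?g ` {b\<in>?I. ?c b = ?c a}" using fa by simp
    then obtain b where b: "b \<in> ?I" "?c b = ?c a" "?g b = ?f a" by auto
    then show ?thesis using t.position[OF b(1)] by simp
  qed
  \<comment> \<open>\<open>q\<close> keeps every entry in its column of \<open>t\<close> and
    replaces it by the one standing in the row that \<open>t'\<close> prescribes; the required
    column permutation is its inverse.\<close>
  define q where "q = (\<lambda>a. if a \<in> ?I then entry t (?f a, ?c a) else a)"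
  have qI: "q a \<in> ?I" "?c (q a) = ?c a" "?g (q a) = ?f a" if "a \<in> ?I" for a
    using that t.entry_in[OF in_diagram[OF that]] t.row_of_entry[OF in_diagram[OF that]]
      t.col_of_entry[OF in_diagram[OF that]] by (simp_all add: q_def)
  have "inj_on q ?I"
  proof (rule inj_onI)
    fix x y assume xy: "x \<in> ?I" "y \<in> ?I" and e: "q x = q y"
    show "x = y"
      by (rule no[OF xy]) (metis e qI(2) xy, metis e qI(3) xy)
  qed
  then have q: "q permutes ?I"
  proof (intro bij_imp_permutes)
    assume inj: "inj_on q ?I"
    moreover have "q ` ?I \<subseteq> ?I" using qI by auto
    ultimately show "bij_betw q ?I ?I" by (simp add: bij_betw_def endo_inj_surj)
  qed (auto simp: q_def)
  have qc: "q \<in> line_perms ?I ?c" using q qI by (simp add: line_perms_def)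
  let ?p = "finv q"
  have p: "?p permutes ?I" using q by (rule permutes_inv)
  have num: "numbering h mu (map_tab ?p t)"
    using t.permuted[OF p] by (simp add: numbered_tableau_def)
  have "row_of mu t' a = row_of mu (map_tab ?p t) a" if "a \<in> ?I" for a
    using t.row_of_map[OF p qI(1)[OF that]] qI(3)[OF that] by (simp add: permutes_inverses(2)[OF q])
  then have "tabloid t' = tabloid (map_tab ?p t)" unfolding tabloid_eq_iff[OF t' num] by blast
  then show ?thesis using line_perms_inv[OF qc] t.column_group_eq by blast
qed

section \<open>Polytabloids and signed column sums\<close>

lemma tabloid_action_linear: "clinear (tabloid_action s)"
  unfolding tabloid_action_def pushforward_eq_lift by (rule clinear_lift)

lemma tabloid_action_single [simp]:
  "tabloid_action s (Poly_Mapping.single X c) = Poly_Mapping.single (map (image s) X) c"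
  by (simp add: tabloid_action_def pushforward_eq_lift cscale_single)

text \<open>The column group of the moved tableau is the conjugate by \<open>s\<close>, with the
  same signs.\<close>

lemma polytabloid_permuted:
  assumes t: "numbering h mu t" and s: "s permutes {1..h}"
  shows "polytabloid h (map_tab s t) = tabloid_action s (polytabloid h t)"
proof -
  interpret t: numbered_tableau h mu t using t by unfold_locales
  interpret s: numbered_tableau h mu "map_tab s t" using s by (rule t.permuted)
  let ?I = "{1..h}"
  have si: "finv s permutes ?I" using s by (rule permutes_inv)
  have col: "col_of mu (map_tab s t) a = col_of mu t (finv s a)" if "a \<in> ?I" for a
    using t.col_of_map[OF s, of "finv s a"] permutes_in_image[OF si, of a] that
    by (simp add: permutes_inverses(1)[OF s])
  have colt: "col_of mu (map_tab s t) (s a) = col_of mu t a" if "a \<in> ?I" for a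
    using t.col_of_map[OF s that] .
  have perm: "permutation s" "permutation (finv s)" using s si by (auto intro: permutes_imp_permutation)
  have "tabloid_action s (polytabloid h t) =
     (\<Sum>p\<in>column_group h t. Poly_Mapping.single (tabloid (map_tab (s \<circ> p) t)) (of_int (sign p)))"
    by (simp add: polytabloid_def clinear_sum[OF tabloid_action_linear] tabloid_def image_comp comp_def)
  also have "\<dots> = (\<Sum>p\<in>column_group h (map_tab s t).
      Poly_Mapping.single (tabloid (map_tab p (map_tab s t))) (of_int (sign p)))"
  proof (rule sum.reindex_bij_witness[of _ "\<lambda>p. finv s \<circ> p \<circ> s" "\<lambda>p. s \<circ> p \<circ> finv s"])
    fix p
    assume p: "p \<in> column_group h t"
    then have pl: "p \<in> line_perms ?I (col_of mu t)" by (simp add: t.column_group_eq)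
    then have pI: "p permutes ?I" by (rule line_perms_permutes)
    show "finv s \<circ> (s \<circ> p \<circ> finv s) \<circ> s = p"
      by (simp add: fun_eq_iff permutes_inverses(2)[OF s])
    have "col_of mu (map_tab s t) (s (p (finv s a))) = col_of mu (map_tab s t) a" if a: "a \<in> ?I" for a
    proof -
      have "finv s a \<in> ?I" using permutes_in_image[OF si] a by simp
      moreover from this have "p (finv s a) \<in> ?I" using permutes_in_image[OF pI] by simp
      ultimately show ?thesis using pl a by (simp add: colt col line_perms_def)
    qed
    then show "s \<circ> p \<circ> finv s \<in> column_group h (map_tab s t)"
      using s pI si by (simp add: s.column_group_eq line_perms_def permutes_compose)
    have "sign (s \<circ> p \<circ> finv s) = sign p"
      using perm permutes_imp_permutation[OF _ pI]
      by (simp add: sign_compose permutation_compose sign_inverse)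
    moreover have "s \<circ> p \<circ> finv s \<circ> s = s \<circ> p"
      by (simp add: fun_eq_iff permutes_inverses(2)[OF s])
    ultimately show "Poly_Mapping.single (tabloid (map_tab (s \<circ> p \<circ> finv s) (map_tab s t))) (of_int (sign (s \<circ> p \<circ> finv s))) =
        (Poly_Mapping.single (tabloid (map_tab (s \<circ> p) t)) (of_int (sign p)) :: _ \<Rightarrow>\<^sub>0 complex)" by simp
  next
    fix p
    assume "p \<in> column_group h (map_tab s t)"
    then have pl: "p \<in> line_perms ?I (col_of mu (map_tab s t))" by (simp add: s.column_group_eq)
    then have pI: "p permutes ?I" by (rule line_perms_permutes)
    show "s \<circ> (finv s \<circ> p \<circ> s) \<circ> finv s = p"
      by (simp add: fun_eq_iff permutes_inverses(1)[OF s])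
    have "col_of mu t (finv s (p (s a))) = col_of mu t a" if a: "a \<in> ?I" for a
    proof -
      have sa: "s a \<in> ?I" using permutes_in_image[OF s] a by simp
      then have "p (s a) \<in> ?I" using permutes_in_image[OF pI] by simp
      then have "col_of mu t (finv s (p (s a))) = col_of mu (map_tab s t) (p (s a))" by (simp add: col)
      also have "\<dots> = col_of mu (map_tab s t) (s a)" using pl sa by (simp add: line_perms_def)
      finally show ?thesis using a by (simp add: colt)
    qed
    then show "finv s \<circ> p \<circ> s \<in> column_group h t"
      using s pI si by (simp add: t.column_group_eq line_perms_def permutes_compose)
  qed
  finally show ?thesis by (simp add: polytabloid_def)
qed

text \<open>The alternating column sum usually written kappa_t, as an operator on all of the tabloid
  module; the polytabloid of \<open>t\<close> is its value at the tabloid of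
  \<open>t\<close>.\<close>

definition column_sum :: "nat \<Rightarrow> nat list list \<Rightarrow> (nat set list \<Rightarrow>\<^sub>0 complex) \<Rightarrow> (nat set list \<Rightarrow>\<^sub>0 complex)" where
  "column_sum h t u = (\<Sum>p\<in>column_group h t. cscale (of_int (sign p)) (tabloid_action p u))"

lemma column_sum_linear: "clinear (column_sum h t)"
  unfolding column_sum_def
  by (intro clinear_setsum clinear_scaled tabloid_action_linear)

lemma polytabloid_eq_column_sum: "polytabloid h t = column_sum h t (Poly_Mapping.single (tabloid t) 1)"
  by (simp add: polytabloid_def column_sum_def cscale_single tabloid_def comp_def)

text \<open>If two entries of a column of \<open>t\<close> share a row of \<open>t'\<close>, their
  transposition fixes the tabloid of \<open>t'\<close> and reverses the sign of the sum, which is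
  therefore 0. Otherwise this tabloid arises from that of \<open>t\<close> by a column permutation,
  which only costs its sign.\<close>

lemma column_sum_tabloid:
  assumes mu: "partition_of mu h" and t: "numbering h mu t" and t': "numbering h mu t'"
  shows "\<exists>k. column_sum h t (Poly_Mapping.single (tabloid t') 1) = cscale k (polytabloid h t)"
proof -
  interpret t: numbered_tableau h mu t using t by unfold_locales
  interpret t': numbered_tableau h mu t' using t' by unfold_locales
  let ?I = "{1..h}" and ?X = "Poly_Mapping.single (tabloid t') (1::complex)"
  let ?G = "line_perms ?I (col_of mu t)"
  have GI: "p permutes ?I" if "p \<in> ?G" for p using that by (rule line_perms_permutes)
  have im: "image (p \<circ> q) = image p \<circ> image q" for p q :: "nat \<Rightarrow> nat"
    by (simp add: fun_eq_iff image_comp)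
  have act: "tabloid_action (p \<circ> q) u = tabloid_action p (tabloid_action q u)" for p q u
    by (rule clinear_eqI[of "tabloid_action (p \<circ> q)" "\<lambda>u. tabloid_action p (tabloid_action q u)"]) (simp_all add: tabloid_action_linear clinear_compose im)
  show ?thesis
  proof (cases "\<exists>a\<in>?I. \<exists>b\<in>?I. a \<noteq> b \<and> col_of mu t a = col_of mu t b \<and> row_of mu t' a = row_of mu t' b")
    case True
    then obtain a b where ab: "a \<in> ?I" "b \<in> ?I" "a \<noteq> b" "col_of mu t a = col_of mu t b"
      "row_of mu t' a = row_of mu t' b" by blast
    let ?w = "Transposition.transpose a b"
    have w: "?w \<in> ?G" using ab(1,2,4) by (rule transpose_line_perms)
    have wI: "?w permutes ?I" using w by (rule GI)
    have num: "numbering h mu (map_tab ?w t')" using t'.permuted[OF wI] by (simp add: numbered_tableau_def)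
    have "row_of mu (map_tab ?w t') x = row_of mu t' x" if x: "x \<in> ?I" for x
    proof -
      have "row_of mu (map_tab ?w t') (?w (?w x)) = row_of mu t' (?w x)"
        using permutes_in_image[OF wI] x by (intro t'.row_of_map[OF wI]) simp
      then show ?thesis using ab(5) by (auto simp: Transposition.transpose_def split: if_splits)
    qed
    then have "tabloid (map_tab ?w t') = tabloid t'" unfolding tabloid_eq_iff[OF num t'] by blast
    then have fix_X: "tabloid_action ?w ?X = ?X" by (simp add: t'.tabloid_map)
    have "column_sum h t ?X = (\<Sum>p\<in>?G. cscale (of_int (sign (p \<circ> ?w))) (tabloid_action (p \<circ> ?w) ?X))"
      unfolding column_sum_def t.column_group_eq by (rule sum_line_perms_right[OF w, symmetric])
    also have "\<dots> = (\<Sum>p\<in>?G. - cscale (of_int (sign p)) (tabloid_action p ?X))"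
    proof (rule sum.cong[OF refl])
      fix p assume "p \<in> ?G"
      then have "sign (p \<circ> ?w) = - sign p"
        using sign_compose[OF permutes_imp_permutation[OF _ GI] permutes_imp_permutation[OF _ wI], of p] ab(3)
        by (simp add: sign_swap_id)
      then show "cscale (of_int (sign (p \<circ> ?w))) (tabloid_action (p \<circ> ?w) ?X) =
          - cscale (of_int (sign p)) (tabloid_action p ?X)"
        by (simp only: act fix_X of_int_minus cvs.scale_minus_left)
    qed
    also have "\<dots> = - column_sum h t ?X" by (simp only: sum_negf column_sum_def t.column_group_eq)
    finally have e: "column_sum h t ?X = - column_sum h t ?X" .
    have "column_sum h t ?X = 0"
    proof (rule poly_mapping_eqI)
      fix Y
      have "Poly_Mapping.lookup (column_sum h t ?X) Y = - Poly_Mapping.lookup (column_sum h t ?X) Y"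
        using arg_cong[OF e, of "\<lambda>u. Poly_Mapping.lookup u Y"] by (simp only: lookup_uminus)
      moreover have "z = - z \<Longrightarrow> z = 0" for z :: complex by (simp add: complex_eq_iff)
      ultimately show "Poly_Mapping.lookup (column_sum h t ?X) Y = Poly_Mapping.lookup 0 Y" by simp
    qed
    then show ?thesis by (intro exI[of _ 0]) simp
  next
    case False
    then obtain q where q: "q \<in> ?G" "tabloid t' = tabloid (map_tab q t)"
      using column_sort_exists[OF mu t t'] t.column_group_eq by blast
    have qI: "q permutes ?I" using q(1) by (rule GI)
    let ?Y = "Poly_Mapping.single (tabloid t) (1::complex)"
    have X: "?X = tabloid_action q ?Y" using q(2) by (simp add: t.tabloid_map)
    have "column_sum h t ?X = (\<Sum>p\<in>?G. cscale (of_int (sign q)) (cscale (of_int (sign (p \<circ> q))) (tabloid_action (p \<circ> q) ?Y)))"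
      unfolding column_sum_def t.column_group_eq
    proof (rule sum.cong[OF refl])
      fix p assume "p \<in> ?G"
      then have "sign (p \<circ> q) = sign p * sign q"
        using sign_compose[OF permutes_imp_permutation[OF _ GI] permutes_imp_permutation[OF _ qI], of p]
        by simp
      then have "sign q * sign (p \<circ> q) = sign p" by (simp add: mult.left_commute)
      then have "of_int (sign q) * of_int (sign (p \<circ> q)) = (of_int (sign p) :: complex)"
        by (metis of_int_mult)
      then show "cscale (of_int (sign p)) (tabloid_action p ?X) =
          cscale (of_int (sign q)) (cscale (of_int (sign (p \<circ> q))) (tabloid_action (p \<circ> q) ?Y))"
        by (simp only: X act cvs.scale_scale)
    qed
    also have "\<dots> = cscale (of_int (sign q)) (\<Sum>p\<in>?G. cscale (of_int (sign (p \<circ> q))) (tabloid_action (p \<circ> q) ?Y))"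
      by (simp only: cvs.scale_sum_right)
    also have "(\<Sum>p\<in>?G. cscale (of_int (sign (p \<circ> q))) (tabloid_action (p \<circ> q) ?Y)) = polytabloid h t"
      unfolding polytabloid_eq_column_sum column_sum_def t.column_group_eq
      by (rule sum_line_perms_right[OF q(1)])
    finally show ?thesis by blast
  qed
qed

text \<open>An endomorphism of the tabloid module with values in the Specht module. Summing over all
  numberings of a tabloid avoids a choice and makes it commute with the symmetric group.\<close>

definition tabloid_sum :: "nat \<Rightarrow> nat list \<Rightarrow> (nat set list \<Rightarrow>\<^sub>0 complex) \<Rightarrow> (nat set list \<Rightarrow>\<^sub>0 complex)" where
  "tabloid_sum h mu = lift (\<lambda>X. \<Sum>t\<in>{t. numbering h mu t \<and> tabloid t = X}. polytabloid h t)"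

lemma tabloid_sum_equivariant:
  assumes s: "s permutes {1..h}"
  shows "tabloid_sum h mu (tabloid_action s u) = tabloid_action s (tabloid_sum h mu u)"
proof (rule clinear_eqI[of "\<lambda>u. tabloid_sum h mu (tabloid_action s u)" "\<lambda>u. tabloid_action s (tabloid_sum h mu u)"])
  fix X
  have si: "finv s permutes {1..h}" using s by (rule permutes_inv)
  have ss: "map_tab s (map_tab (finv s) t) = t" "map_tab (finv s) (map_tab s t) = t" for t
    by (simp_all add: comp_def permutes_inverses[OF s])
  have iX: "map (image (finv s)) (map (image s) X) = X"
    by (simp add: comp_def image_image permutes_inverses[OF s])
  have "(\<Sum>t\<in>{t. numbering h mu t \<and> tabloid t = map (image s) X}. polytabloid h t) =
      (\<Sum>t\<in>{t. numbering h mu t \<and> tabloid t = X}. tabloid_action s (polytabloid h t))"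
  proof (rule sum.reindex_bij_witness[of _ "map_tab s" "map_tab (finv s)"])
    fix t assume t: "t \<in> {t. numbering h mu t \<and> tabloid t = map (image s) X}"
    interpret t: numbered_tableau h mu t using t by unfold_locales simp
    interpret u: numbered_tableau h mu "map_tab (finv s) t" by (rule t.permuted[OF si])
    show "map_tab s (map_tab (finv s) t) = t" by (rule ss)
    show "map_tab (finv s) t \<in> {t. numbering h mu t \<and> tabloid t = X}"
      using t u.numbering iX by (simp add: t.tabloid_map)
    show "tabloid_action s (polytabloid h (map_tab (finv s) t)) = polytabloid h t"
      using polytabloid_permuted[OF u.numbering s] ss(1) by simp
  next
    fix t assume t: "t \<in> {t. numbering h mu t \<and> tabloid t = X}"
    interpret t: numbered_tableau h mu t using t by unfold_locales simp
    interpret u: numbered_tableau h mu "map_tab s t" by (rule t.permuted[OF s])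
    show "map_tab (finv s) (map_tab s t) = t" by (rule ss)
    show "map_tab s t \<in> {t. numbering h mu t \<and> tabloid t = map (image s) X}"
      using t u.numbering by (simp add: t.tabloid_map)
  qed
  then show "tabloid_sum h mu (tabloid_action s (Poly_Mapping.single X 1)) =
      tabloid_action s (tabloid_sum h mu (Poly_Mapping.single X 1))"
    by (simp add: tabloid_sum_def clinear_sum[OF tabloid_action_linear])
qed (simp_all add: tabloid_sum_def tabloid_action_linear clinear_lift clinear_compose)

text \<open>No form of Schur's lemma enters. A polytabloid is kappa_t of a tabloid; by equivariance
  \<open>tabloid_sum\<close> commutes with kappa_t, and kappa_t sends every tabloid to a multiple of
  the polytabloid of \<open>t\<close>. The scalar is the same for all numberings because they are
  permuted transitively.\<close>

lemma tabloid_sum_polytabloid: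
  assumes mu: "partition_of mu h" and t0: "numbering h mu t0"
  shows "\<exists>d. \<forall>t. numbering h mu t \<longrightarrow> tabloid_sum h mu (polytabloid h t) = cscale d (polytabloid h t)"
proof -
  interpret t0: numbered_tableau h mu t0 using t0 by unfold_locales
  have "\<exists>k. column_sum h t0 (polytabloid h t') = cscale k (polytabloid h t0)" if t': "numbering h mu t'" for t'
  proof -
    interpret t': numbered_tableau h mu t' using t' by unfold_locales
    have "\<exists>k. column_sum h t0 (Poly_Mapping.single (tabloid (map_tab p t')) 1) = cscale k (polytabloid h t0)"
      if "p \<in> column_group h t'" for p
      using column_sum_tabloid[OF mu t0, of "map_tab p t'"] t'.permuted[of p] that
      by (simp add: column_group_def numbered_tableau_def)
    then obtain k where k: "column_sum h t0 (Poly_Mapping.single (tabloid (map_tab p t')) 1) = cscale (k p) (polytabloid h t0)"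
      if "p \<in> column_group h t'" for p by metis
    have "polytabloid h t' = (\<Sum>p\<in>column_group h t'. cscale (of_int (sign p)) (Poly_Mapping.single (tabloid (map_tab p t')) 1))"
      by (simp add: polytabloid_def cscale_single)
    then have "column_sum h t0 (polytabloid h t') =
        (\<Sum>p\<in>column_group h t'. cscale (of_int (sign p)) (cscale (k p) (polytabloid h t0)))"
      by (simp add: clinear_sum[OF column_sum_linear] clinear_cscale[OF column_sum_linear] k)
    also have "\<dots> = cscale (\<Sum>p\<in>column_group h t'. of_int (sign p) * k p) (polytabloid h t0)"
      by (simp add: cvs.scale_sum_left)
    finally show ?thesis by blast
  qed
  then obtain k where k: "column_sum h t0 (polytabloid h t') = cscale (k t') (polytabloid h t0)"
    if "numbering h mu t'" for t' by metis
  let ?X = "Poly_Mapping.single (tabloid t0) (1::complex)"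
  have lin: "clinear (tabloid_sum h mu)" unfolding tabloid_sum_def by (rule clinear_lift)
  have "tabloid_sum h mu (polytabloid h t0) = column_sum h t0 (tabloid_sum h mu ?X)"
  proof -
    have "tabloid_sum h mu (polytabloid h t0) =
        (\<Sum>p\<in>column_group h t0. cscale (of_int (sign p)) (tabloid_sum h mu (tabloid_action p ?X)))"
      by (simp add: polytabloid_eq_column_sum column_sum_def clinear_sum[OF lin] clinear_cscale[OF lin])
    also have "\<dots> = column_sum h t0 (tabloid_sum h mu ?X)"
      unfolding column_sum_def
      by (intro sum.cong refl) (simp add: column_group_def tabloid_sum_equivariant del: tabloid_action_single)
    finally show ?thesis .
  qed
  also have "\<dots> = (\<Sum>t\<in>{t. numbering h mu t \<and> tabloid t = tabloid t0}. cscale (k t) (polytabloid h t0))"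
    by (simp add: tabloid_sum_def clinear_sum[OF column_sum_linear] k)
  also have "\<dots> = cscale (\<Sum>t\<in>{t. numbering h mu t \<and> tabloid t = tabloid t0}. k t) (polytabloid h t0)"
    by (simp add: cvs.scale_sum_left)
  finally obtain d where d: "tabloid_sum h mu (polytabloid h t0) = cscale d (polytabloid h t0)" by blast
  have "tabloid_sum h mu (polytabloid h t) = cscale d (polytabloid h t)" if t: "numbering h mu t" for t
  proof -
    interpret t: numbered_tableau h mu t using t by unfold_locales
    define s where "s = (\<lambda>a. if a \<in> {1..h} then entry t (row_of mu t0 a, col_of mu t0 a) else a)"
    have bij: "bij_betw (entry t \<circ> inv_into (diagram mu) (entry t0)) {1..h} {1..h}"
      by (rule bij_betw_trans[OF bij_betw_inv_into[OF t0.entry_bij] t.entry_bij])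
    have "bij_betw s {1..h} {1..h}"
      by (rule bij_betw_cong[THEN iffD1, OF _ bij]) (simp add: s_def row_of_def col_of_def)
    then have s: "s permutes {1..h}" by (intro bij_imp_permutes) (auto simp: s_def)
    have "map_tab s t0 = t"
    proof (rule nth_equalityI)
      show "length (map_tab s t0) = length t" by (simp add: t0.len t.len)
      fix r assume "r < length (map_tab s t0)"
      then have r: "r < length mu" by (simp add: t0.len)
      show "map_tab s t0 ! r = t ! r"
      proof (rule nth_equalityI)
        show "length (map_tab s t0 ! r) = length (t ! r)" using r by (simp add: t0.len t.len)
        fix c assume "c < length (map_tab s t0 ! r)"
        then have c: "c < mu ! r" using r by (simp add: t0.len)
        have d: "(r, c) \<in> diagram mu" using r c by (simp add: diagram_def)
        have "s (entry t0 (r, c)) = entry t (r, c)"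
          using t0.entry_in[OF d] t0.row_of_entry[OF d] t0.col_of_entry[OF d] by (simp add: s_def)
        then show "map_tab s t0 ! r ! c = t ! r ! c"
          using r c by (simp add: entry_def t0.len)
      qed
    qed
    then have e: "polytabloid h t = tabloid_action s (polytabloid h t0)"
      using polytabloid_permuted[OF t0 s] by simp
    show ?thesis
      unfolding e tabloid_sum_equivariant[OF s] d by (rule clinear_cscale[OF tabloid_action_linear])
  qed
  then show ?thesis by blast
qed

text \<open>
  Since \<open>tabloid_sum\<close> maps into the Specht module and is multiplication by \<open>d\<close> there, the trace of
  \<open>\<sigma>\<close> on the module is, up to \<open>d\<close>, the trace of \<open>\<sigma> \<circ> tabloid_sum\<close> on the span of all tabloids.
\<close>

lemma specht_trace:
  assumes mu: "partition_of mu h" and s: "s permutes {1..h}"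
    and d: "\<And>t. numbering h mu t \<Longrightarrow> tabloid_sum h mu (polytabloid h t) = cscale d (polytabloid h t)"
  shows "d * specht_character h mu s =
     (\<Sum>t\<in>{t. numbering h mu t}. Poly_Mapping.lookup (tabloid_action s (polytabloid h t)) (tabloid t))"
proof -
  let ?Num = "{t. numbering h mu t}" and ?V = "specht_module h mu"
  let ?T = "tabloid ` ?Num" and ?Q = "\<lambda>u. tabloid_action s (tabloid_sum h mu u)"
  have lin: "clinear (tabloid_sum h mu)" unfolding tabloid_sum_def by (rule clinear_lift)
  have V: "cvs.subspace ?V" unfolding specht_module_def by (rule cvs.subspace_span)
  have poly_V: "polytabloid h t \<in> ?V" if "numbering h mu t" for t
    unfolding specht_module_def using that by (intro cvs.span_base) auto
  have permuted: "numbering h mu (map_tab p t)" if "numbering h mu t" "p permutes {1..h}" for p t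
    using numbered_tableau.permuted[of h mu t p] that by (simp add: numbered_tableau_def)
  have keysV: "Poly_Mapping.keys v \<subseteq> ?T" if "v \<in> ?V" for v
  proof -
    have "cvs.subspace {v :: nat set list \<Rightarrow>\<^sub>0 complex. Poly_Mapping.keys v \<subseteq> ?T}"
    proof (rule cvs.subspaceI)
      fix c and x :: "nat set list \<Rightarrow>\<^sub>0 complex"
      assume "x \<in> {v. Poly_Mapping.keys v \<subseteq> ?T}"
      then show "cscale c x \<in> {v. Poly_Mapping.keys v \<subseteq> ?T}" by (auto simp: in_keys_iff subset_iff)
    next
      fix x y :: "nat set list \<Rightarrow>\<^sub>0 complex"
      assume "x \<in> {v. Poly_Mapping.keys v \<subseteq> ?T}" "y \<in> {v. Poly_Mapping.keys v \<subseteq> ?T}"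
      then show "x + y \<in> {v. Poly_Mapping.keys v \<subseteq> ?T}"
        using order.trans[OF Poly_Mapping.keys_add[of x y], of ?T] by simp
    qed simp
    moreover have "Poly_Mapping.keys (polytabloid h t) \<subseteq> ?T" if "numbering h mu t" for t
    proof -
      have "Poly_Mapping.keys (polytabloid h t) \<subseteq> (\<Union>p\<in>column_group h t. {tabloid (map_tab p t)})"
        unfolding polytabloid_def by (rule order.trans[OF Poly_Mapping.keys_sum]) auto
      also have "\<dots> \<subseteq> ?T" using permuted[OF that] by (auto simp: column_group_def)
      finally show ?thesis .
    qed
    ultimately show ?thesis
      using that cvs.span_minimal[of "{polytabloid h t | t. numbering h mu t}" "{v. Poly_Mapping.keys v \<subseteq> ?T}"]
      unfolding specht_module_def by blast
  qed
  have sV: "tabloid_action s v \<in> ?V" if "v \<in> ?V" for v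
  proof -
    have "cvs.subspace {v. tabloid_action s v \<in> ?V}"
      using V by (auto simp: cvs.subspace_def clinear_0 clinear_add clinear_cscale tabloid_action_linear)
    then have "?V \<subseteq> {v. tabloid_action s v \<in> ?V}"
      unfolding specht_module_def[of h mu, symmetric]
      by (subst (1) specht_module_def, intro cvs.span_minimal)
        (auto simp: polytabloid_permuted[OF _ s, symmetric] intro!: poly_V permuted s)
    then show ?thesis using that by blast
  qed
  have dV: "tabloid_sum h mu v = cscale d v" if "v \<in> ?V" for v
  proof -
    have "cvs.subspace {v. tabloid_sum h mu v = cscale d v}"
      by (auto simp: cvs.subspace_def clinear_0 clinear_add clinear_cscale lin cvs.scale_right_distrib
        mult.commute)
    then have "?V \<subseteq> {v. tabloid_sum h mu v = cscale d v}"
      unfolding specht_module_def using d by (intro cvs.span_minimal) auto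
    then show ?thesis using that by blast
  qed
  have sumX: "tabloid_sum h mu (Poly_Mapping.single X 1) =
      (\<Sum>t\<in>{t. numbering h mu t \<and> tabloid t = X}. polytabloid h t)" for X
    by (simp add: tabloid_sum_def)
  have "d * specht_character h mu s = (\<Sum>X\<in>?T. Poly_Mapping.lookup (?Q (Poly_Mapping.single X 1)) X)"
    unfolding specht_character_def
  proof (rule trace_on_projection[symmetric])
    show "finite ?T" using finite_numberings by simp
    show "clinear ?Q" by (rule clinear_compose[OF tabloid_action_linear lin])
    show "?Q (Poly_Mapping.single X 1) \<in> ?V" for X
      unfolding sumX by (intro sV cvs.subspace_sum V) (auto intro: poly_V)
    show "?Q v = cscale d (tabloid_action s v)" if "v \<in> ?V" for v
      by (simp only: dV[OF that] clinear_cscale[OF tabloid_action_linear])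
  qed (use keysV V in auto)
  also have "\<dots> = (\<Sum>X\<in>?T. \<Sum>t\<in>{t\<in>?Num. tabloid t = X}. Poly_Mapping.lookup (tabloid_action s (polytabloid h t)) (tabloid t))"
    unfolding sumX by (intro sum.cong refl) (simp add: clinear_sum[OF tabloid_action_linear] lookup_sum)
  also have "\<dots> = (\<Sum>t\<in>?Num. Poly_Mapping.lookup (tabloid_action s (polytabloid h t)) (tabloid t))"
    using finite_numberings by (intro sum.group) auto
  finally show ?thesis .
qed

text \<open>The tabloid of \<open>t\<close> moved by \<open>s \<circ> p\<close> is again that of
  \<open>t\<close> exactly if \<open>s \<circ> p\<close> preserves the rows of
  \<open>t\<close>.\<close>

lemma lookup_polytabloid_action:
  assumes t: "numbering h mu t" and s: "s permutes {1..h}"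
  shows "Poly_Mapping.lookup (tabloid_action s (polytabloid h t)) (tabloid t) =
    (\<Sum>p\<in>line_perms {1..h} (col_of mu t).
       if s \<circ> p \<in> line_perms {1..h} (row_of mu t) then of_int (sign p) else 0)"
proof -
  interpret t: numbered_tableau h mu t using t by unfold_locales
  have "(tabloid (map_tab (s \<circ> p) t) = tabloid t) = (s \<circ> p \<in> line_perms {1..h} (row_of mu t))"
    if "p \<in> line_perms {1..h} (col_of mu t)" for p
  proof -
    have sp: "s \<circ> p permutes {1..h}" using s line_perms_permutes[OF that] by (rule permutes_compose[rotated])
    have num: "numbering h mu (map_tab (s \<circ> p) t)"
      using t.permuted[OF sp] by (simp add: numbered_tableau_def)
    have all: "(\<forall>a\<in>{1..h}. P a) \<longleftrightarrow> (\<forall>a\<in>{1..h}. P ((s \<circ> p) a))" for P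
    proof -
      have "(\<forall>a\<in>(s \<circ> p) ` {1..h}. P a) \<longleftrightarrow> (\<forall>a\<in>{1..h}. P ((s \<circ> p) a))" by blast
      then show ?thesis unfolding permutes_image[OF sp] .
    qed
    have "(\<forall>a\<in>{1..h}. row_of mu (map_tab (s \<circ> p) t) a = row_of mu t a) \<longleftrightarrow>
        (\<forall>a\<in>{1..h}. row_of mu (map_tab (s \<circ> p) t) ((s \<circ> p) a) = row_of mu t ((s \<circ> p) a))"
      by (rule all)
    also have "\<dots> \<longleftrightarrow> (\<forall>a\<in>{1..h}. row_of mu t a = row_of mu t ((s \<circ> p) a))"
      using t.row_of_map[OF sp] by simp
    also have "\<dots> \<longleftrightarrow> s \<circ> p \<in> line_perms {1..h} (row_of mu t)"
      using sp by (auto simp: line_perms_def)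
    finally show ?thesis unfolding tabloid_eq_iff[OF num t] .
  qed
  then show ?thesis
    by (auto simp: polytabloid_def clinear_sum[OF tabloid_action_linear] lookup_sum lookup_single when_def
        t.column_group_eq tabloid_def image_comp comp_def intro!: sum.cong)
qed

text \<open>The scalar \<open>d\<close> is that of \<open>tabloid_sum\<close>. At the identity each
  numbering contributes 1, since its row and column groups meet only in the identity; so
  \<open>d\<close> times the degree is the number of numberings, and \<open>d\<close> cannot
  vanish.\<close>

lemma specht_character_formula:
  assumes mu: "partition_of mu h"
  obtains d where "d \<noteq> 0" "\<And>s. s permutes {1..h} \<Longrightarrow> d * specht_character h mu s =
    (\<Sum>t\<in>{t. numbering h mu t}. \<Sum>p\<in>line_perms {1..h} (col_of mu t).
       if s \<circ> p \<in> line_perms {1..h} (row_of mu t) then of_int (sign p) else 0)"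
proof -
  let ?Num = "{t. numbering h mu t}"
  obtain d where d: "\<And>t. numbering h mu t \<Longrightarrow> tabloid_sum h mu (polytabloid h t) = cscale d (polytabloid h t)"
    using tabloid_sum_polytabloid[OF mu] by (metis (no_types))
  have formula: "d * specht_character h mu s =
    (\<Sum>t\<in>?Num. \<Sum>p\<in>line_perms {1..h} (col_of mu t).
       if s \<circ> p \<in> line_perms {1..h} (row_of mu t) then of_int (sign p) else 0)" if "s permutes {1..h}" for s
  proof -
    have "d * specht_character h mu s =
        (\<Sum>t\<in>?Num. Poly_Mapping.lookup (tabloid_action s (polytabloid h t)) (tabloid t))"
      by (rule specht_trace[OF mu that]) (rule d)
    also have "\<dots> = (\<Sum>t\<in>?Num. \<Sum>p\<in>line_perms {1..h} (col_of mu t).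
       if s \<circ> p \<in> line_perms {1..h} (row_of mu t) then of_int (sign p) else 0)"
      by (rule sum.cong[OF refl], rule lookup_polytabloid_action[OF _ that]) simp
    finally show ?thesis .
  qed
  show thesis
  proof (cases "?Num = {}")
    \<comment> \<open>Without numberings the character and all sums are zero and any nonzero
      \<open>d\<close> will do; this case spares the construction of a numbering.\<close>
    case True
    have "specht_character h mu s = 0" if "s permutes {1..h}" for s
      using specht_trace[OF mu that, of 1] True by simp
    then show ?thesis using True by (intro that[of 1]) simp_all
  next
    case False
    have "(\<Sum>p\<in>line_perms {1..h} (col_of mu t).
       if id \<circ> p \<in> line_perms {1..h} (row_of mu t) then of_int (sign p) else 0) = (1::complex)" if "t \<in> ?Num" for t
    proof -
      interpret t: numbered_tableau h mu t using that by unfold_locales simp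
      have triv: "p = id" if "p \<in> line_perms {1..h} (col_of mu t)" "p \<in> line_perms {1..h} (row_of mu t)" for p
      proof
        fix a
        have p: "p permutes {1..h}" using that(1) by (rule line_perms_permutes)
        show "p a = id a"
        proof (cases "a \<in> {1..h}")
          case True
          then have "p a \<in> {1..h}" using permutes_in_image[OF p] by simp
          then show ?thesis
            using t.entry_position[of "p a"] t.entry_position[OF True] that True
            by (simp add: line_perms_def)
        next
          case False
          then show ?thesis using permutes_not_in[OF p] by simp
        qed
      qed
      have "(\<Sum>p\<in>line_perms {1..h} (col_of mu t).
          if id \<circ> p \<in> line_perms {1..h} (row_of mu t) then of_int (sign p) else 0) =
          (\<Sum>p\<in>line_perms {1..h} (col_of mu t). if p = id then (1::complex) else 0)"
        using triv by (intro sum.cong) auto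
      then show ?thesis by (simp add: finite_line_perms)
    qed
    then have "d * specht_character h mu id = (\<Sum>t\<in>?Num. 1)"
      using formula[OF permutes_id] by simp
    then have "d * specht_character h mu id = of_nat (card ?Num)" by simp
    moreover have "card ?Num \<noteq> 0" using False finite_numberings by simp
    ultimately have "d \<noteq> 0" by auto
    then show ?thesis using formula by (rule that)
  qed
qed

section \<open>A Fock space representation\<close>

text \<open>
  The mode \<open>(a, k)\<close> is the variable \<open>(a|k)\<close> of the polynomial superalgebra on which
  \<open>e\<^bsub>a,b\<^esub>\<close> acts as the polarization \<open>\<Sum>\<^sub>k (a|k) \<partial>/\<partial>(b|k)\<close>.  It is anticommuting exactly if
  \<open>a\<close> is some \<open>\<alpha>\<^sub>r\<close>.  A monomial is a multiset of modes; of the multiplicity of an anticommuting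
  mode only the parity is relevant.
\<close>

type_synonym mode = "symb \<times> nat"
type_synonym fock = "mode multiset \<Rightarrow>\<^sub>0 complex"

fun alpha_index :: "symb \<Rightarrow> nat" where
  "alpha_index (Alpha r) = r"
| "alpha_index _ = 0"

definition is_alpha :: "symb \<Rightarrow> bool" where
  "is_alpha a \<longleftrightarrow> symb_parity a = 0"

definition fermionic :: "mode \<Rightarrow> bool" where
  "fermionic x \<longleftrightarrow> is_alpha (fst x)"

text \<open>An enumeration of the anticommuting modes; their order fixes the signs of Jordan-Wigner
  type in \<open>mode_sign\<close>.\<close>

definition mode_index :: "mode \<Rightarrow> nat" where
  "mode_index x = prod_encode (alpha_index (fst x), snd x)"

definition mode_sign :: "mode \<Rightarrow> mode multiset \<Rightarrow> complex" where
  "mode_sign x s = (-1) ^ size (filter_mset (\<lambda>y. fermionic y \<and> mode_index y < mode_index x) s)"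

text \<open>Multiplication by the variable \<open>x\<close>, with \<open>an\<close> as the
  derivative. An anticommuting mode counts as occupied when its multiplicity is odd, so the space
  need not be cut down to multisets without repetitions.\<close>

definition cr :: "mode \<Rightarrow> fock \<Rightarrow> fock" where
  "cr x = lift (\<lambda>s. if fermionic x
     then if even (count s x) then Poly_Mapping.single (add_mset x s) (mode_sign x s) else 0
     else Poly_Mapping.single (add_mset x s) 1)"

definition an :: "mode \<Rightarrow> fock \<Rightarrow> fock" where
  "an x = lift (\<lambda>s. if fermionic x
     then if odd (count s x) then Poly_Mapping.single (s - {#x#}) (mode_sign x s) else 0
     else Poly_Mapping.single (s - {#x#}) (of_nat (count s x)))"

definition swap_sign :: "mode \<Rightarrow> mode \<Rightarrow> complex" where
  "swap_sign x y = (if fermionic x \<and> fermionic y then -1 else 1)"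

section \<open>Commutation and anticommutation relations\<close>

lemma is_alphaE: "is_alpha a \<Longrightarrow> (\<And>r. a = Alpha r \<Longrightarrow> P) \<Longrightarrow> P"
  by (cases a) (auto simp: is_alpha_def)

lemma mode_index_inj: "fermionic x \<Longrightarrow> fermionic y \<Longrightarrow> mode_index x = mode_index y \<Longrightarrow> x = y"
  by (cases x; cases y) (auto simp: fermionic_def mode_index_def elim!: is_alphaE)

lemma clinear_cr: "clinear (cr x)" and clinear_an: "clinear (an x)"
  by (simp_all add: cr_def an_def clinear_lift)

lemma mode_sign_add:
  "mode_sign x (add_mset y s) = (if fermionic y \<and> mode_index y < mode_index x then - mode_sign x s else mode_sign x s)"
  by (simp add: mode_sign_def)

lemma mode_sign_remove:
  assumes "y \<in># s"
  shows "mode_sign x (s - {#y#}) = (if fermionic y \<and> mode_index y < mode_index x then - mode_sign x s else mode_sign x s)"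
proof -
  obtain s' where "s = add_mset y s'" using multi_member_split[OF assms] by blast
  then show ?thesis using mode_sign_add[of x y s'] by simp
qed

lemma mode_sign_square: "mode_sign x s * mode_sign x s = 1"
  by (simp add: mode_sign_def minus_one_mult_self)

lemma cr_single: "cr x (Poly_Mapping.single s c) = (if fermionic x
     then if even (count s x) then Poly_Mapping.single (add_mset x s) (c * mode_sign x s) else 0
     else Poly_Mapping.single (add_mset x s) c)"
  by (simp add: cr_def cscale_single)

lemma an_single: "an x (Poly_Mapping.single s c) = (if fermionic x
     then if odd (count s x) then Poly_Mapping.single (s - {#x#}) (c * mode_sign x s) else 0
     else Poly_Mapping.single (s - {#x#}) (c * of_nat (count s x)))"
  by (simp add: an_def cscale_single)

lemma odd_count_in: "odd (count s x) \<Longrightarrow> x \<in># s"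
  by (metis count_inI even_zero)

text \<open>Of two distinct anticommuting modes exactly one precedes the other, so exactly one of
  the two orders picks up an additional sign; every mixed or commuting pair commutes.\<close>

lemma cr_cr: "cr x (cr y m) = cscale (swap_sign x y) (cr y (cr x m))"
proof (rule clinear_eqI[of "\<lambda>m. cr x (cr y m)" "\<lambda>m. cscale (swap_sign x y) (cr y (cr x m))"])
  fix s
  show "cr x (cr y (Poly_Mapping.single s 1)) = cscale (swap_sign x y) (cr y (cr x (Poly_Mapping.single s 1)))"
  proof (cases "x = y")
    case False
    then have "fermionic x \<Longrightarrow> fermionic y \<Longrightarrow> (mode_index x < mode_index y) = (\<not> mode_index y < mode_index x)"
      using mode_index_inj by (metis linorder_neqE_nat not_less_iff_gr_or_eq)
    then show ?thesis using False
      by (auto simp: cr_single swap_sign_def mode_sign_add cscale_single add_mset_commute single_uminus mult.commute clinear_0[OF clinear_cr])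
  qed (auto simp: cr_single swap_sign_def cscale_single clinear_0[OF clinear_cr])
qed (rule clinear_scaled clinear_compose[OF clinear_cr clinear_cr])+

lemma an_single_absent: "x \<notin># s \<Longrightarrow> an x (Poly_Mapping.single s c) = 0"
proof -
  assume "x \<notin># s"
  then have c: "count s x = 0" by (rule count_eq_zero_iff[THEN iffD2])
  show ?thesis unfolding an_single c by simp
qed

lemma an_an: "an x (an y m) = cscale (swap_sign x y) (an y (an x m))"
proof (rule clinear_eqI[of "\<lambda>m. an x (an y m)" "\<lambda>m. cscale (swap_sign x y) (an y (an x m))"])
  fix s
  show "an x (an y (Poly_Mapping.single s 1)) = cscale (swap_sign x y) (an y (an x (Poly_Mapping.single s 1)))"
  proof (cases "x = y")
    case False
    show ?thesis
    proof (cases "x \<in># s \<and> y \<in># s")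
      case True
      obtain v where v: "s = add_mset x v" using multi_member_split[of x s] True by auto
      have "y \<in># v" using True v False by simp
      from multi_member_split[OF this] obtain u where u: "v = add_mset y u" by blast
      have d: "s - {#x#} = add_mset y u" "s - {#y#} = add_mset x u" "add_mset y u - {#y#} = u" "add_mset x u - {#x#} = u"
        using False by (simp_all add: v u)
      have mode_sign_s: "mode_sign z s = mode_sign z (add_mset x (add_mset y u))" for z by (simp add: v u)
      have c: "count s x = Suc (count u x)" "count s y = Suc (count u y)" using False by (simp_all add: v u)
      have "mode_index x < mode_index y \<longleftrightarrow> \<not> mode_index y < mode_index x" if "fermionic x" "fermionic y"
        using mode_index_inj[OF that] False by (metis linorder_neqE_nat not_less_iff_gr_or_eq)
      then show ?thesis using False
        by (cases "fermionic x"; cases "fermionic y")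
          (simp_all add: an_single d c mode_sign_s swap_sign_def mode_sign_add cscale_single clinear_0[OF clinear_an]
            mult.commute single_uminus)
    next
      case absent: False
      have twice: "an w (an z (Poly_Mapping.single s 1)) = 0" if "w \<notin># s \<or> z \<notin># s" for w z
      proof (cases "z \<in># s")
        case True
        then have "w \<notin># s - {#z#}" using that in_diffD[of w s "{#z#}"] by blast
        then show ?thesis by (simp add: an_single[of z s] an_single_absent clinear_0[OF clinear_an])
      qed (simp add: an_single_absent clinear_0[OF clinear_an])
      have "an x (an y (Poly_Mapping.single s 1)) = 0" "an y (an x (Poly_Mapping.single s 1)) = 0"
        using absent by (auto intro: twice)
      then show ?thesis by simp
    qed
  qed (auto simp: an_single swap_sign_def cscale_single clinear_0[OF clinear_an])
qed (rule clinear_scaled clinear_compose[OF clinear_an clinear_an])+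

lemma an_cr: "an x (cr y m) = cscale (swap_sign x y) (cr y (an x m)) + (if x = y then m else 0)"
proof (rule clinear_eqI[of "\<lambda>m. an x (cr y m)" "\<lambda>m. cscale (swap_sign x y) (cr y (an x m)) + (if x = y then m else 0)"])
  fix s
  show "an x (cr y (Poly_Mapping.single s 1)) =
      cscale (swap_sign x y) (cr y (an x (Poly_Mapping.single s 1))) + (if x = y then Poly_Mapping.single s 1 else 0)"
  proof (cases "x = y")
    case False
    show ?thesis
    proof (cases "x \<in># s")
      case True
      from multi_member_split[OF this] obtain u where u: "s = add_mset x u" by blast
      have d: "add_mset y s - {#x#} = add_mset y u" using False by (simp add: u)
      have "mode_index x < mode_index y \<longleftrightarrow> \<not> mode_index y < mode_index x" if "fermionic x" "fermionic y"
        using mode_index_inj[OF that] False by (metis linorder_neqE_nat not_less_iff_gr_or_eq)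
      then show ?thesis using False
        by (cases "fermionic x"; cases "fermionic y")
          (simp_all add: an_single cr_single d u swap_sign_def mode_sign_add cscale_single clinear_0[OF clinear_an] clinear_0[OF clinear_cr] mult_ac single_uminus)
    next
      case absent: False
      have "an x (cr y (Poly_Mapping.single s 1)) = 0" "an x (Poly_Mapping.single s 1) = 0"
        using absent False by (auto simp: an_single_absent clinear_0[OF clinear_an] cr_single)
      then show ?thesis using False by (simp add: clinear_0[OF clinear_cr])
    qed
  next
    case True
    show ?thesis
    proof (cases "fermionic x")
      case True
      then show ?thesis using \<open>x = y\<close>
        by (auto simp: an_single cr_single swap_sign_def mode_sign_add mode_sign_remove odd_count_in cscale_single
          single_uminus mult.commute clinear_0[OF clinear_an] clinear_0[OF clinear_cr] mode_sign_square)
    next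
      case False
      have "x \<in># s \<or> count s x = 0" by (auto simp: count_eq_zero_iff)
      then show ?thesis using \<open>x = y\<close> False
        by (auto simp: an_single cr_single swap_sign_def cscale_single add.commute simp flip: single_add)
    qed
  qed
next
  have "clinear (\<lambda>m::fock. if x = y then m else 0)" by (rule clinearI) auto
  then show "clinear (\<lambda>m. cscale (swap_sign x y) (cr y (an x m)) + (if x = y then m else 0))"
    by (intro clinear_plus clinear_scaled clinear_compose[OF clinear_cr clinear_an])
qed (rule clinear_compose[OF clinear_an clinear_cr])

text \<open>For gl(n) the second index runs over as many values as there are letters: the variables
  (i|k) then form a square matrix, which can be evaluated at the identity.\<close>

definition polar :: "nat \<Rightarrow> symb \<Rightarrow> symb \<Rightarrow> fock \<Rightarrow> fock" where
  "polar n a b m = (\<Sum>k\<in>{1..n}. cr (a, k) (an (b, k) m))"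

lemma clinear_polar: "clinear (polar n a b)"
  unfolding polar_def by (intro clinear_setsum clinear_compose[OF clinear_cr clinear_an])

definition alpha_sign :: "symb \<Rightarrow> symb \<Rightarrow> complex" where
  "alpha_sign a b = (if is_alpha a \<and> is_alpha b then -1 else 1)"

lemma swap_sign_eq: "swap_sign (a, k) (b, l) = alpha_sign a b"
  by (simp add: swap_sign_def alpha_sign_def fermionic_def)

lemma symb_parity_cases: "symb_parity a = (if is_alpha a then 0 else 1)"
  by (cases a) (simp_all add: is_alpha_def)

text \<open>Adding 1 to every symbol parity leaves |a|+|b| unchanged modulo 2. The bracket sign may
  thus be computed with the parity that is 1 on the alphas only, for which it factorizes over the
  four pairs of symbols.\<close>

lemma gl_sign: "(-1) ^ (gl_parity (a, b) * gl_parity (c, d)) =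
    alpha_sign b c * alpha_sign a c * alpha_sign b d * alpha_sign a d"
  by (auto simp: gl_parity_def symb_parity_cases alpha_sign_def)

lemma alpha_sign_square: "alpha_sign a b * alpha_sign a b = 1" "alpha_sign a b * (alpha_sign a b * z) = z"
  and alpha_sign_commute: "alpha_sign a b = alpha_sign b a"
  by (auto simp: alpha_sign_def)

text \<open>Both products are reduced to the normally ordered quadruple \<open>?X\<close>; what
  remains are the contractions of \<open>b\<close> with \<open>c\<close> and of \<open>d\<close>
  with \<open>a\<close>, the two terms of the superbracket.\<close>

lemma cr_an_quadruple:
  fixes a b c d :: symb
  defines "s \<equiv> (-1) ^ (gl_parity (a, b) * gl_parity (c, d)) :: complex"
  shows "cr (a, k) (an (b, k) (cr (c, l) (an (d, l) m))) =
     cscale s (cr (c, l) (an (d, l) (cr (a, k) (an (b, k) m)))) +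
     ((if k = l then if b = c then cr (a, k) (an (d, k) m) else 0 else 0) -
      (if k = l then cscale s (if a = d then cr (c, k) (an (b, k) m) else 0) else 0))"
proof -
  let ?X = "cr (c, l) (cr (a, k) (an (d, l) (an (b, k) m)))"
  note lin = clinear_add[OF clinear_cr] clinear_cscale[OF clinear_cr] clinear_0[OF clinear_cr]
  have 1: "cr (a, k) (an (b, k) (cr (c, l) (an (d, l) m))) =
      cscale (alpha_sign b c * alpha_sign a c * alpha_sign b d) ?X +
      (if k = l then if b = c then cr (a, k) (an (d, k) m) else 0 else 0)"
    by (subst an_cr, subst an_an, simp only: lin clinear_cscale[OF clinear_cr] swap_sign_eq, subst cr_cr)
       (auto simp: lin swap_sign_eq mult_ac)
  have 2: "cr (c, l) (an (d, l) (cr (a, k) (an (b, k) m))) =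
      cscale (alpha_sign a d) ?X + (if k = l then if a = d then cr (c, k) (an (b, k) m) else 0 else 0)"
    by (subst an_cr) (auto simp: lin swap_sign_eq alpha_sign_commute)
  have s: "s * alpha_sign a d = alpha_sign b c * alpha_sign a c * alpha_sign b d"
    unfolding s_def gl_sign by (simp add: mult.assoc alpha_sign_square)
  show ?thesis unfolding 1 2 cvs.scale_right_distrib cvs.scale_scale s by auto
qed

lemma polar_bracket:
  fixes a b c d :: symb
  defines "s \<equiv> (-1) ^ (gl_parity (a, b) * gl_parity (c, d)) :: complex"
  shows "polar n a b (polar n c d m) = cscale s (polar n c d (polar n a b m)) +
     ((if b = c then polar n a d m else 0) - cscale s (if a = d then polar n c b m else 0))"
proof -
  have "polar n a b (polar n c d m) = (\<Sum>k\<in>{1..n}. \<Sum>l\<in>{1..n}. cr (a, k) (an (b, k) (cr (c, l) (an (d, l) m))))"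
    by (simp add: polar_def clinear_sum[OF clinear_an] clinear_sum[OF clinear_cr])
  also have "\<dots> = (\<Sum>k\<in>{1..n}. \<Sum>l\<in>{1..n}. cscale s (cr (c, l) (an (d, l) (cr (a, k) (an (b, k) m)))))
     + ((\<Sum>k\<in>{1..n}. \<Sum>l\<in>{1..n}. if k = l then if b = c then cr (a, k) (an (d, k) m) else 0 else 0)
     - (\<Sum>k\<in>{1..n}. \<Sum>l\<in>{1..n}. if k = l then cscale s (if a = d then cr (c, k) (an (b, k) m) else 0) else 0))"
    unfolding cr_an_quadruple[where a = a and b = b and c = c and d = d, folded s_def] sum.distrib sum_subtractf by simp
  also have "(\<Sum>k\<in>{1..n}. \<Sum>l\<in>{1..n}. cscale s (cr (c, l) (an (d, l) (cr (a, k) (an (b, k) m))))) =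
      cscale s (polar n c d (polar n a b m))"
    by (subst sum.swap)
       (simp add: polar_def clinear_sum[OF clinear_an] clinear_sum[OF clinear_cr] cvs.scale_sum_right)
  also have "(\<Sum>k\<in>{1..n}. \<Sum>l\<in>{1..n}. if k = l then if b = c then cr (a, k) (an (d, k) m) else 0 else 0) =
      (if b = c then polar n a d m else 0)"
    by (simp add: polar_def)
  also have "(\<Sum>k\<in>{1..n}. \<Sum>l\<in>{1..n}. if k = l then cscale s (if a = d then cr (c, k) (an (b, k) m) else 0) else 0) =
      cscale s (if a = d then polar n c b m else 0)"
    by (simp add: polar_def cvs.scale_sum_right)
  finally show ?thesis .
qed

section \<open>Normally ordered operators\<close>

definition crs :: "nat \<Rightarrow> (nat \<Rightarrow> mode) \<Rightarrow> fock \<Rightarrow> fock" where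
  "crs h x m = foldr (\<lambda>q. cr (x q)) [0..<h] m"

definition ans :: "nat \<Rightarrow> (nat \<Rightarrow> mode) \<Rightarrow> fock \<Rightarrow> fock" where
  "ans h x m = foldr (\<lambda>q. an (x q)) [0..<h] m"

definition normal_op :: "nat \<Rightarrow> nat \<Rightarrow> (nat \<Rightarrow> symb) \<Rightarrow> (nat \<Rightarrow> symb) \<Rightarrow> fock \<Rightarrow> fock" where
  "normal_op n h a b m = (\<Sum>k\<in>PiE {..<h} (\<lambda>_. {1..n}). crs h (\<lambda>q. (a q, k q)) (ans h (\<lambda>q. (b q, k q)) m))"

definition act_word :: "nat \<Rightarrow> (symb \<times> symb) list \<Rightarrow> fock \<Rightarrow> fock" where
  "act_word n xs m = foldr (\<lambda>(a, b). polar n a b) xs m"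

lemma act_word_append: "act_word n (xs @ ys) m = act_word n xs (act_word n ys m)"
  by (simp add: act_word_def)

lemma act_word_Nil [simp]: "act_word n [] m = m"
  and act_word_Cons: "act_word n (x # xs) m = polar n (fst x) (snd x) (act_word n xs m)"
  by (simp_all add: act_word_def case_prod_beta)

lemma clinear_act_word: "clinear (act_word n xs)"
proof (induction xs)
  case Nil
  show ?case by (rule clinearI) simp_all
next
  case (Cons x xs)
  have "act_word n (x # xs) = (\<lambda>m. polar n (fst x) (snd x) (act_word n xs m))"
    by (rule ext) (rule act_word_Cons)
  then show ?case using clinear_compose[OF clinear_polar Cons] by simp
qed

lemma crs_Suc: "crs (Suc h) x m = crs h x (cr (x h) m)"
  and ans_Suc: "ans (Suc h) x m = ans h x (an (x h) m)"
  and crs_0 [simp]: "crs 0 x m = m" and ans_0 [simp]: "ans 0 x m = m"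
  by (simp_all add: crs_def ans_def)

lemma crs_cong: "(\<And>q. q < h \<Longrightarrow> x q = y q) \<Longrightarrow> crs h x m = crs h y m"
  and ans_cong: "(\<And>q. q < h \<Longrightarrow> x q = y q) \<Longrightarrow> ans h x m = ans h y m"
  unfolding crs_def ans_def by (auto intro!: foldr_cong)

lemma clinear_crs: "clinear (crs h x)"
proof (induction h)
  case 0
  show ?case by (rule clinearI) simp_all
next
  case (Suc h)
  show ?case by (rule clinearI)
    (simp_all add: crs_Suc clinear_add[OF clinear_cr] clinear_cscale[OF clinear_cr] clinear_add[OF Suc] clinear_cscale[OF Suc])
qed

lemma clinear_ans: "clinear (ans h x)"
proof (induction h)
  case 0
  show ?case by (rule clinearI) simp_all
next
  case (Suc h)
  show ?case by (rule clinearI)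
    (simp_all add: ans_Suc clinear_add[OF clinear_an] clinear_cscale[OF clinear_an] clinear_add[OF Suc] clinear_cscale[OF Suc])
qed

lemma normal_op_cong:
  "(\<And>q. q < h \<Longrightarrow> a q = a' q) \<Longrightarrow> (\<And>q. q < h \<Longrightarrow> b q = b' q) \<Longrightarrow> normal_op n h a b m = normal_op n h a' b' m"
  unfolding normal_op_def by (intro sum.cong refl) (metis (no_types, lifting) crs_cong ans_cong)

lemma sum_PiE_Suc:
  "(\<Sum>k\<in>PiE {..<Suc h} (\<lambda>_. K). f k) = (\<Sum>k\<in>PiE {..<h} (\<lambda>_. K). \<Sum>l\<in>K. f (k(h := l)))"
proof -
  have "(\<Sum>k\<in>PiE {..<Suc h} (\<lambda>_. K). f k) = (\<Sum>(l, k)\<in>K \<times> PiE {..<h} (\<lambda>_. K). f (k(h := l)))"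
    unfolding lessThan_Suc PiE_insert_eq
    using inj_combinator[of h "{..<h}" "\<lambda>_. K"] by (subst sum.reindex) (auto simp: case_prod_beta)
  also have "\<dots> = (\<Sum>l\<in>K. \<Sum>k\<in>PiE {..<h} (\<lambda>_. K). f (k(h := l)))" by (simp add: sum.cartesian_product)
  finally show ?thesis by (simp only: sum.swap[of _ K])
qed

lemma ans_cr_commute:
  assumes "\<And>q. q < h \<Longrightarrow> x q \<noteq> y \<and> \<not> (fermionic (x q) \<and> fermionic y)"
  shows "ans h x (cr y m) = cr y (ans h x m)"
  using assms
proof (induction h arbitrary: m)
  case (Suc h)
  have "an (x h) (cr y m) = cr y (an (x h) m)"
    using Suc.prems[of h] by (auto simp: an_cr swap_sign_def)
  then show ?case using Suc by (simp add: ans_Suc)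
qed simp

lemma an_ans_zero:
  assumes "\<And>q. q < h \<Longrightarrow> \<not> fermionic (x q)" "an y m = 0"
  shows "an y (ans h x m) = 0"
  using assms
proof (induction h arbitrary: m)
  case (Suc h)
  have "an y (an (x h) m) = 0"
    using Suc.prems by (simp add: an_an[of y] clinear_0[OF clinear_an])
  then show ?case using Suc by (simp add: ans_Suc)
qed simp

text \<open>No lower index can be contracted with an upper one, so every creation operator passes
  the annihilators to its left without remainder and without sign.\<close>

lemma act_word_normal:
  assumes "\<And>p q. p < h \<Longrightarrow> q < h \<Longrightarrow> a p \<noteq> b q \<and> \<not> (is_alpha (a p) \<and> is_alpha (b q))"
  shows "act_word n (map (\<lambda>q. (a q, b q)) [0..<h]) m = normal_op n h a b m"
  using assms
proof (induction h arbitrary: m)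
  case 0
  then show ?case by (simp add: normal_op_def)
next
  case (Suc h)
  have "act_word n (map (\<lambda>q. (a q, b q)) [0..<Suc h]) m = normal_op n h a b (polar n (a h) (b h) m)"
    using Suc by (simp add: act_word_append act_word_Cons)
  also have "\<dots> = (\<Sum>k\<in>PiE {..<h} (\<lambda>_. {1..n}). \<Sum>l\<in>{1..n}.
      crs h (\<lambda>q. (a q, k q)) (ans h (\<lambda>q. (b q, k q)) (cr (a h, l) (an (b h, l) m))))"
    by (simp add: normal_op_def polar_def clinear_sum[OF clinear_crs] clinear_sum[OF clinear_ans])
  also have "\<dots> = (\<Sum>k\<in>PiE {..<h} (\<lambda>_. {1..n}). \<Sum>l\<in>{1..n}.
      crs (Suc h) (\<lambda>q. (a q, (k(h := l)) q)) (ans (Suc h) (\<lambda>q. (b q, (k(h := l)) q)) m))"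
  proof (intro sum.cong refl)
    fix k l
    have "ans h (\<lambda>q. (b q, k q)) (cr (a h, l) (an (b h, l) m)) = cr (a h, l) (ans h (\<lambda>q. (b q, k q)) (an (b h, l) m))"
    proof (rule ans_cr_commute)
      fix q assume "q < h"
      then show "(b q, k q) \<noteq> (a h, l) \<and> \<not> (fermionic (b q, k q) \<and> fermionic (a h, l))"
        using Suc.prems[of h q] by (auto simp: fermionic_def)
    qed
    moreover have "ans h (\<lambda>q. (b q, (k(h := l)) q)) m' = ans h (\<lambda>q. (b q, k q)) m'" for m'
      by (rule ans_cong) simp
    moreover have "crs h (\<lambda>q. (a q, (k(h := l)) q)) m' = crs h (\<lambda>q. (a q, k q)) m'" for m'
      by (rule crs_cong) simp
    ultimately show "crs h (\<lambda>q. (a q, k q)) (ans h (\<lambda>q. (b q, k q)) (cr (a h, l) (an (b h, l) m))) =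
        crs (Suc h) (\<lambda>q. (a q, (k(h := l)) q)) (ans (Suc h) (\<lambda>q. (b q, (k(h := l)) q)) m)"
      by (simp add: crs_Suc ans_Suc)
  qed
  also have "\<dots> = normal_op n (Suc h) a b m"
    by (simp only: normal_op_def sum_PiE_Suc)
  finally show ?case .
qed

section \<open>Wick's rule for modes of one kind\<close>

definition exchange :: "bool \<Rightarrow> complex" where
  "exchange b = (if b then -1 else 1)"

lemma foldr_cr_move:
  assumes "\<And>z. z \<in> set zs \<Longrightarrow> fermionic z = b" "fermionic y = b"
  shows "foldr cr zs (cr y m) = cscale (exchange b ^ length zs) (cr y (foldr cr zs m))"
  using assms
proof (induction zs)
  case (Cons z zs)
  have "cr z (cr y (foldr cr zs m)) = cscale (exchange b) (cr y (cr z (foldr cr zs m)))"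
    using Cons.prems cr_cr[of z y] by (simp add: swap_sign_def exchange_def)
  then show ?case using Cons by (simp add: clinear_cscale[OF clinear_cr] mult.commute)
qed simp

text \<open>Signed Leibniz rule; the last term is the annihilator that has passed all
  creators.\<close>

lemma an_foldr_cr:
  assumes "\<And>y. y \<in> set ys \<Longrightarrow> fermionic y = b" "fermionic x = b"
  shows "an x (foldr cr ys m) =
    (\<Sum>p<length ys. if x = ys ! p then cscale (exchange b ^ p) (foldr cr (take p ys @ drop (Suc p) ys) m) else 0)
    + cscale (exchange b ^ length ys) (foldr cr ys (an x m))"
  using assms
proof (induction ys)
  case (Cons y ys)
  let ?S = "\<Sum>p<length ys. if x = ys ! p then cscale (exchange b ^ p) (foldr cr (take p ys @ drop (Suc p) ys) m) else 0"
  have "an x (foldr cr (y # ys) m) = cscale (exchange b) (cr y (an x (foldr cr ys m))) + (if x = y then foldr cr ys m else 0)"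
    using Cons.prems by (simp add: an_cr swap_sign_def exchange_def)
  also have "an x (foldr cr ys m) = ?S + cscale (exchange b ^ length ys) (foldr cr ys (an x m))"
    using Cons by simp
  also have "cscale (exchange b) (cr y (?S + cscale (exchange b ^ length ys) (foldr cr ys (an x m)))) =
     (\<Sum>p<length ys. if x = ys ! p then cscale (exchange b ^ Suc p) (cr y (foldr cr (take p ys @ drop (Suc p) ys) m)) else 0)
     + cscale (exchange b ^ length (y # ys)) (foldr cr (y # ys) (an x m))"
  proof -
    have "cscale (exchange b) (cr y ?S) =
      (\<Sum>p<length ys. if x = ys ! p then cscale (exchange b ^ Suc p) (cr y (foldr cr (take p ys @ drop (Suc p) ys) m)) else 0)"
      unfolding clinear_sum[OF clinear_cr] cvs.scale_sum_right
      by (intro sum.cong refl) (simp add: clinear_cscale[OF clinear_cr] clinear_0[OF clinear_cr])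
    then show ?thesis
      by (simp add: clinear_add[OF clinear_cr] clinear_cscale[OF clinear_cr] cvs.scale_right_distrib)
  qed
  finally show ?case
    unfolding length_Cons sum.lessThan_Suc_shift take_Suc_Cons drop_Suc_Cons append_Cons foldr.simps comp_apply
    by (simp add: add_ac)
qed simp

text \<open>The gap left by the contracted factor \<open>y p\<close> is filled by the last factor
  \<open>y h\<close>. Contracting costs \<open>exchange b ^ p\<close>, moving \<open>y h\<close>
  into the gap \<open>exchange b ^ (h - 1 - p)\<close>; together this is
  \<open>exchange b ^ h\<close> times the character of the transposition.\<close>

lemma an_crs:
  assumes "\<And>q. q < Suc h \<Longrightarrow> fermionic (y q) = b" "fermionic x = b" "an x m = 0"
  shows "an x (crs (Suc h) y m) =
    (\<Sum>p\<in>{..<Suc h}. if x = y p then cscale (exchange b ^ h * char1 b (Transposition.transpose h p))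
       (crs h (y \<circ> Transposition.transpose h p) m) else 0)"
proof -
  let ?L = "map y [0..<h]"
  have crs_list: "crs h y m' = foldr cr (map y [0..<h]) m'" for y m' by (simp add: crs_def foldr_map comp_def)
  have ferm: "fermionic z = b" if "z \<in> set ?L" for z using that assms(1) by auto
  have yh: "fermionic (y h) = b" using assms(1) by simp
  have "an x (crs (Suc h) y m) = an x (foldr cr ?L (cr (y h) m))"
    by (simp add: crs_Suc crs_list)
  also have "\<dots> = (\<Sum>p<h. if x = y p then cscale (exchange b ^ p) (foldr cr (take p ?L @ drop (Suc p) ?L) (cr (y h) m)) else 0)
      + cscale (exchange b ^ h) (foldr cr ?L (an x (cr (y h) m)))"
    using an_foldr_cr[of ?L b x "cr (y h) m", OF ferm assms(2)] by simp
  also have "an x (cr (y h) m) = (if x = y h then m else 0)"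
    by (simp add: an_cr assms(3) clinear_0[OF clinear_cr])
  also have "cscale (exchange b ^ h) (foldr cr ?L (if x = y h then m else 0)) =
      (if x = y h then cscale (exchange b ^ h * char1 b (Transposition.transpose h h)) (crs h (y \<circ> Transposition.transpose h h) m) else 0)"
    using clinear_0[OF clinear_crs, of h y] by (simp add: crs_list char1_id[unfolded id_def])
  also have "(\<Sum>p<h. if x = y p then cscale (exchange b ^ p) (foldr cr (take p ?L @ drop (Suc p) ?L) (cr (y h) m)) else 0) =
      (\<Sum>p<h. if x = y p then cscale (exchange b ^ h * char1 b (Transposition.transpose h p)) (crs h (y \<circ> Transposition.transpose h p) m) else 0)"
  proof (rule sum.cong[OF refl])
    fix p assume "p \<in> {..<h}"
    then have p: "p < h" by simp
    have upd: "take p ?L @ y h # drop (Suc p) ?L = map (y \<circ> Transposition.transpose h p) [0..<h]"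
    proof -
      have "take p ?L @ y h # drop (Suc p) ?L = ?L[p := y h]"
        using p by (simp add: upd_conv_take_nth_drop)
      also have "\<dots> = map (y \<circ> Transposition.transpose h p) [0..<h]"
        by (rule nth_equalityI) (auto simp: nth_list_update Transposition.transpose_def p)
      finally show ?thesis .
    qed
    have dl: "length (drop (Suc p) ?L) = h - Suc p" by simp
    have "foldr cr (take p ?L @ drop (Suc p) ?L) (cr (y h) m) =
        foldr cr (take p ?L) (cscale (exchange b ^ (h - Suc p)) (cr (y h) (foldr cr (drop (Suc p) ?L) m)))"
    proof -
      have "foldr cr (drop (Suc p) ?L) (cr (y h) m) =
          cscale (exchange b ^ length (drop (Suc p) ?L)) (cr (y h) (foldr cr (drop (Suc p) ?L) m))"
      proof (rule foldr_cr_move[OF _ yh])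
        fix z assume "z \<in> set (drop (Suc p) ?L)"
        then show "fermionic z = b" by (intro ferm) (rule in_set_dropD)
      qed
      then show ?thesis unfolding dl by simp
    qed
    also have "\<dots> = cscale (exchange b ^ (h - Suc p)) (foldr cr (take p ?L @ y h # drop (Suc p) ?L) m)"
    proof -
      have "clinear (foldr cr zs)" for zs
        by (induction zs) (auto intro: clinear_ident clinear_compose[OF clinear_cr] simp: comp_def id_def)
      from clinear_cscale[OF this] show ?thesis by simp
    qed
    finally have "cscale (exchange b ^ p) (foldr cr (take p ?L @ drop (Suc p) ?L) (cr (y h) m)) =
        cscale (exchange b ^ (p + (h - Suc p))) (crs h (y \<circ> Transposition.transpose h p) m)"
      unfolding upd crs_list by (simp add: power_add)
    moreover have "exchange b ^ (p + (h - Suc p)) = exchange b ^ h * char1 b (Transposition.transpose h p)"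
    proof -
      obtain j where j: "h = p + Suc j" using p less_iff_Suc_add by auto
      then show ?thesis using p char1_transpose[of h p b] by (simp add: exchange_def power_add)
    qed
    ultimately show "(if x = y p then cscale (exchange b ^ p) (foldr cr (take p ?L @ drop (Suc p) ?L) (cr (y h) m)) else 0) =
        (if x = y p then cscale (exchange b ^ h * char1 b (Transposition.transpose h p)) (crs h (y \<circ> Transposition.transpose h p) m) else 0)"
      by simp
  qed
  finally show ?thesis by (simp add: add.commute)
qed

text \<open>For anticommuting modes this is (-1)^(h(h-1)/2), the sign of reversing \<open>h\<close>
  factors: \<open>ans\<close> and \<open>crs\<close> list their modes in the same order, while
  nested contractions pair reversed orders.\<close>

definition wick_sign :: "bool \<Rightarrow> nat \<Rightarrow> complex" where
  "wick_sign b h = (\<Prod>k<h. exchange b ^ k)"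

text \<open>Every permutation of \<open>{..<Suc h}\<close> is uniquely
  \<open>transpose h p \<circ> r\<close> with \<open>r\<close> fixing \<open>h\<close>:
  \<open>p\<close> is the partner of the annihilator applied first, and \<open>r\<close> pairs the
  others.\<close>

lemma wick:
  assumes "\<And>q. q < h \<Longrightarrow> fermionic (y q) = b" "\<And>q. q < h \<Longrightarrow> fermionic (x q) = b"
    and "\<And>q. q < h \<Longrightarrow> an (x q) m = 0"
  shows "ans h x (crs h y m) = (\<Sum>p\<in>{p. p permutes {..<h}}.
     if \<forall>q<h. x q = y (p q) then cscale (wick_sign b h * char1 b p) m else 0)"
  using assms
proof (induction h arbitrary: y)
  case 0
  then show ?case by (simp add: wick_sign_def char1_id[unfolded id_def])
next
  case (Suc h)
  let ?t = "Transposition.transpose h"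
  let ?F = "\<lambda>p. if \<forall>q<Suc h. x q = y (p q) then cscale (wick_sign b (Suc h) * char1 b p) m else 0"
  have tr: "?t p permutes {..<Suc h}" if "p \<in> {..<Suc h}" for p
    using that by (intro permutes_swap_id) auto
  have "ans (Suc h) x (crs (Suc h) y m) = ans h x (an (x h) (crs (Suc h) y m))" by (rule ans_Suc)
  also have "an (x h) (crs (Suc h) y m) = (\<Sum>p\<in>{..<Suc h}. if x h = y p then cscale (exchange b ^ h * char1 b (?t p))
       (crs h (y \<circ> ?t p) m) else 0)"
    using Suc.prems by (intro an_crs) auto
  also have "ans h x \<dots> = (\<Sum>p\<in>{..<Suc h}. if x h = y p then cscale (exchange b ^ h * char1 b (?t p))
       (ans h x (crs h (y \<circ> ?t p) m)) else 0)"
    unfolding clinear_sum[OF clinear_ans]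
    by (intro sum.cong refl) (simp add: clinear_cscale[OF clinear_ans] clinear_0[OF clinear_ans])
  also have "\<dots> = (\<Sum>p\<in>{..<Suc h}. \<Sum>r\<in>{r. r permutes {..<h}}. ?F (?t p \<circ> r))"
  proof (rule sum.cong[OF refl])
    fix p assume p: "p \<in> {..<Suc h}"
    have "fermionic ((y \<circ> ?t p) q) = b" if "q < h" for q
    proof -
      have "?t p q < Suc h" using permutes_in_image[OF tr[OF p], of q] that by simp
      then show ?thesis using Suc.prems(1) by simp
    qed
    then have IH: "ans h x (crs h (y \<circ> ?t p) m) = (\<Sum>r\<in>{r. r permutes {..<h}}.
        if \<forall>q<h. x q = (y \<circ> ?t p) (r q) then cscale (wick_sign b h * char1 b r) m else 0)"
      using Suc.prems by (intro Suc.IH) auto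
    have "?F (?t p \<circ> r) = (if x h = y p then cscale (exchange b ^ h * char1 b (?t p))
        (if \<forall>q<h. x q = (y \<circ> ?t p) (r q) then cscale (wick_sign b h * char1 b r) m else 0) else 0)"
      if r: "r permutes {..<h}" for r
    proof -
      have rh: "r h = h" using permutes_not_in[OF r, of h] by simp
      have r': "r permutes {..<Suc h}" using r by (rule permutes_subset) auto
      have c: "char1 b (?t p \<circ> r) = char1 b (?t p) * char1 b r"
        by (rule char1_compose[OF _ tr[OF p] r']) simp
      have eq: "(\<forall>q<Suc h. x q = y ((?t p \<circ> r) q)) \<longleftrightarrow> x h = y p \<and> (\<forall>q<h. x q = (y \<circ> ?t p) (r q))"
        by (auto simp: less_Suc_eq rh)
      show ?thesis unfolding eq c by (auto simp: wick_sign_def mult_ac)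
    qed
    then show "(if x h = y p then cscale (exchange b ^ h * char1 b (?t p)) (ans h x (crs h (y \<circ> ?t p) m)) else 0) =
        (\<Sum>r\<in>{r. r permutes {..<h}}. ?F (?t p \<circ> r))"
      unfolding IH by (simp add: cvs.scale_sum_right)
  qed
  also have "\<dots> = (\<Sum>p\<in>{p. p permutes {..<Suc h}}. ?F p)"
    unfolding lessThan_Suc by (rule sum_over_permutations_insert[symmetric]) auto
  finally show ?case .
qed

section \<open>Symmetry of normally ordered operators in their pairs of letters\<close>

lemma ans_permute:
  assumes "\<And>q. q < h \<Longrightarrow> \<not> fermionic (x q)" "p permutes {..<h}"
  shows "ans h (x \<circ> p) m = ans h x m"
proof -
  have ans: "ans h x m = List.fold an (rev (map x [0..<h])) m" for x
    by (simp add: ans_def foldr_conv_fold rev_map fold_map comp_def)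
  have "List.fold an (rev (map (x \<circ> p) [0..<h])) = List.fold an (rev (map x [0..<h]))"
  proof (rule fold_multiset_equiv)
    have "image_mset p (mset_set {..<h}) = mset_set {..<h}" by (rule permutes_image_mset[OF assms(2)])
    then have "image_mset x (image_mset p (mset_set {..<h})) = image_mset x (mset_set {..<h})" by simp
    then show "mset (rev (map (x \<circ> p) [0..<h])) = mset (rev (map x [0..<h]))"
      by (simp add: atLeast0LessThan multiset.map_comp)
    fix u v assume "u \<in> set (rev (map (x \<circ> p) [0..<h]))" "v \<in> set (rev (map (x \<circ> p) [0..<h]))"
    moreover have "p q < h" if "q < h" for q using permutes_in_image[OF assms(2), of q] that by simp
    ultimately have "\<not> fermionic u" using assms(1) by auto
    then show "an u \<circ> an v = an v \<circ> an u" by (simp add: fun_eq_iff an_an[of u v] swap_sign_def)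
  qed
  then show ?thesis by (simp add: ans)
qed

lemma crs_permute:
  assumes "\<And>q. q < h \<Longrightarrow> \<not> fermionic (x q)" "p permutes {..<h}"
  shows "crs h (x \<circ> p) m = crs h x m"
proof -
  have crs: "crs h x m = List.fold cr (rev (map x [0..<h])) m" for x
    by (simp add: crs_def foldr_conv_fold rev_map fold_map comp_def)
  have "List.fold cr (rev (map (x \<circ> p) [0..<h])) = List.fold cr (rev (map x [0..<h]))"
  proof (rule fold_multiset_equiv)
    have "image_mset p (mset_set {..<h}) = mset_set {..<h}" by (rule permutes_image_mset[OF assms(2)])
    then have "image_mset x (image_mset p (mset_set {..<h})) = image_mset x (mset_set {..<h})" by simp
    then show "mset (rev (map (x \<circ> p) [0..<h])) = mset (rev (map x [0..<h]))"
      by (simp add: atLeast0LessThan multiset.map_comp)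
    fix u v assume "u \<in> set (rev (map (x \<circ> p) [0..<h]))" "v \<in> set (rev (map (x \<circ> p) [0..<h]))"
    moreover have "p q < h" if "q < h" for q using permutes_in_image[OF assms(2), of q] that by simp
    ultimately have "\<not> fermionic u" using assms(1) by auto
    then show "cr u \<circ> cr v = cr v \<circ> cr u" by (simp add: fun_eq_iff cr_cr[of u v] swap_sign_def)
  qed
  then show ?thesis by (simp add: crs)
qed

lemma sum_PiE_permute:
  assumes "p permutes D"
  shows "(\<Sum>k\<in>PiE D (\<lambda>_. K). f (k \<circ> p)) = (\<Sum>k\<in>PiE D (\<lambda>_. K). f k)"
proof (rule sum.reindex_bij_witness[of _ "\<lambda>k. k \<circ> finv p" "\<lambda>k. k \<circ> p"])
  fix k assume k: "k \<in> PiE D (\<lambda>_. K)"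
  show "k \<circ> p \<circ> finv p = k" by (simp only: comp_assoc permutes_inv_o(1)[OF assms] comp_id)
  show "k \<circ> finv p \<circ> p = k" by (simp only: comp_assoc permutes_inv_o(2)[OF assms] comp_id)
  show "k \<circ> p \<in> PiE D (\<lambda>_. K)" by (rule compose_PiE[OF assms k])
  show "k \<circ> finv p \<in> PiE D (\<lambda>_. K)" by (rule compose_PiE[OF permutes_inv[OF assms] k])
qed simp

lemma normal_op_permute:
  assumes "\<And>q. q < h \<Longrightarrow> \<not> is_alpha (a q) \<and> \<not> is_alpha (b q)" and p: "p permutes {..<h}"
  shows "normal_op n h (a \<circ> p) (b \<circ> p) m = normal_op n h a b m"
proof -
  have "normal_op n h (a \<circ> p) (b \<circ> p) m = (\<Sum>k\<in>PiE {..<h} (\<lambda>_. {1..n}).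
      crs h (\<lambda>q. ((a \<circ> p) q, (k \<circ> p) q)) (ans h (\<lambda>q. ((b \<circ> p) q, (k \<circ> p) q)) m))"
    unfolding normal_op_def by (rule sum_PiE_permute[OF p, symmetric])
  also have "\<dots> = normal_op n h a b m"
    unfolding normal_op_def
  proof (rule sum.cong[OF refl])
    fix k
    have "crs h ((\<lambda>q. (a q, k q)) \<circ> p) m' = crs h (\<lambda>q. (a q, k q)) m'" for m'
      using assms(1) by (intro crs_permute p) (simp add: fermionic_def)
    moreover have "ans h ((\<lambda>q. (b q, k q)) \<circ> p) m' = ans h (\<lambda>q. (b q, k q)) m'" for m'
      using assms(1) by (intro ans_permute p) (simp add: fermionic_def)
    ultimately show "crs h (\<lambda>q. ((a \<circ> p) q, (k \<circ> p) q)) (ans h (\<lambda>q. ((b \<circ> p) q, (k \<circ> p) q)) m) =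
        crs h (\<lambda>q. (a q, k q)) (ans h (\<lambda>q. (b q, k q)) m)"
      by (simp add: comp_def)
  qed
  finally show ?thesis .
qed

text \<open>A contraction equates symbols and copy numbers alike. The latter force
  \<open>l = k \<circ> p\<close>, so summing over the copies leaves a normally ordered operator
  whose lower letters are permuted by the pairing \<open>p\<close>.\<close>

lemma act_word_contract:
  assumes a: "\<And>q. q < h \<Longrightarrow> is_alpha (a q) = b" and a': "\<And>q. q < h \<Longrightarrow> is_alpha (a' q) = b"
    and s: "\<And>p q. p < h \<Longrightarrow> q < h \<Longrightarrow> s p \<noteq> a' q \<and> \<not> (is_alpha (s p) \<and> is_alpha (a' q))"
    and u: "\<And>q. q < h \<Longrightarrow> \<not> is_alpha (u q)"
    and m: "\<And>q k. q < h \<Longrightarrow> an (a' q, k) m = 0"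
  shows "act_word n (map (\<lambda>q. (s q, a' q)) [0..<h]) (normal_op n h a u m) =
    (\<Sum>p\<in>{p. p permutes {..<h}}. if \<forall>q<h. a' q = a (p q)
       then cscale (wick_sign b h * char1 b p) (normal_op n h s (u \<circ> p) m) else 0)"
proof -
  let ?K = "PiE {..<h} (\<lambda>_. {1..n})" and ?P = "{p. p permutes {..<h}}"
  let ?A = "\<lambda>k. ans h (\<lambda>q. (u q, k q)) m"
  have finK: "finite ?K" by (simp add: finite_PiE)
  have "act_word n (map (\<lambda>q. (s q, a' q)) [0..<h]) (normal_op n h a u m) =
      normal_op n h s a' (normal_op n h a u m)"
    using s by (rule act_word_normal)
  also have "\<dots> = (\<Sum>l\<in>?K. \<Sum>k\<in>?K. crs h (\<lambda>q. (s q, l q)) (ans h (\<lambda>q. (a' q, l q)) (crs h (\<lambda>q. (a q, k q)) (?A k))))"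
    by (simp add: normal_op_def clinear_sum[OF clinear_crs] clinear_sum[OF clinear_ans])
  also have "\<dots> = (\<Sum>l\<in>?K. \<Sum>k\<in>?K. \<Sum>p\<in>?P. if \<forall>q<h. a' q = a (p q) \<and> l q = k (p q)
        then cscale (wick_sign b h * char1 b p) (crs h (\<lambda>q. (s q, l q)) (?A k)) else 0)"
  proof (intro sum.cong refl)
    fix l k
    have "an (a' q, l q) (?A k) = 0" if "q < h" for q
      using u m[OF that] by (intro an_ans_zero) (auto simp: fermionic_def)
    then have "ans h (\<lambda>q. (a' q, l q)) (crs h (\<lambda>q. (a q, k q)) (?A k)) =
        (\<Sum>p\<in>?P. if \<forall>q<h. (a' q, l q) = (a (p q), k (p q)) then cscale (wick_sign b h * char1 b p) (?A k) else 0)"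
      using a a' by (intro wick) (auto simp: fermionic_def)
    then have "crs h (\<lambda>q. (s q, l q)) (ans h (\<lambda>q. (a' q, l q)) (crs h (\<lambda>q. (a q, k q)) (?A k))) =
        (\<Sum>p\<in>?P. crs h (\<lambda>q. (s q, l q)) (if \<forall>q<h. (a' q, l q) = (a (p q), k (p q)) then cscale (wick_sign b h * char1 b p) (?A k) else 0))"
      by (simp only: clinear_sum[OF clinear_crs])
    also have "\<dots> = (\<Sum>p\<in>?P. if \<forall>q<h. a' q = a (p q) \<and> l q = k (p q)
        then cscale (wick_sign b h * char1 b p) (crs h (\<lambda>q. (s q, l q)) (?A k)) else 0)"
      by (intro sum.cong refl) (auto simp: clinear_cscale[OF clinear_crs] clinear_0[OF clinear_crs])
    finally show "crs h (\<lambda>q. (s q, l q)) (ans h (\<lambda>q. (a' q, l q)) (crs h (\<lambda>q. (a q, k q)) (?A k))) =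
        (\<Sum>p\<in>?P. if \<forall>q<h. a' q = a (p q) \<and> l q = k (p q)
        then cscale (wick_sign b h * char1 b p) (crs h (\<lambda>q. (s q, l q)) (?A k)) else 0)" .
  qed
  also have "\<dots> = (\<Sum>p\<in>?P. \<Sum>k\<in>?K. \<Sum>l\<in>?K. if \<forall>q<h. a' q = a (p q) \<and> l q = k (p q)
        then cscale (wick_sign b h * char1 b p) (crs h (\<lambda>q. (s q, l q)) (?A k)) else 0)"
    by (subst sum.swap, subst (2) sum.swap, subst sum.swap) (rule refl)
  also have "\<dots> = (\<Sum>p\<in>?P. if \<forall>q<h. a' q = a (p q)
       then cscale (wick_sign b h * char1 b p) (normal_op n h s (u \<circ> p) m) else 0)"
  proof (rule sum.cong[OF refl])
    fix p assume "p \<in> ?P"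
    then have p: "p permutes {..<h}" by simp
    let ?c = "wick_sign b h * char1 b p"
    have inner: "(\<Sum>l\<in>?K. if \<forall>q<h. a' q = a (p q) \<and> l q = k (p q)
        then cscale ?c (crs h (\<lambda>q. (s q, l q)) (?A k)) else 0) =
        (if \<forall>q<h. a' q = a (p q) then cscale ?c (crs h (\<lambda>q. (s q, (k \<circ> p) q)) (?A k)) else 0)"
      if k: "k \<in> ?K" for k
    proof -
      have kp: "k \<circ> p \<in> ?K" by (rule compose_PiE[OF p k])
      have "(\<forall>q<h. a' q = a (p q) \<and> l q = k (p q)) \<longleftrightarrow> (\<forall>q<h. a' q = a (p q)) \<and> l = k \<circ> p" if "l \<in> ?K" for l
        using PiE_eq_iff_not_empty PiE_ext[OF that kp] by auto
      then have "(\<Sum>l\<in>?K. if \<forall>q<h. a' q = a (p q) \<and> l q = k (p q)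
        then cscale ?c (crs h (\<lambda>q. (s q, l q)) (?A k)) else 0) =
        (\<Sum>l\<in>?K. if l = k \<circ> p then if \<forall>q<h. a' q = a (p q) then cscale ?c (crs h (\<lambda>q. (s q, l q)) (?A k)) else 0 else 0)"
        by (intro sum.cong refl) auto
      also have "\<dots> = (if \<forall>q<h. a' q = a (p q) then cscale ?c (crs h (\<lambda>q. (s q, (k \<circ> p) q)) (?A k)) else 0)"
        using kp by (subst sum.delta[OF finK]) auto
      finally show ?thesis .
    qed
    have A: "?A k = ans h (\<lambda>q. ((u \<circ> p) q, (k \<circ> p) q)) m" for k
    proof -
      have "ans h ((\<lambda>q. (u q, k q)) \<circ> p) m = ?A k"
        using u by (intro ans_permute p) (simp add: fermionic_def)
      then show ?thesis by (simp add: comp_def)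
    qed
    have "(\<Sum>k\<in>?K. \<Sum>l\<in>?K. if \<forall>q<h. a' q = a (p q) \<and> l q = k (p q)
        then cscale ?c (crs h (\<lambda>q. (s q, l q)) (?A k)) else 0) =
        (\<Sum>k\<in>?K. if \<forall>q<h. a' q = a (p q) then cscale ?c (crs h (\<lambda>q. (s q, (k \<circ> p) q))
          (ans h (\<lambda>q. ((u \<circ> p) q, (k \<circ> p) q)) m)) else 0)"
      by (intro sum.cong refl) (simp only: inner, simp only: A)
    also have "\<dots> = (\<Sum>k\<in>?K. if \<forall>q<h. a' q = a (p q) then cscale ?c (crs h (\<lambda>q. (s q, k q))
          (ans h (\<lambda>q. ((u \<circ> p) q, k q)) m)) else 0)"
      by (rule sum_PiE_permute[OF p])
    also have "\<dots> = (if \<forall>q<h. a' q = a (p q) then cscale ?c (normal_op n h s (u \<circ> p) m) else 0)"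
    proof -
      have "(\<Sum>k\<in>?K. if P then f k else 0) = (if P then \<Sum>k\<in>?K. f k else 0)" for P and f :: "_ \<Rightarrow> fock"
        by (cases P) simp_all
      then show ?thesis unfolding normal_op_def cvs.scale_sum_right .
    qed
    finally show "(\<Sum>k\<in>?K. \<Sum>l\<in>?K. if \<forall>q<h. a' q = a (p q) \<and> l q = k (p q)
        then cscale ?c (crs h (\<lambda>q. (s q, l q)) (?A k)) else 0) =
        (if \<forall>q<h. a' q = a (p q) then cscale ?c (normal_op n h s (u \<circ> p) m) else 0)" .
  qed
  finally show ?thesis .
qed

text \<open>Letters may occur arbitrarily; it is the virtual symbols that are absent, so every
  virtual annihilator gives 0 here, as Wick's rule requires.\<close>

definition vacuum :: "fock set" where
  "vacuum = {m. \<forall>s\<in>Poly_Mapping.keys m. \<forall>x\<in>#s. \<exists>l. fst x = Letter l}"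

lemma vacuumD: "m \<in> vacuum \<Longrightarrow> s \<in> Poly_Mapping.keys m \<Longrightarrow> x \<in># s \<Longrightarrow> \<exists>l. fst x = Letter l"
  by (simp only: vacuum_def mem_Collect_eq)

lemma an_vacuum:
  assumes "m \<in> vacuum" "\<And>l. c \<noteq> Letter l"
  shows "an (c, k) m = 0"
proof (rule clinear_eqI[of "an (c, k)" "\<lambda>_. 0"])
  show "clinear (\<lambda>_::fock. 0::fock)" by (rule clinearI) simp_all
  fix s assume s: "s \<in> Poly_Mapping.keys m"
  show "an (c, k) (Poly_Mapping.single s 1) = 0"
  proof (rule an_single_absent, rule notI)
    assume "(c, k) \<in># s"
    from vacuumD[OF assms(1) s this] obtain l where "fst (c, k) = Letter l" by (elim exE)
    then show False using assms(2)[of l] by simp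
  qed
qed (rule clinear_an)

lemma wick_sign_False: "wick_sign False h = 1"
  by (simp add: wick_sign_def exchange_def)

text \<open>The alphas of a column are distinct, so only the identity pairs equal ones.\<close>

lemma act_column_word:
  assumes v: "v \<in> vacuum"
  shows "act_word n (map (\<lambda>q. (Letter (s q), Alpha (Suc q))) [0..<h] @
      map (\<lambda>q. (Alpha (Suc q), Letter (t q))) [0..<h]) v =
    cscale (wick_sign True h) (normal_op n h (Letter \<circ> s) (Letter \<circ> t) v)"
proof -
  have 1: "act_word n (map (\<lambda>q. (Alpha (Suc q), Letter (t q))) [0..<h]) v =
      normal_op n h (\<lambda>q. Alpha (Suc q)) (\<lambda>q. Letter (t q)) v"
    by (rule act_word_normal) (auto simp: is_alpha_def)
  have "act_word n (map (\<lambda>q. (Letter (s q), Alpha (Suc q))) [0..<h]) (normal_op n h (\<lambda>q. Alpha (Suc q)) (\<lambda>q. Letter (t q)) v) =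
      (\<Sum>p\<in>{p. p permutes {..<h}}. if \<forall>q<h. Alpha (Suc q) = Alpha (Suc (p q))
       then cscale (wick_sign True h * char1 True p) (normal_op n h (\<lambda>q. Letter (s q)) ((\<lambda>q. Letter (t q)) \<circ> p) v) else 0)"
    by (rule act_word_contract) (auto simp: is_alpha_def intro: an_vacuum[OF v])
  also have "\<dots> = (\<Sum>p\<in>{p. p permutes {..<h}}. if p = id
       then cscale (wick_sign True h * char1 True p) (normal_op n h (\<lambda>q. Letter (s q)) ((\<lambda>q. Letter (t q)) \<circ> p) v) else 0)"
  proof (intro sum.cong refl if_cong)
    fix p assume "p \<in> {p. p permutes {..<h}}"
    then have "p q = q" if "\<not> q < h" for q using that permutes_not_in by fastforce
    then show "(\<forall>q<h. Alpha (Suc q) = Alpha (Suc (p q))) = (p = id)"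
      by (auto simp: fun_eq_iff) metis
  qed
  also have "\<dots> = cscale (wick_sign True h) (normal_op n h (Letter \<circ> s) (Letter \<circ> t) v)"
    by (simp add: sum.delta finite_permutations permutes_id comp_def)
  finally show ?thesis by (simp add: act_word_append 1)
qed

text \<open>The betas mark columns and their modes commute, so contracting them sums over the column
  group without signs; the alphas mark rows and anticommute, which gives the signed row sum. The
  betas are contracted before the alphas, hence \<open>c\<close> stands next to
  \<open>t\<close>.\<close>

lemma act_young_word:
  assumes v: "v \<in> vacuum"
  shows "act_word n (map (\<lambda>q. (Letter (s q), Alpha (Suc (row q)))) [0..<h] @
      map (\<lambda>q. (Alpha (Suc (row q)), Beta (Suc (col q)))) [0..<h] @
      map (\<lambda>q. (Beta (Suc (col q)), Letter (t q))) [0..<h]) v =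
    cscale (wick_sign True h) (\<Sum>r\<in>line_perms {..<h} row. \<Sum>c\<in>line_perms {..<h} col.
      cscale (char1 True r) (normal_op n h (Letter \<circ> s) (Letter \<circ> t \<circ> c \<circ> r) v))"
proof -
  have perms: "(\<Sum>p\<in>{p. p permutes {..<h}}. if \<forall>q<h. line q = line (p q) then f p else 0) =
      (\<Sum>p\<in>line_perms {..<h} line. f p)" for line :: "nat \<Rightarrow> nat" and f :: "_ \<Rightarrow> fock"
    unfolding line_perms_def by (rule sum.inter_filter[symmetric, THEN trans, rotated])
      (auto simp: finite_permutations intro!: sum.cong)
  have 1: "act_word n (map (\<lambda>q. (Beta (Suc (col q)), Letter (t q))) [0..<h]) v =
      normal_op n h (\<lambda>q. Beta (Suc (col q))) (\<lambda>q. Letter (t q)) v"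
    by (rule act_word_normal) (auto simp: is_alpha_def)
  have "act_word n (map (\<lambda>q. (Alpha (Suc (row q)), Beta (Suc (col q)))) [0..<h])
      (normal_op n h (\<lambda>q. Beta (Suc (col q))) (\<lambda>q. Letter (t q)) v) =
      (\<Sum>p\<in>{p. p permutes {..<h}}. if \<forall>q<h. Beta (Suc (col q)) = Beta (Suc (col (p q)))
       then cscale (wick_sign False h * char1 False p) (normal_op n h (\<lambda>q. Alpha (Suc (row q))) ((\<lambda>q. Letter (t q)) \<circ> p) v) else 0)"
    by (rule act_word_contract) (auto simp: is_alpha_def intro: an_vacuum[OF v])
  then have 2: "act_word n (map (\<lambda>q. (Alpha (Suc (row q)), Beta (Suc (col q)))) [0..<h])
      (normal_op n h (\<lambda>q. Beta (Suc (col q))) (\<lambda>q. Letter (t q)) v) =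
      (\<Sum>c\<in>line_perms {..<h} col. normal_op n h (\<lambda>q. Alpha (Suc (row q))) (\<lambda>q. Letter (t (c q))) v)"
    unfolding symb.inject nat.inject perms[of col] by (simp add: wick_sign_False char1_def comp_def)
  have 3: "act_word n (map (\<lambda>q. (Letter (s q), Alpha (Suc (row q)))) [0..<h])
      (normal_op n h (\<lambda>q. Alpha (Suc (row q))) (\<lambda>q. Letter (t (c q))) v) =
      (\<Sum>r\<in>line_perms {..<h} row. cscale (wick_sign True h * char1 True r) (normal_op n h (\<lambda>q. Letter (s q)) ((\<lambda>q. Letter (t (c q))) \<circ> r) v))" for c
  proof -
    have "act_word n (map (\<lambda>q. (Letter (s q), Alpha (Suc (row q)))) [0..<h])
      (normal_op n h (\<lambda>q. Alpha (Suc (row q))) (\<lambda>q. Letter (t (c q))) v) =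
      (\<Sum>p\<in>{p. p permutes {..<h}}. if \<forall>q<h. Alpha (Suc (row q)) = Alpha (Suc (row (p q)))
       then cscale (wick_sign True h * char1 True p) (normal_op n h (\<lambda>q. Letter (s q)) ((\<lambda>q. Letter (t (c q))) \<circ> p) v) else 0)"
      by (rule act_word_contract) (auto simp: is_alpha_def intro: an_vacuum[OF v])
    then show ?thesis unfolding symb.inject nat.inject perms[of row] .
  qed
  show ?thesis
    unfolding act_word_append 1 2 clinear_sum[OF clinear_act_word] 3
    by (subst sum.swap) (simp add: cvs.scale_sum_right comp_def)
qed

section \<open>The enveloping algebra and its action\<close>

lemma single_mult_eq_cscale:
  fixes p :: "'a::monoid_add \<Rightarrow>\<^sub>0 complex"
  shows "Poly_Mapping.single 0 c * p = cscale c p" "p * Poly_Mapping.single 0 c = cscale c p"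
proof -
  have p: "p = (\<Sum>x\<in>Poly_Mapping.keys p. Poly_Mapping.single x (Poly_Mapping.lookup p x))"
    using poly_mapping_sum_single[OF finite_keys subset_refl, of p] by (simp add: cscale_single)
  have c: "cscale c p = (\<Sum>x\<in>Poly_Mapping.keys p. Poly_Mapping.single x (c * Poly_Mapping.lookup p x))"
    using arg_cong[OF p, of "cscale c"] by (simp add: cvs.scale_sum_right cscale_single)
  have "Poly_Mapping.single 0 c * p = (\<Sum>x\<in>Poly_Mapping.keys p. Poly_Mapping.single 0 c * Poly_Mapping.single x (Poly_Mapping.lookup p x))"
    using arg_cong[OF p, of "(*) (Poly_Mapping.single 0 c)"] by (simp add: sum_distrib_left)
  then show "Poly_Mapping.single 0 c * p = cscale c p" by (simp add: c mult_single)
  have "p * Poly_Mapping.single 0 c = (\<Sum>x\<in>Poly_Mapping.keys p. Poly_Mapping.single x (Poly_Mapping.lookup p x) * Poly_Mapping.single 0 c)"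
    using arg_cong[OF p, of "\<lambda>p. p * Poly_Mapping.single 0 c"] by (simp add: sum_distrib_right)
  then show "p * Poly_Mapping.single 0 c = cscale c p" by (simp add: c mult_single mult.commute)
qed

lemma cscale_mult_left: "cscale c p * q = cscale c (p * q)"
  and cscale_mult_right: "p * cscale c q = cscale c (p * q)"
  for p q :: "'a::monoid_add \<Rightarrow>\<^sub>0 complex"
  by (simp add: single_mult_eq_cscale(1)[symmetric] mult.assoc)
     (simp add: single_mult_eq_cscale(2)[symmetric] mult.assoc)

lemma word_monom_mult: "word_monom xs * word_monom ys = word_monom (xs @ ys)"
  by (simp add: word_monom_def mult_single plus_word_def)

lemma word_monom_Nil: "word_monom [] = 1"
  by (simp add: word_monom_def zero_word_def[symmetric])

definition act :: "nat \<Rightarrow> ((symb \<times> symb) word \<Rightarrow>\<^sub>0 complex) \<Rightarrow> fock \<Rightarrow> fock" where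
  "act n p m = lift (\<lambda>w. act_word n (letters w) m) p"

lemma clinear_act_left: "clinear (\<lambda>p. act n p m)"
  unfolding act_def by (rule clinear_lift)

lemma clinear_act: "clinear (act n p)"
  unfolding act_def lift_def by (intro clinear_setsum clinear_scaled clinear_act_word)

lemma act_word_monom: "act n (word_monom xs) m = act_word n xs m"
  by (simp add: act_def word_monom_def)

lemma act_mult: "act n (p * q) m = act n p (act n q m)"
proof (rule clinear_eqI[of "\<lambda>p. act n (p * q) m" "\<lambda>p. act n p (act n q m)"])
  show "clinear (\<lambda>p. act n (p * q) m)"
    by (rule clinearI)
      (simp_all add: distrib_right cscale_mult_left clinear_add[OF clinear_act_left] clinear_cscale[OF clinear_act_left])
  show "clinear (\<lambda>p. act n p (act n q m))" by (rule clinear_act_left)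
  fix w
  show "act n (Poly_Mapping.single w 1 * q) m = act n (Poly_Mapping.single w 1) (act n q m)"
  proof (rule clinear_eqI[of "\<lambda>q. act n (Poly_Mapping.single w 1 * q) m" "\<lambda>q. act n (Poly_Mapping.single w 1) (act n q m)"])
    show "clinear (\<lambda>q. act n (Poly_Mapping.single w 1 * q) m)"
      by (rule clinearI)
        (simp_all add: distrib_left cscale_mult_right clinear_add[OF clinear_act_left] clinear_cscale[OF clinear_act_left])
    show "clinear (\<lambda>q. act n (Poly_Mapping.single w 1) (act n q m))"
      by (rule clinear_compose[OF clinear_act clinear_act_left])
    show "act n (Poly_Mapping.single w 1 * Poly_Mapping.single v 1) m =
        act n (Poly_Mapping.single w 1) (act n (Poly_Mapping.single v 1) m)" for v
      by (simp add: act_def mult_single plus_word_def act_word_append)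
  qed
qed

section \<open>Free algebra, superbracket relations and quotient\<close>

abbreviation fa :: "'a set \<Rightarrow> ('a word \<Rightarrow>\<^sub>0 complex) set" where
  "fa X \<equiv> carrier (free_alg X)"

lemma fa_iff: "p \<in> fa X \<longleftrightarrow> (\<forall>w\<in>Poly_Mapping.keys p. set (letters w) \<subseteq> X)"
  by (simp add: free_alg_def)

lemma free_alg_simps [simp]:
  "x \<otimes>\<^bsub>free_alg X\<^esub> y = x * y" "x \<oplus>\<^bsub>free_alg X\<^esub> y = x + y"
  "\<one>\<^bsub>free_alg X\<^esub> = 1" "\<zero>\<^bsub>free_alg X\<^esub> = 0"
  by (simp_all add: free_alg_def)

lemma fa_add [intro]: "p \<in> fa X \<Longrightarrow> q \<in> fa X \<Longrightarrow> p + q \<in> fa X"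
  using ring.ring_simprules(1)[OF ring_free_alg, of p X q] by simp

lemma fa_mult [intro]: "p \<in> fa X \<Longrightarrow> q \<in> fa X \<Longrightarrow> p * q \<in> fa X"
  using ring.ring_simprules(5)[OF ring_free_alg, of p X q] by simp

lemma fa_cscale [intro]: "p \<in> fa X \<Longrightarrow> cscale c p \<in> fa X"
  by (auto simp: fa_iff in_keys_iff)

lemma fa_uminus [intro]: "p \<in> fa X \<Longrightarrow> - p \<in> fa X"
  by (simp add: fa_iff keys_minus)

lemma fa_diff [intro]: "p \<in> fa X \<Longrightarrow> q \<in> fa X \<Longrightarrow> p - q \<in> fa X"
  using fa_add[of p X "- q"] fa_uminus[of q X] by simp

lemma fa_zero [simp]: "0 \<in> fa X"
  by (simp add: fa_iff)

lemma fa_sum [intro]: "(\<And>i. i \<in> J \<Longrightarrow> f i \<in> fa X) \<Longrightarrow> (\<Sum>i\<in>J. f i) \<in> fa X"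
  by (induction J rule: infinite_finite_induct) auto

lemma fa_monom: "word_monom xs \<in> fa X \<longleftrightarrow> set xs \<subseteq> X"
  by (simp add: fa_iff word_monom_def)

lemma fa_one [simp]: "1 \<in> fa X"
  using fa_monom[of "[]" X] by (simp add: word_monom_Nil)

lemma fa_mono: "X \<subseteq> Y \<Longrightarrow> fa X \<subseteq> fa Y"
  unfolding fa_iff subset_iff[of "fa X"] by (meson order.trans)

lemma a_inv_free_alg: "p \<in> fa X \<Longrightarrow> \<ominus>\<^bsub>free_alg X\<^esub> p = - p"
  using abelian_group.minus_equality[OF ring.is_abelian_group[OF ring_free_alg], where x = p and y = "- p"] by auto

definition gl_relation :: "symb \<times> symb \<Rightarrow> symb \<times> symb \<Rightarrow> (symb \<times> symb) word \<Rightarrow>\<^sub>0 complex" where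
  "gl_relation x y = word_monom [x, y] - cscale ((-1) ^ (gl_parity x * gl_parity y)) (word_monom [y, x])
     - pushforward (\<lambda>z. Word [z]) (gl_bracket x y)"

lemma gl_relation_eq:
  "gl_relation (a, b) (c, d) = word_monom [(a, b), (c, d)]
     - cscale ((-1) ^ (gl_parity (a, b) * gl_parity (c, d))) (word_monom [(c, d), (a, b)])
     - ((if b = c then word_monom [(a, d)] else 0)
        - cscale ((-1) ^ (gl_parity (a, b) * gl_parity (c, d))) (if a = d then word_monom [(c, b)] else 0))"
proof -
  note lin = clinear_lift[of "\<lambda>z. Poly_Mapping.single (Word [z]) 1"]
  show ?thesis
    unfolding gl_relation_def gl_bracket_def pushforward_eq_lift
    by (simp add: clinear_diff[OF lin] clinear_cscale[OF lin] clinear_0[OF lin] word_monom_def)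
qed

lemma act_gl_relation: "act n (gl_relation x y) m = 0"
proof -
  obtain a b c d where xy: "x = (a, b)" "y = (c, d)" by (metis prod.exhaust)
  have "act n (gl_relation x y) m = polar n a b (polar n c d m)
     - cscale ((-1) ^ (gl_parity (a, b) * gl_parity (c, d))) (polar n c d (polar n a b m))
     - ((if b = c then polar n a d m else 0)
        - cscale ((-1) ^ (gl_parity (a, b) * gl_parity (c, d))) (if a = d then polar n c b m else 0))"
    unfolding xy gl_relation_eq
    by (simp add: clinear_diff[OF clinear_act_left] clinear_cscale[OF clinear_act_left] clinear_0[OF clinear_act_left]
        act_word_monom act_word_Cons)
  also have "\<dots> = 0" unfolding polar_bracket[of n a b c d m] by simp
  finally show ?thesis .
qed

locale gl_super =
  fixes m0 m1 n :: nat
begin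

abbreviation "G \<equiv> gl_basis m0 m1 n"
abbreviation "I \<equiv> env_ideal G gl_parity gl_bracket"
abbreviation "U \<equiv> U_gl m0 m1 n"
abbreviation "cls \<equiv> U_class m0 m1 n"
abbreviation "L \<equiv> symb_L n \<times> symb_L n"

lemma L_subset: "L \<subseteq> G"
  by (auto simp: gl_basis_def)

lemma faL_subset: "p \<in> fa L \<Longrightarrow> p \<in> fa G"
  using fa_mono[OF L_subset] by blast

lemma gl_relation_carrier:
  assumes "x \<in> G" "y \<in> G"
  shows "gl_relation x y \<in> fa G"
proof -
  obtain a b c d where xy: "x = (a, b)" "y = (c, d)" by (metis prod.exhaust)
  have "(a, d) \<in> G" "(c, b) \<in> G" using assms by (auto simp: xy gl_basis_def)
  then show ?thesis
    using assms unfolding xy gl_relation_eq by (auto simp: fa_monom intro!: fa_diff fa_cscale)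
qed

lemma env_ideal_eq: "I = Idl\<^bsub>free_alg G\<^esub> {gl_relation x y | x y. x \<in> G \<and> y \<in> G}"
  by (simp add: env_ideal_def gl_relation_def)

lemma ideal_I: "ideal I (free_alg G)"
  unfolding env_ideal_eq by (rule ring.genideal_ideal[OF ring_free_alg]) (auto intro: gl_relation_carrier)

sublocale I: ideal I "free_alg G"
  by (rule ideal_I)

lemma gl_relation_I: "x \<in> G \<Longrightarrow> y \<in> G \<Longrightarrow> gl_relation x y \<in> I"
  unfolding env_ideal_eq
  by (rule subsetD[OF ring.genideal_self[OF ring_free_alg]]) (use gl_relation_carrier in blast)+

lemma I_carrier: "p \<in> I \<Longrightarrow> p \<in> fa G"
  using I.a_subset by blast

lemma I_zero: "0 \<in> I" and I_add: "p \<in> I \<Longrightarrow> q \<in> I \<Longrightarrow> p + q \<in> I"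
  using additive_subgroup.zero_closed[OF ideal.axioms(1)[OF ideal_I]]
    additive_subgroup.a_closed[OF ideal.axioms(1)[OF ideal_I]] by simp_all

lemma I_mult_left: "p \<in> I \<Longrightarrow> q \<in> fa G \<Longrightarrow> q * p \<in> I"
  and I_mult_right: "p \<in> I \<Longrightarrow> q \<in> fa G \<Longrightarrow> p * q \<in> I"
  using I.I_l_closed I.I_r_closed by simp_all

lemma I_cscale: "p \<in> I \<Longrightarrow> cscale c p \<in> I"
  using I_mult_left[OF _ fa_cscale[OF fa_one], of p c] by (simp add: cscale_mult_left)

text \<open>The elements acting by zero form a two-sided ideal, and \<open>polar_bracket\<close>
  puts the defining relations into it.\<close>

lemma act_I: "p \<in> I \<Longrightarrow> act n' p m = 0"
proof -
  let ?K = "{p \<in> fa G. \<forall>m. act n' p m = 0}"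
  note lin = clinear_add[OF clinear_act_left] clinear_uminus[OF clinear_act_left]
    clinear_0[OF clinear_act_left] clinear_0[OF clinear_act]
  have "ideal ?K (free_alg G)"
  proof (rule idealI[OF ring_free_alg])
    show "subgroup ?K (add_monoid (free_alg G))"
    proof (rule group.subgroupI)
      show "Group.group (add_monoid (free_alg G))"
        by (rule abelian_group.a_group[OF ring.is_abelian_group[OF ring_free_alg]])
      show "?K \<noteq> {}" by (auto simp: lin intro!: exI[of _ 0])
      fix p assume p: "p \<in> ?K"
      have "inv\<^bsub>add_monoid (free_alg G)\<^esub> p = - p"
        using a_inv_free_alg[of p G] p by (simp add: a_inv_def)
      then show "inv\<^bsub>add_monoid (free_alg G)\<^esub> p \<in> ?K" using p by (auto simp: lin)
    qed (auto simp: lin)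
  qed (auto simp: act_mult lin)
  moreover have "{gl_relation x y | x y. x \<in> G \<and> y \<in> G} \<subseteq> ?K"
    by (auto simp: gl_relation_carrier act_gl_relation)
  ultimately have "I \<subseteq> ?K"
    unfolding env_ideal_eq by (rule ring.genideal_minimal[OF ring_free_alg])
  then show "p \<in> I \<Longrightarrow> act n' p m = 0" by blast
qed

lemma U_eq: "U = free_alg G Quot I"
  by (simp add: U_gl_def env_alg_def)

lemma ring_U: "ring U"
  unfolding U_eq by (rule I.quotient_is_ring)

lemma cls_def': "cls = (+>\<^bsub>free_alg G\<^esub>) I"
  by (rule ext) (simp add: U_class_def)

lemma cls_hom: "cls \<in> ring_hom (free_alg G) U"
  unfolding U_eq cls_def' by (rule I.rcos_ring_hom)

lemma cls_add: "p \<in> fa G \<Longrightarrow> q \<in> fa G \<Longrightarrow> cls p \<oplus>\<^bsub>U\<^esub> cls q = cls (p + q)"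
  and cls_mult: "p \<in> fa G \<Longrightarrow> q \<in> fa G \<Longrightarrow> cls p \<otimes>\<^bsub>U\<^esub> cls q = cls (p * q)"
  and cls_carrier: "p \<in> fa G \<Longrightarrow> cls p \<in> carrier U"
  using ring_hom_add[OF cls_hom] ring_hom_mult[OF cls_hom] ring_hom_closed[OF cls_hom] by auto

lemma carrier_U: "carrier U = cls ` fa G"
  unfolding U_eq cls_def' by (auto simp: FactRing_def A_RCOSETS_def')

lemma cls_eq_iff: "p \<in> fa G \<Longrightarrow> q \<in> fa G \<Longrightarrow> cls p = cls q \<longleftrightarrow> p - q \<in> I"
  using ring.quotient_eq_iff_same_a_r_cos[OF ring_free_alg ideal_I, of p q]
  by (simp add: cls_def' a_minus_def a_inv_free_alg)

lemma cls_smult: "p \<in> fa G \<Longrightarrow> U_smult m0 m1 n c (cls p) = cls (cscale c p)"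
  unfolding U_smult_def by (subst cls_mult) (auto simp: cscale_mult_left)

lemma cls_zero: "cls 0 = \<zero>\<^bsub>U\<^esub>"
  using ring_hom_zero[OF cls_hom ring_free_alg ring_U] by simp

lemma cls_finsum:
  assumes "finite J" "\<And>j. j \<in> J \<Longrightarrow> f j \<in> fa G"
  shows "(\<Oplus>\<^bsub>U\<^esub>j\<in>J. cls (f j)) = cls (\<Sum>j\<in>J. f j)"
  using assms
proof (induction J rule: finite_induct)
  case empty
  interpret U: ring U by (rule ring_U)
  show ?case by (simp add: cls_zero)
next
  case (insert x J)
  interpret U: ring U by (rule ring_U)
  show ?case using insert by (subst U.finsum_insert) (simp_all add: cls_carrier cls_add fa_sum Pi_def)
qed

end

section \<open>Irregular products annihilate the vacuum\<close>

text \<open>Integer valued, so that degrees may be subtracted freely; a vector whose degree comes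
  out negative must be 0.\<close>

definition symb_degree :: "symb \<Rightarrow> mode multiset \<Rightarrow> int" where
  "symb_degree g s = int (size (filter_mset (\<lambda>x. fst x = g) s))"

definition graded :: "symb \<Rightarrow> int \<Rightarrow> fock \<Rightarrow> bool" where
  "graded g d m \<longleftrightarrow> (\<forall>s\<in>Poly_Mapping.keys m. symb_degree g s = d)"

lemma graded_negative: "graded g d m \<Longrightarrow> d < 0 \<Longrightarrow> m = 0"
  by (force simp: graded_def symb_degree_def simp flip: keys_eq_empty)

lemma keys_cr: "Poly_Mapping.keys (cr x m) \<subseteq> add_mset x ` Poly_Mapping.keys m"
  unfolding cr_def by (rule order.trans[OF keys_lift]) (auto split: if_splits)

lemma keys_an: "Poly_Mapping.keys (an x m) \<subseteq> (\<lambda>s. s - {#x#}) ` {s\<in>Poly_Mapping.keys m. x \<in># s}"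
proof
  fix u assume "u \<in> Poly_Mapping.keys (an x m)"
  moreover have "an x = lift (\<lambda>s. an x (Poly_Mapping.single s 1))"
    by (subst (1) an_def) (simp add: an_def)
  ultimately have "u \<in> Poly_Mapping.keys (lift (\<lambda>s. an x (Poly_Mapping.single s 1)) m)" by metis
  from subsetD[OF keys_lift this]
  obtain s where s: "s \<in> Poly_Mapping.keys m" "u \<in> Poly_Mapping.keys (an x (Poly_Mapping.single s 1))"
    by (elim UN_E)
  have "x \<in># s" using s(2) an_single_absent[of x s 1] by (cases "x \<in># s") simp_all
  moreover have "u = s - {#x#}" using s(2) by (auto simp: an_single split: if_splits)
  ultimately show "u \<in> (\<lambda>s. s - {#x#}) ` {s\<in>Poly_Mapping.keys m. x \<in># s}" using s(1) by blast
qed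

lemma graded_cr: "graded g d m \<Longrightarrow> graded g (d + (if fst x = g then 1 else 0)) (cr x m)"
  using keys_cr[of x m] by (auto simp: graded_def symb_degree_def)

lemma graded_an: "graded g d m \<Longrightarrow> graded g (d - (if fst x = g then 1 else 0)) (an x m)"
  unfolding graded_def
proof
  fix u assume m: "\<forall>s\<in>Poly_Mapping.keys m. symb_degree g s = d" and "u \<in> Poly_Mapping.keys (an x m)"
  then obtain s where s: "s \<in> Poly_Mapping.keys m" "x \<in># s" "u = s - {#x#}" using keys_an by blast
  have "s = add_mset x u" using s(2,3) by simp
  then show "symb_degree g u = d - (if fst x = g then 1 else 0)"
    using m s(1) by (auto simp: symb_degree_def)
qed

lemma graded_sum: "(\<And>i. i \<in> J \<Longrightarrow> graded g d (f i)) \<Longrightarrow> graded g d (\<Sum>i\<in>J. f i)"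
  unfolding graded_def using Poly_Mapping.keys_sum[of f J] by blast

lemma graded_polar:
  assumes "graded g d m"
  shows "graded g (d - (if b = g then 1 else 0) + (if a = g then 1 else 0)) (polar n a b m)"
  unfolding polar_def
proof (rule graded_sum)
  fix k
  show "graded g (d - (if b = g then 1 else 0) + (if a = g then 1 else 0)) (cr (a, k) (an (b, k) m))"
    using graded_cr[OF graded_an[OF assms, of "(b, k)"], of "(a, k)"] by simp
qed

definition word_degree :: "symb \<Rightarrow> (symb \<times> symb) list \<Rightarrow> int" where
  "word_degree g xs = int (length (filter (\<lambda>x. fst x = g) xs)) - int (length (filter (\<lambda>x. snd x = g) xs))"

lemma graded_act_word: "graded g d m \<Longrightarrow> graded g (d + word_degree g xs) (act_word n xs m)"
proof (induction xs)
  case (Cons x xs)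
  from graded_polar[OF Cons.IH[OF Cons.prems], of "snd x" "fst x" n]
  show ?case by (simp add: act_word_Cons word_degree_def algebra_simps split: if_splits)
qed (simp add: word_degree_def)

lemma vacuum_graded:
  assumes "v \<in> vacuum" "\<And>l. g \<noteq> Letter l"
  shows "graded g 0 v"
  unfolding graded_def
proof
  fix s assume s: "s \<in> Poly_Mapping.keys v"
  have "filter_mset (\<lambda>x. fst x = g) s = {#}"
  proof (rule multiset_eqI)
    fix x
    show "count (filter_mset (\<lambda>x. fst x = g) s) x = count {#} x"
      using vacuumD[OF assms(1) s, of x] assms(2) by (auto simp: count_eq_zero_iff)
  qed
  then show "symb_degree g s = 0" by (simp add: symb_degree_def)
qed

text \<open>A virtual symbol has degree 0 in the vacuum. Read from the right, irregularity means
  that up to some factor \<open>g\<close> is removed more often than it was inserted before, which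
  would make its degree negative.\<close>

lemma irregular_act:
  assumes irr: "irregular m0 m1 xs" and v: "v \<in> vacuum"
  shows "act_word n xs v = 0"
proof -
  define ys where "ys = rev xs"
  obtain k g where k: "k < length ys" and g: "g \<in> symb_A0 m0 \<union> symb_A1 m1"
    and c: "card {j. j \<le> k \<and> snd (ys ! j) = g} > card {j. j < k \<and> fst (ys ! j) = g}"
    using irr by (auto simp: irregular_def ys_def)
  have gl: "g \<noteq> Letter l" for l using g by (auto simp: symb_A0_def symb_A1_def)
  have cnt: "length (filter P (take k ys)) = card {j. j < k \<and> P (ys ! j)}" for P
  proof -
    have "length (filter P (take k ys)) = card {j. j < length (take k ys) \<and> P (take k ys ! j)}"
      by (rule length_filter_conv_card)
    also have "{j. j < length (take k ys) \<and> P (take k ys ! j)} = {j. j < k \<and> P (ys ! j)}" using k by auto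
    finally show ?thesis .
  qed
  let ?B = "rev (take k ys)" and ?A = "rev (drop (Suc k) ys)"
  have "ys = take k ys @ ys ! k # drop (Suc k) ys" using k by (rule id_take_nth_drop)
  then have "rev ys = rev (take k ys @ ys ! k # drop (Suc k) ys)" by (rule arg_cong)
  then have xs: "xs = ?A @ ys ! k # ?B" by (simp add: ys_def)
  have deg: "word_degree g ?B = int (card {j. j < k \<and> fst (ys ! j) = g}) - int (card {j. j < k \<and> snd (ys ! j) = g})"
    using cnt[of "\<lambda>x. fst x = g"] cnt[of "\<lambda>x. snd x = g"] by (simp add: word_degree_def rev_filter[symmetric])
  have M: "graded g (word_degree g ?B) (act_word n ?B v)"
    using graded_act_word[OF vacuum_graded[OF v gl], of ?B n] by simp
  have "polar n (fst (ys ! k)) (snd (ys ! k)) (act_word n ?B v) = 0"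
  proof (cases "snd (ys ! k) = g")
    case True
    have "{j. j \<le> k \<and> snd (ys ! j) = g} = insert k {j. j < k \<and> snd (ys ! j) = g}" using True by auto
    then have "card {j. j \<le> k \<and> snd (ys ! j) = g} = Suc (card {j. j < k \<and> snd (ys ! j) = g})" by simp
    then have d: "word_degree g ?B - 1 < 0" using c deg by simp
    have "an (snd (ys ! k), l) (act_word n ?B v) = 0" for l
      using graded_an[OF M, of "(snd (ys ! k), l)"] True d by (intro graded_negative) auto
    then show ?thesis by (simp add: polar_def clinear_0[OF clinear_cr])
  next
    case False
    have "{j. j \<le> k \<and> snd (ys ! j) = g} = {j. j < k \<and> snd (ys ! j) = g}"
      using False by (auto simp: le_less)
    \<comment> \<open>If this factor does not remove \<open>g\<close> itself, the excess is already
      present to its right.\<close>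
    then have "word_degree g ?B < 0" using c deg by simp
    then have "act_word n ?B v = 0" using M by (rule graded_negative[rotated])
    then show ?thesis by (simp add: clinear_0[OF clinear_polar])
  qed
  then show ?thesis
    by (subst xs) (simp add: act_word_append act_word_Cons clinear_0[OF clinear_act_word])
qed

section \<open>The ideal of irregular products, pulled back to the free algebra\<close>

context gl_super
begin

text \<open>A preimage in the free algebra, so that sums and multiples are formed with polynomials
  instead of cosets.\<close>

definition irr_polys :: "((symb \<times> symb) word \<Rightarrow>\<^sub>0 complex) set" where
  "irr_polys = {p \<in> fa G. cls p \<in> Irr m0 m1 n}"

lemma a_inv_U: "p \<in> fa G \<Longrightarrow> inv\<^bsub>add_monoid U\<^esub> (cls p) = cls (- p)"
  using abelian_group.minus_equality[OF ring.is_abelian_group[OF ring_U], where x = "cls p" and y = "cls (- p)"]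
  by (simp add: a_inv_def cls_add cls_carrier fa_uminus cls_zero)

lemma left_ideal_polys:
  assumes "P \<subseteq> fa G" "0 \<in> P" "\<And>p q. p \<in> P \<Longrightarrow> q \<in> P \<Longrightarrow> p + q \<in> P" "\<And>p. p \<in> P \<Longrightarrow> - p \<in> P"
    "\<And>p q. p \<in> P \<Longrightarrow> q \<in> fa G \<Longrightarrow> q * p \<in> P"
  shows "left_ideal U (cls ` P)"
  unfolding left_ideal_def
proof (intro conjI ballI)
  have "subgroup (cls ` P) (add_monoid U)"
  proof (rule group.subgroupI)
    show "Group.group (add_monoid U)"
      by (rule abelian_group.a_group[OF ring.is_abelian_group[OF ring_U]])
    show "cls ` P \<subseteq> carrier (add_monoid U)" using assms(1) by (auto intro: cls_carrier)
    show "cls ` P \<noteq> {}" using assms(2) by auto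
    show "inv\<^bsub>add_monoid U\<^esub> a \<in> cls ` P" if "a \<in> cls ` P" for a
      using that assms(1,4) a_inv_U by auto
    show "a \<otimes>\<^bsub>add_monoid U\<^esub> b \<in> cls ` P" if ab: "a \<in> cls ` P" "b \<in> cls ` P" for a b
    proof -
      obtain p q where "a = cls p" "b = cls q" "p \<in> P" "q \<in> P" using ab by auto
      moreover from this have "p \<in> fa G" "q \<in> fa G" using assms(1) by blast+
      ultimately show ?thesis using assms(3)[of p q] cls_add[of p q] by simp
    qed
  qed
  then show "additive_subgroup (cls ` P) U" by (rule additive_subgroup.intro)
  fix r x assume "r \<in> carrier U" "x \<in> cls ` P"
  then obtain q p where qp: "r = cls q" "x = cls p" "q \<in> fa G" "p \<in> P" unfolding carrier_U by auto
  moreover from this have "p \<in> fa G" using assms(1) by blast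
  ultimately show "r \<otimes>\<^bsub>U\<^esub> x \<in> cls ` P" using assms(5)[of p q] cls_mult[of q p] by simp
qed

lemma Irr_subset: "left_ideal U J \<Longrightarrow> (\<And>xs. set xs \<subseteq> G \<Longrightarrow> irregular m0 m1 xs \<Longrightarrow> cls (word_monom xs) \<in> J) \<Longrightarrow>
    Irr m0 m1 n \<subseteq> J"
  unfolding Irr_def left_ideal_gen_def by blast

lemma Irr_carrier: "Irr m0 m1 n \<subseteq> carrier U"
  unfolding carrier_U
  by (rule Irr_subset[OF left_ideal_polys]) (auto simp: fa_monom)

lemma irr_polysI:
  assumes "p \<in> fa G"
    "\<And>J. left_ideal U J \<Longrightarrow> (\<And>xs. set xs \<subseteq> G \<Longrightarrow> irregular m0 m1 xs \<Longrightarrow> cls (word_monom xs) \<in> J) \<Longrightarrow> cls p \<in> J"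
  shows "p \<in> irr_polys"
proof -
  have "cls p \<in> Irr m0 m1 n"
    unfolding Irr_def left_ideal_gen_def by (rule InterI) (rule assms(2), auto)
  then show ?thesis using assms(1) by (simp add: irr_polys_def)
qed

lemma irr_polysD:
  assumes "p \<in> irr_polys" "left_ideal U J" "\<And>xs. set xs \<subseteq> G \<Longrightarrow> irregular m0 m1 xs \<Longrightarrow> cls (word_monom xs) \<in> J"
  shows "cls p \<in> J"
  using Irr_subset[OF assms(2,3)] assms(1) by (auto simp: irr_polys_def)

lemma irr_polys_carrier: "p \<in> irr_polys \<Longrightarrow> p \<in> fa G"
  by (simp add: irr_polys_def)

lemma irr_polys_I: "p \<in> I \<Longrightarrow> p \<in> irr_polys"
proof (rule irr_polysI)
  assume p: "p \<in> I"
  then show "p \<in> fa G" by (rule I_carrier)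
  fix J assume "left_ideal U J"
  then have "\<zero>\<^bsub>U\<^esub> \<in> J" unfolding left_ideal_def by (blast intro: additive_subgroup.zero_closed)
  moreover have "cls p = cls 0" using cls_eq_iff[of p 0] p I_carrier by simp
  ultimately show "cls p \<in> J" by (simp add: cls_zero)
qed

lemma irr_polys_add:
  assumes "p \<in> irr_polys" "q \<in> irr_polys"
  shows "p + q \<in> irr_polys"
proof (rule irr_polysI)
  show "p + q \<in> fa G" using assms irr_polys_carrier by blast
  fix J assume J: "left_ideal U J" "\<And>xs. set xs \<subseteq> G \<Longrightarrow> irregular m0 m1 xs \<Longrightarrow> cls (word_monom xs) \<in> J"
  have "cls p \<in> J" "cls q \<in> J" using irr_polysD[OF _ J] assms by auto
  then have "cls p \<oplus>\<^bsub>U\<^esub> cls q \<in> J"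
    using J(1) unfolding left_ideal_def by (blast intro: additive_subgroup.a_closed)
  then show "cls (p + q) \<in> J" using assms by (simp add: cls_add irr_polys_carrier)
qed

lemma irr_polys_mult:
  assumes "p \<in> irr_polys" "q \<in> fa G"
  shows "q * p \<in> irr_polys"
proof (rule irr_polysI)
  show "q * p \<in> fa G" using assms irr_polys_carrier by blast
  fix J assume J: "left_ideal U J" "\<And>xs. set xs \<subseteq> G \<Longrightarrow> irregular m0 m1 xs \<Longrightarrow> cls (word_monom xs) \<in> J"
  have "cls p \<in> J" using irr_polysD[OF _ J] assms by auto
  then have "cls q \<otimes>\<^bsub>U\<^esub> cls p \<in> J"
    using J(1) assms(2) unfolding left_ideal_def by (auto intro: cls_carrier)
  then show "cls (q * p) \<in> J" using assms by (simp add: cls_mult irr_polys_carrier)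
qed

lemma irr_polys_cscale: "p \<in> irr_polys \<Longrightarrow> cscale c p \<in> irr_polys"
  using irr_polys_mult[OF _ fa_cscale[OF fa_one], of p c] by (simp add: cscale_mult_left)

lemma irr_polys_irregular: "set xs \<subseteq> G \<Longrightarrow> irregular m0 m1 xs \<Longrightarrow> word_monom xs \<in> irr_polys"
  by (rule irr_polysI) (auto simp: fa_monom)

text \<open>The polynomials killing the vacuum are stable under left multiplication, so their
  classes form a left ideal, which contains the irregular products. Returning from a class to
  \<open>p\<close> costs an element of the relation ideal, which acts by zero.\<close>

lemma act_irr_polys:
  assumes "p \<in> irr_polys" "v \<in> vacuum"
  shows "act n p v = 0"
proof -
  let ?P = "{p \<in> fa G. \<forall>v\<in>vacuum. act n p v = 0}"
  note lin = clinear_add[OF clinear_act_left] clinear_uminus[OF clinear_act_left]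
    clinear_0[OF clinear_act_left] clinear_0[OF clinear_act]
  have "left_ideal U (cls ` ?P)"
    by (rule left_ideal_polys) (auto simp: lin act_mult)
  then have "cls p \<in> cls ` ?P"
    by (rule irr_polysD[OF assms(1)]) (auto simp: fa_monom act_word_monom irregular_act)
  then obtain q where q: "q \<in> ?P" "cls p = cls q" by auto
  then have "p - q \<in> I" using cls_eq_iff[of p q] irr_polys_carrier[OF assms(1)] by auto
  then have "act n (p - q) v = 0" by (rule act_I)
  then show ?thesis using q(1) assms(2) by (simp add: clinear_diff[OF clinear_act_left])
qed

end

section \<open>Faithfulness on the vacuum\<close>

text \<open>
  In the coordinates \<open>y\<^sub>j\<^sub>k = (j|k) - \<delta>\<^sub>j\<^sub>k\<close> centred at the identity matrix, \<open>e\<^sub>i\<^sub>j\<close> acts as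
  \<open>\<partial>/\<partial>y\<^sub>j\<^sub>i\<close> plus a degree preserving operator.  Hence a product of \<open>d\<close> factors, applied to a
  monomial of degree \<open>d\<close> in the \<open>y\<close> and evaluated at the identity matrix, counts matchings.
\<close>

definition shifted :: "nat \<times> nat \<Rightarrow> fock \<Rightarrow> fock" where
  "shifted x m = cr (Letter (fst x), snd x) m - (if fst x = snd x then m else 0)"

definition shifted_monom :: "(nat \<times> nat) list \<Rightarrow> fock" where
  "shifted_monom xs = foldr shifted xs (Poly_Mapping.single {#} 1)"

text \<open>Evaluation at the identity matrix: a monomial gives 1 if all its variables are diagonal,
  else 0. The target \<open>unit \<Rightarrow>\<^sub>0 complex\<close> is a copy of the complex
  numbers to which \<open>clinear\<close> applies.\<close>

definition at_identity :: "fock \<Rightarrow> (unit \<Rightarrow>\<^sub>0 complex)" where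
  "at_identity = lift (\<lambda>s. if \<forall>x\<in>#s. fst x = Letter (snd x) then Poly_Mapping.single () 1 else 0)"

definition letter_word :: "(nat \<times> nat) list \<Rightarrow> (symb \<times> symb) list" where
  "letter_word = map (\<lambda>(i, j). (Letter i, Letter j))"

lemma not_fermionic_Letter [simp]: "\<not> fermionic (Letter j, k)"
  by (simp add: fermionic_def is_alpha_def)

lemma clinear_shifted: "clinear (shifted x)"
  by (rule clinearI)
    (auto simp: shifted_def clinear_add[OF clinear_cr] clinear_cscale[OF clinear_cr] cvs.scale_right_diff_distrib)

lemma clinear_at_identity: "clinear at_identity"
  unfolding at_identity_def by (rule clinear_lift)

lemma vacuum_add: "p \<in> vacuum \<Longrightarrow> q \<in> vacuum \<Longrightarrow> p + q \<in> vacuum"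
  unfolding vacuum_def using Poly_Mapping.keys_add[of p q] by blast

lemma vacuum_uminus: "p \<in> vacuum \<Longrightarrow> - p \<in> vacuum"
  unfolding vacuum_def by (simp add: keys_minus)

lemma shifted_monom_vacuum: "shifted_monom xs \<in> vacuum"
proof (induction xs)
  case Nil
  show ?case by (simp add: shifted_monom_def vacuum_def)
next
  case (Cons x xs)
  have "cr (Letter (fst x), snd x) (shifted_monom xs) \<in> vacuum"
    unfolding vacuum_def
  proof (intro CollectI ballI)
    fix s z assume "s \<in> Poly_Mapping.keys (cr (Letter (fst x), snd x) (shifted_monom xs))" and z: "z \<in># s"
    then obtain u where u: "u \<in> Poly_Mapping.keys (shifted_monom xs)" "s = add_mset (Letter (fst x), snd x) u"
      using keys_cr by blast
    then show "\<exists>l. fst z = Letter l" using z vacuumD[OF Cons u(1), of z] by auto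
  qed
  then show ?case
    using vacuum_add[OF _ vacuum_uminus[OF Cons]]
    by (cases "fst x = snd x") (simp_all add: shifted_monom_def shifted_def)
qed

lemma at_identity_shifted: "at_identity (shifted x m) = 0"
proof -
  have "at_identity (cr (Letter (fst x), snd x) m) = (if fst x = snd x then at_identity m else 0)"
  proof (rule clinear_eqI[of "\<lambda>m. at_identity (cr (Letter (fst x), snd x) m)" "\<lambda>m. if fst x = snd x then at_identity m else 0"])
    show "clinear (\<lambda>m. at_identity (cr (Letter (fst x), snd x) m))"
      by (rule clinear_compose[OF clinear_at_identity clinear_cr])
    show "clinear (\<lambda>m. if fst x = snd x then at_identity m else 0)"
      by (rule clinearI) (simp_all add: clinear_add[OF clinear_at_identity] clinear_cscale[OF clinear_at_identity])
    show "at_identity (cr (Letter (fst x), snd x) (Poly_Mapping.single s 1)) =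
        (if fst x = snd x then at_identity (Poly_Mapping.single s 1) else 0)" for s
      by (simp add: cr_single at_identity_def)
  qed
  then show ?thesis
    by (simp add: shifted_def clinear_diff[OF clinear_at_identity] clinear_0[OF clinear_at_identity])
qed

lemma an_shifted:
  "an (Letter j, k) (shifted x m) = shifted x (an (Letter j, k) m) + (if x = (j, k) then m else 0)"
proof -
  have "(Letter j, k) = (Letter (fst x), snd x) \<longleftrightarrow> x = (j, k)" by (auto simp: prod_eq_iff)
  then show ?thesis
    by (simp add: shifted_def clinear_diff[OF clinear_an] clinear_0[OF clinear_an] an_cr swap_sign_def)
qed

abbreviation remove_nth :: "nat \<Rightarrow> 'a list \<Rightarrow> 'a list" where
  "remove_nth p xs \<equiv> take p xs @ drop (Suc p) xs"

lemma an_shifted_monom: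
  "an (Letter j, k) (shifted_monom xs) =
    (\<Sum>p<length xs. if xs ! p = (j, k) then shifted_monom (remove_nth p xs) else 0)"
proof (induction xs)
  case Nil
  show ?case by (simp add: shifted_monom_def an_single_absent del: single_one)
next
  case (Cons x xs)
  have "an (Letter j, k) (shifted_monom (x # xs)) =
      shifted x (an (Letter j, k) (shifted_monom xs)) + (if x = (j, k) then shifted_monom xs else 0)"
    by (simp add: shifted_monom_def an_shifted)
  also have "shifted x (an (Letter j, k) (shifted_monom xs)) =
      (\<Sum>p<length xs. if xs ! p = (j, k) then shifted_monom (x # remove_nth p xs) else 0)"
    unfolding Cons clinear_sum[OF clinear_shifted]
    by (intro sum.cong refl) (simp add: clinear_0[OF clinear_shifted] shifted_monom_def)
  finally show ?case
    unfolding length_Cons sum.lessThan_Suc_shift take_Suc_Cons drop_Suc_Cons append_Cons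
    by (simp add: add.commute)
qed

text \<open>Multiplication by (i|k) is multiplication by y_ik plus delta_ik: the first part gives
  the terms of unchanged degree, the second the pure derivative.\<close>

lemma polar_shifted_monom:
  assumes i: "i \<in> {1..n}"
  shows "polar n (Letter i) (Letter j) (shifted_monom xs) =
    (\<Sum>k\<in>{1..n}. \<Sum>p<length xs. if xs ! p = (j, k) then shifted_monom ((i, k) # remove_nth p xs) else 0)
    + (\<Sum>p<length xs. if xs ! p = (j, i) then shifted_monom (remove_nth p xs) else 0)"
proof -
  have "polar n (Letter i) (Letter j) (shifted_monom xs) =
      (\<Sum>k\<in>{1..n}. shifted (i, k) (an (Letter j, k) (shifted_monom xs)) +
         (if i = k then an (Letter j, k) (shifted_monom xs) else 0))"
    unfolding polar_def by (intro sum.cong refl) (simp add: shifted_def)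
  also have "\<dots> = (\<Sum>k\<in>{1..n}. shifted (i, k) (an (Letter j, k) (shifted_monom xs))) + an (Letter j, i) (shifted_monom xs)"
    using i by (simp add: sum.distrib)
  also have "(\<Sum>k\<in>{1..n}. shifted (i, k) (an (Letter j, k) (shifted_monom xs))) =
      (\<Sum>k\<in>{1..n}. \<Sum>p<length xs. if xs ! p = (j, k) then shifted_monom ((i, k) # remove_nth p xs) else 0)"
    unfolding an_shifted_monom clinear_sum[OF clinear_shifted]
    by (intro sum.cong refl) (simp add: clinear_0[OF clinear_shifted] shifted_monom_def)
  finally show ?thesis unfolding an_shifted_monom .
qed

text \<open>Each factor of the word lowers the degree in the y by at most one, so some y remains and
  vanishes at the identity matrix.\<close>

lemma at_identity_act_short:
  assumes "set w \<subseteq> {1..n} \<times> {1..n}" "length w < length xs"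
  shows "at_identity (act_word n (letter_word w) (shifted_monom xs)) = 0"
  using assms
proof (induction w arbitrary: xs rule: rev_induct)
  case Nil
  then obtain x ys where "xs = x # ys" by (cases xs) auto
  then show ?case by (simp add: letter_word_def shifted_monom_def at_identity_shifted)
next
  case (snoc e w)
  obtain i j where e: "e = (i, j)" by (cases e)
  have i: "i \<in> {1..n}" using snoc.prems(1) e by auto
  let ?f = "\<lambda>m. at_identity (act_word n (letter_word w) m)"
  have f: "clinear ?f" by (rule clinear_compose[OF clinear_at_identity clinear_act_word])
  have "?f (if xs ! p = (j, k) then shifted_monom ((i, k) # remove_nth p xs) else 0) = 0" if "p < length xs" for p k
    using snoc.IH[of "(i, k) # remove_nth p xs"] snoc.prems that by (simp add: clinear_0[OF f] min_def)
  moreover have "?f (if xs ! p = (j, i) then shifted_monom (remove_nth p xs) else 0) = 0" if "p < length xs" for p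
    using snoc.IH[of "remove_nth p xs"] snoc.prems that by (simp add: clinear_0[OF f] min_def)
  ultimately have "?f (polar n (Letter i) (Letter j) (shifted_monom xs)) = 0"
    unfolding polar_shifted_monom[OF i] clinear_add[OF f] clinear_sum[OF f] by simp
  then show ?case by (simp add: e letter_word_def act_word_append act_word_Cons)
qed

text \<open>By \<open>at_identity_act_short\<close> only the terms that lower the degree survive.
  They count matchings, so nothing cancels; index pairs are swapped because e_ij differentiates with
  respect to y_ji.\<close>

lemma at_identity_act_equal:
  assumes "set w \<subseteq> {1..n} \<times> {1..n}" "length w = length xs"
  shows "\<exists>c::nat. at_identity (act_word n (letter_word w) (shifted_monom xs)) = Poly_Mapping.single () (of_nat c) \<and>
    (c > 0 \<longleftrightarrow> mset (map prod.swap w) = mset xs)"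
  using assms
proof (induction w arbitrary: xs rule: rev_induct)
  case Nil
  then show ?case by (intro exI[of _ 1]) (simp add: letter_word_def shifted_monom_def at_identity_def del: single_one)
next
  case (snoc e w)
  obtain i j where e: "e = (i, j)" by (cases e)
  have i: "i \<in> {1..n}" using snoc.prems(1) e by auto
  have w: "set w \<subseteq> {1..n} \<times> {1..n}" using snoc.prems(1) by auto
  let ?f = "\<lambda>m. at_identity (act_word n (letter_word w) m)"
  have f: "clinear ?f" by (rule clinear_compose[OF clinear_at_identity clinear_act_word])
  have "\<forall>p. \<exists>c::nat. p < length xs \<longrightarrow> ?f (shifted_monom (remove_nth p xs)) = Poly_Mapping.single () (of_nat c) \<and>
      (c > 0 \<longleftrightarrow> mset (map prod.swap w) = mset (remove_nth p xs))"
  proof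
    fix p
    show "\<exists>c::nat. p < length xs \<longrightarrow> ?f (shifted_monom (remove_nth p xs)) = Poly_Mapping.single () (of_nat c) \<and>
      (c > 0 \<longleftrightarrow> mset (map prod.swap w) = mset (remove_nth p xs))"
    proof (cases "p < length xs")
      case True
      then have "length w = length (remove_nth p xs)" using snoc.prems by simp
      from snoc.IH[OF w this] show ?thesis by blast
    qed blast
  qed
  from choice[OF this] obtain c :: "nat \<Rightarrow> nat" where
    c: "\<And>p. p < length xs \<Longrightarrow> ?f (shifted_monom (remove_nth p xs)) = Poly_Mapping.single () (of_nat (c p))"
       "\<And>p. p < length xs \<Longrightarrow> c p > 0 \<longleftrightarrow> mset (map prod.swap w) = mset (remove_nth p xs)" by blast
  let ?C = "\<Sum>p<length xs. if xs ! p = (j, i) then c p else 0"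
  have first: "?f (if xs ! p = (j, k) then shifted_monom ((i, k) # remove_nth p xs) else 0) = 0" if "p < length xs" for p k
    using at_identity_act_short[OF w, of "(i, k) # remove_nth p xs"] snoc.prems that by (simp add: clinear_0[OF f] min_def)
  have "?f (polar n (Letter i) (Letter j) (shifted_monom xs)) =
      (\<Sum>p<length xs. ?f (if xs ! p = (j, i) then shifted_monom (remove_nth p xs) else 0))"
    unfolding polar_shifted_monom[OF i] clinear_add[OF f] clinear_sum[OF f] by (simp add: first)
  also have "\<dots> = (\<Sum>p<length xs. Poly_Mapping.single () (of_nat (if xs ! p = (j, i) then c p else 0)))"
    by (intro sum.cong refl) (simp add: clinear_0[OF f] c(1))
  also have "\<dots> = Poly_Mapping.single () (of_nat ?C)"
    by (rule poly_mapping_eqI) (simp add: lookup_sum)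
  finally have 1: "?f (polar n (Letter i) (Letter j) (shifted_monom xs)) = Poly_Mapping.single () (of_nat ?C)" .
  have rem: "mset xs = add_mset (xs ! p) (mset (remove_nth p xs))" if "p < length xs" for p
    using arg_cong[OF id_take_nth_drop[OF that], of mset] by simp
  have "?C > 0 \<longleftrightarrow> (\<exists>p<length xs. xs ! p = (j, i) \<and> c p > 0)"
  proof -
    have "?C = 0 \<longleftrightarrow> (\<forall>p\<in>{..<length xs}. (if xs ! p = (j, i) then c p else 0) = 0)"
      by (rule sum_eq_0_iff) simp
    also have "\<dots> \<longleftrightarrow> \<not> (\<exists>p<length xs. xs ! p = (j, i) \<and> c p > 0)" by auto
    finally show ?thesis by (simp only: neq0_conv[symmetric]) blast
  qed
  also have "\<dots> \<longleftrightarrow> mset (map prod.swap (w @ [e])) = mset xs"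
  proof
    assume "\<exists>p<length xs. xs ! p = (j, i) \<and> c p > 0"
    then obtain p where "p < length xs" "xs ! p = (j, i)" "mset (map prod.swap w) = mset (remove_nth p xs)"
      using c(2) by blast
    then show "mset (map prod.swap (w @ [e])) = mset xs" using rem[of p] by (simp add: e)
  next
    assume eq: "mset (map prod.swap (w @ [e])) = mset xs"
    then have "(j, i) \<in># mset xs" by (simp add: e flip: eq)
    then obtain p where p: "p < length xs" "xs ! p = (j, i)" by (auto simp: in_set_conv_nth)
    then have "mset (map prod.swap w) = mset (remove_nth p xs)" using eq rem[of p] by (simp add: e)
    then show "\<exists>p<length xs. xs ! p = (j, i) \<and> c p > 0" using p c(2) by blast
  qed
  finally show ?case using 1 by (intro exI[of _ ?C]) (simp add: e letter_word_def act_word_append act_word_Cons)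
qed

section \<open>Degree filtration on the enveloping algebra of gl(n)\<close>

context gl_super
begin

text \<open>Preimage in the free algebra of the part of degree below \<open>d\<close> in the
  filtration of U(gl(n)) by word length.\<close>

definition lower :: "nat \<Rightarrow> ((symb \<times> symb) word \<Rightarrow>\<^sub>0 complex) set" where
  "lower d = {p. \<exists>i\<in>I. \<exists>l\<in>fa L. p = i + l \<and> (\<forall>w\<in>Poly_Mapping.keys l. length (letters w) < d)}"

lemma lowerI: "i \<in> I \<Longrightarrow> l \<in> fa L \<Longrightarrow> (\<And>w. w \<in> Poly_Mapping.keys l \<Longrightarrow> length (letters w) < d) \<Longrightarrow> i + l \<in> lower d"
  unfolding lower_def by blast

lemma lowerE:
  assumes "p \<in> lower d"
  obtains i l where "i \<in> I" "l \<in> fa L" "p = i + l" "\<forall>w\<in>Poly_Mapping.keys l. length (letters w) < d"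
  using assms unfolding lower_def by blast

lemma lower_zero: "0 \<in> lower d"
  using lowerI[OF I_zero fa_zero, of d] by simp

lemma lower_add:
  assumes "p \<in> lower d" "q \<in> lower d"
  shows "p + q \<in> lower d"
proof -
  obtain i l where p: "i \<in> I" "l \<in> fa L" "p = i + l" "\<forall>w\<in>Poly_Mapping.keys l. length (letters w) < d"
    using assms(1) by (rule lowerE)
  obtain i' l' where q: "i' \<in> I" "l' \<in> fa L" "q = i' + l'" "\<forall>w\<in>Poly_Mapping.keys l'. length (letters w) < d"
    using assms(2) by (rule lowerE)
  have "(i + i') + (l + l') \<in> lower d"
  proof (rule lowerI)
    show "i + i' \<in> I" using p(1) q(1) by (rule I_add)
    show "l + l' \<in> fa L" using p(2) q(2) by (rule fa_add)
    fix w assume "w \<in> Poly_Mapping.keys (l + l')"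
    then have "w \<in> Poly_Mapping.keys l \<union> Poly_Mapping.keys l'" using Poly_Mapping.keys_add by (rule subsetD[rotated])
    then show "length (letters w) < d" using p(4) q(4) by blast
  qed
  then show ?thesis by (simp add: p(3) q(3) add_ac)
qed

lemma keys_cscale: "Poly_Mapping.keys (cscale c p) \<subseteq> Poly_Mapping.keys p"
  by (auto simp: in_keys_iff)

lemma lower_cscale:
  assumes "p \<in> lower d"
  shows "cscale c p \<in> lower d"
proof -
  obtain i l where p: "i \<in> I" "l \<in> fa L" "p = i + l" "\<forall>w\<in>Poly_Mapping.keys l. length (letters w) < d"
    using assms by (rule lowerE)
  have "cscale c i + cscale c l \<in> lower d"
  proof (rule lowerI)
    show "cscale c i \<in> I" by (rule I_cscale[OF p(1)])
    show "cscale c l \<in> fa L" by (rule fa_cscale[OF p(2)])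
    fix w assume "w \<in> Poly_Mapping.keys (cscale c l)"
    then show "length (letters w) < d" by (rule bspec[OF p(4) subsetD[OF keys_cscale]])
  qed
  then show ?thesis by (simp add: p(3) cvs.scale_right_distrib)
qed

lemma lower_uminus: "p \<in> lower d \<Longrightarrow> - p \<in> lower d"
  using lower_cscale[of p d "-1"] by simp

lemma lower_sum: "(\<And>j. j \<in> J \<Longrightarrow> f j \<in> lower d) \<Longrightarrow> (\<Sum>j\<in>J. f j) \<in> lower d"
  by (induction J rule: infinite_finite_induct) (simp_all add: lower_zero lower_add)

lemma lower_cons:
  assumes "p \<in> lower d" "x \<in> L"
  shows "word_monom [x] * p \<in> lower (Suc d)"
proof -
  obtain i l where p: "i \<in> I" "l \<in> fa L" "p = i + l" "\<forall>w\<in>Poly_Mapping.keys l. length (letters w) < d"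
    using assms(1) by (rule lowerE)
  have x: "word_monom [x] \<in> fa L" using assms(2) by (simp add: fa_monom)
  have "word_monom [x] * i + word_monom [x] * l \<in> lower (Suc d)"
  proof (rule lowerI)
    show "word_monom [x] * i \<in> I" using p(1) faL_subset[OF x] by (rule I_mult_left)
    show "word_monom [x] * l \<in> fa L" using x p(2) by (rule fa_mult)
    fix w assume "w \<in> Poly_Mapping.keys (word_monom [x] * l)"
    then obtain u v where "w = u + v" "u \<in> Poly_Mapping.keys (word_monom [x])" "v \<in> Poly_Mapping.keys l"
      using keys_mult[of "word_monom [x]" l] by blast
    then show "length (letters w) < Suc d" using bspec[OF p(4), of v] by (simp add: word_monom_def plus_word_def)
  qed
  then show ?thesis by (simp add: p(3) distrib_left)
qed

lemma lower_monom: "set xs \<subseteq> L \<Longrightarrow> length xs < d \<Longrightarrow> word_monom xs \<in> lower d"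
  using lowerI[OF I_zero, of "word_monom xs" d] by (simp add: fa_monom) (simp add: word_monom_def)

text \<open>Letters are odd, hence every generator of gl(n) is even, and exchanging two of them
  costs only brackets, which are shorter words.\<close>

lemma lower_swap:
  assumes "x \<in> L" "y \<in> L" "set zs \<subseteq> L"
  shows "word_monom (x # y # zs) - word_monom (y # x # zs) \<in> lower (length (x # y # zs))"
proof -
  obtain a b c d where xy: "x = (a, b)" "y = (c, d)" by (metis prod.exhaust)
  have L: "(a, d) \<in> L" "(c, b) \<in> L" using assms xy by auto
  have par: "gl_parity (a, b) = 0" using assms(1) by (auto simp: xy gl_parity_def symb_L_def)
  let ?d = "length (x # y # zs)"
  have "gl_relation x y * word_monom zs \<in> I"
    using L_subset assms by (intro I_mult_right gl_relation_I) (auto simp: fa_monom)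
  then have 1: "gl_relation x y * word_monom zs \<in> lower ?d"
    using lowerI[of "gl_relation x y * word_monom zs" 0 ?d] by simp
  have 2: "(if b = c then word_monom ((a, d) # zs) else 0) \<in> lower ?d"
    using L assms(3) by (auto intro!: lower_monom lower_zero)
  have 3: "(if a = d then word_monom ((c, b) # zs) else 0) \<in> lower ?d"
    using L assms(3) by (auto intro!: lower_monom lower_zero)
  have "word_monom (x # y # zs) - word_monom (y # x # zs) = gl_relation x y * word_monom zs +
      (if b = c then word_monom ((a, d) # zs) else 0) + - (if a = d then word_monom ((c, b) # zs) else 0)"
    unfolding xy gl_relation_eq par
    by (simp add: left_diff_distrib word_monom_mult)
  then show ?thesis
    using lower_add[OF lower_add[OF 1 2] lower_uminus[OF 3]] by simp
qed

lemma lower_trans: "p - q \<in> lower d \<Longrightarrow> q - r \<in> lower d \<Longrightarrow> p - r \<in> lower d"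
  using lower_add[of "p - q" d "q - r"] by simp

lemma lower_cons_diff:
  assumes "word_monom xs - word_monom ys \<in> lower d" "x \<in> L"
  shows "word_monom (x # xs) - word_monom (x # ys) \<in> lower (Suc d)"
  using lower_cons[OF assms] by (simp add: right_diff_distrib word_monom_mult)

lemma lower_move:
  assumes "x \<in> L" "set us \<subseteq> L" "set zs \<subseteq> L"
  shows "word_monom (us @ x # zs) - word_monom (x # us @ zs) \<in> lower (Suc (length us + length zs))"
  using assms(2)
proof (induction us)
  case Nil
  show ?case by (simp add: lower_zero)
next
  case (Cons u us)
  have "word_monom (u # us @ x # zs) - word_monom (u # x # us @ zs) \<in> lower (Suc (Suc (length us + length zs)))"
    using Cons by (intro lower_cons_diff) auto
  moreover have "word_monom (u # x # us @ zs) - word_monom (x # u # us @ zs) \<in> lower (Suc (Suc (length us + length zs)))"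
    using lower_swap[of u x "us @ zs"] Cons.prems assms by simp
  ultimately have "word_monom (u # us @ x # zs) - word_monom (x # u # us @ zs) \<in> lower (Suc (Suc (length us + length zs)))"
    by (rule lower_trans)
  then show ?case by simp
qed

text \<open>The spanning half of the Poincare-Birkhoff-Witt theorem; the independence of words up to
  order will come from the action.\<close>

lemma lower_permuted:
  assumes "mset xs = mset ys" "set xs \<subseteq> L"
  shows "word_monom xs - word_monom ys \<in> lower (length xs)"
  using assms
proof (induction xs arbitrary: ys)
  case Nil
  then show ?case by (simp add: lower_zero)
next
  case (Cons x xs)
  have "x \<in> set ys" using Cons.prems(1) by (metis list.set_intros(1) set_mset_mset)
  then obtain us zs where ys: "ys = us @ x # zs" using split_list by metis
  have ms: "mset xs = mset (us @ zs)" using Cons.prems(1) by (simp add: ys)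
  have "set ys = set (x # xs)" using Cons.prems(1) by (metis set_mset_mset)
  then have "set us \<subseteq> set (x # xs)" "set zs \<subseteq> set (x # xs)" "x \<in> set (x # xs)" unfolding ys by auto
  then have setL: "set us \<subseteq> L" "set zs \<subseteq> L" "x \<in> L" using Cons.prems(2) by blast+
  have len: "length xs = length us + length zs" using arg_cong[OF ms, of size] by simp
  have 1: "word_monom (x # xs) - word_monom (x # us @ zs) \<in> lower (Suc (length xs))"
    using Cons.IH[OF ms] Cons.prems(2) setL(3) by (intro lower_cons_diff) auto
  have "word_monom (us @ x # zs) - word_monom (x # us @ zs) \<in> lower (Suc (length xs))"
    using lower_move[OF setL(3,1,2)] by (simp add: len)
  from lower_trans[OF 1] lower_uminus[OF this] show ?case by (simp add: ys)
qed

text \<open>\<open>SOME\<close> depends on the multiset alone, so words differing only in order get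
  the same representative, without any order on the letters.\<close>

definition canonical :: "'a list \<Rightarrow> 'a list" where
  "canonical xs = (SOME ys. mset ys = mset xs)"

lemma mset_canonical: "mset (canonical xs) = mset xs"
  unfolding canonical_def by (rule someI_ex) blast

lemma canonical_eq_iff: "canonical xs = canonical ys \<longleftrightarrow> mset xs = mset ys"
  by (metis canonical_def mset_canonical)

lemma set_canonical: "set (canonical xs) = set xs" and length_canonical: "length (canonical xs) = length xs"
  using mset_canonical[of xs] by (metis set_mset_mset, metis size_mset)

definition unletter :: "symb \<times> symb \<Rightarrow> nat \<times> nat" where
  "unletter x = (THE y. x = (Letter (fst y), Letter (snd y)))"

lemma unletter [simp]: "unletter (Letter i, Letter j) = (i, j)"
  unfolding unletter_def by (rule the_equality) auto

lemma letter_word_unletter: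
  assumes "set xs \<subseteq> L"
  shows "letter_word (map unletter xs) = xs" "set (map unletter xs) \<subseteq> {1..n} \<times> {1..n}"
  using assms by (induction xs) (auto simp: letter_word_def symb_L_def)

lemma act_low_degree:
  assumes "q \<in> fa L" "\<And>w. w \<in> Poly_Mapping.keys q \<Longrightarrow> length (letters w) < length xs"
  shows "at_identity (act n q (shifted_monom xs)) = 0"
proof -
  have "at_identity (act_word n (letters w) (shifted_monom xs)) = 0" if "w \<in> Poly_Mapping.keys q" for w
  proof -
    have "set (letters w) \<subseteq> L" using assms(1) that by (simp add: fa_iff)
    from letter_word_unletter[OF this] show ?thesis
      using at_identity_act_short[of "map unletter (letters w)" n xs] assms(2)[OF that] by simp
  qed
  then show ?thesis
    by (simp add: act_def lift_def clinear_sum[OF clinear_at_identity] clinear_cscale[OF clinear_at_identity])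
qed

text \<open>Each representative is tested on the polynomial whose factors are its swapped index
  pairs. No other representative matches that polynomial, and this one does with a positive count,
  so its coefficient must vanish.\<close>

lemma canonical_combination_zero:
  assumes T: "finite T" "\<And>w. w \<in> T \<Longrightarrow> set (letters w) \<subseteq> L \<and> length (letters w) = d"
    and zero: "\<And>xs. length xs = d \<Longrightarrow>
      at_identity (act n (\<Sum>w\<in>T. cscale (c w) (word_monom (canonical (letters w)))) (shifted_monom xs)) = 0"
  shows "(\<Sum>w\<in>T. cscale (c w) (word_monom (canonical (letters w)))) = 0"
proof (rule poly_mapping_eqI)
  fix u
  let ?t = "\<Sum>w\<in>T. cscale (c w) (word_monom (canonical (letters w)))"
  have look: "Poly_Mapping.lookup ?t u = (\<Sum>w\<in>T. if Word (canonical (letters w)) = u then c w else 0)"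
    unfolding lookup_sum lookup_cscale word_monom_def lookup_single
    by (intro sum.cong refl) (simp add: when_def)
  show "Poly_Mapping.lookup ?t u = Poly_Mapping.lookup 0 u"
  proof (cases "\<exists>w\<in>T. Word (canonical (letters w)) = u")
    case False
    then show ?thesis unfolding look by (simp add: sum.neutral)
  next
    case True
    then obtain w0 where w0: "w0 \<in> T" "u = Word (canonical (letters w0))" by blast
    let ?us = "canonical (letters w0)" and ?xs = "map (prod.swap \<circ> unletter) (canonical (letters w0))"
    have us: "set ?us \<subseteq> L" "length ?us = d" using T(2)[OF w0(1)] by (simp_all add: set_canonical length_canonical)
    have "\<exists>k::nat. at_identity (act_word n ?us (shifted_monom ?xs)) = Poly_Mapping.single () (of_nat k) \<and>
        (k > 0 \<longleftrightarrow> mset (map prod.swap (map unletter ?us)) = mset ?xs)"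
      using at_identity_act_equal[of "map unletter ?us" n ?xs] letter_word_unletter[OF us(1)] by simp
    then obtain k :: nat where k: "at_identity (act_word n ?us (shifted_monom ?xs)) = Poly_Mapping.single () (of_nat k)" "k > 0"
      by auto
    have other: "at_identity (act_word n (canonical (letters w)) (shifted_monom ?xs)) =
        (if Word (canonical (letters w)) = u then Poly_Mapping.single () (of_nat k) else 0)" if w: "w \<in> T" for w
    proof (cases "canonical (letters w) = ?us")
      case False
      let ?ws = "canonical (letters w)"
      have ws: "set ?ws \<subseteq> L" "length ?ws = d" using T(2)[OF w] by (simp_all add: set_canonical length_canonical)
      have "mset (map prod.swap (map unletter ?ws)) \<noteq> mset ?xs"
      proof
        assume eq: "mset (map prod.swap (map unletter ?ws)) = mset ?xs"
        have unswap: "image_mset (\<lambda>(j, i). (Letter i, Letter j)) (mset (map prod.swap (map unletter xs))) = mset xs"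
          if "set xs \<subseteq> L" for xs
        proof -
          have "image_mset (\<lambda>(j, i). (Letter i, Letter j)) (mset (map prod.swap (map unletter xs))) =
              mset (letter_word (map unletter xs))"
            by (simp add: letter_word_def multiset.map_comp comp_def case_prod_beta prod.swap_def flip: mset_map)
          then show ?thesis using letter_word_unletter(1)[OF that] by simp
        qed
        have "mset ?ws = mset ?us"
          unfolding unswap[OF ws(1), symmetric] eq map_map[symmetric] by (rule unswap[OF us(1)])
        then have "mset (letters w) = mset (letters w0)" by (simp add: mset_canonical)
        then show False using False canonical_eq_iff by blast
      qed
      then have "at_identity (act_word n ?ws (shifted_monom ?xs)) = 0"
        using at_identity_act_equal[of "map unletter ?ws" n ?xs] letter_word_unletter[OF ws(1)] ws(2) us(2)
        by auto
      then show ?thesis using False w0(2) by simp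
    qed (simp add: w0(2) k)
    have "0 = at_identity (act n ?t (shifted_monom ?xs))" using zero[of ?xs] us(2) by simp
    also have "\<dots> = (\<Sum>w\<in>T. cscale (c w) (at_identity (act_word n (canonical (letters w)) (shifted_monom ?xs))))"
      by (simp add: clinear_sum[OF clinear_act_left] clinear_cscale[OF clinear_act_left] act_word_monom
          clinear_sum[OF clinear_at_identity] clinear_cscale[OF clinear_at_identity])
    also have "\<dots> = (\<Sum>w\<in>T. Poly_Mapping.single () ((if Word (canonical (letters w)) = u then c w else 0) * of_nat k))"
      by (intro sum.cong refl) (simp add: other cscale_single)
    finally have "0 = Poly_Mapping.lookup (\<Sum>w\<in>T. Poly_Mapping.single () ((if Word (canonical (letters w)) = u then c w else 0) * of_nat k)) ()"
      by (metis lookup_zero)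
    then have "Poly_Mapping.lookup ?t u * of_nat k = 0"
      unfolding look by (simp add: lookup_sum sum_distrib_right)
    then show ?thesis using k(2) by simp
  qed
qed

text \<open>Induction on a strict bound for the word length. The top part is replaced by canonical
  words at the price of an element of \<open>I\<close> and shorter words. The test polynomials of
  degree \<open>d\<close> do not see the shorter part, so the canonical part is 0 and a polynomial
  of smaller degree remains.\<close>

lemma faithful:
  assumes "p \<in> fa L" "\<And>w. w \<in> Poly_Mapping.keys p \<Longrightarrow> length (letters w) < d"
    and "\<And>v. v \<in> vacuum \<Longrightarrow> act n p v = 0"
  shows "p \<in> I"
  using assms
proof (induction d arbitrary: p)
  case 0
  then have "Poly_Mapping.keys p = {}" by blast
  then show ?case by (simp add: I_zero)
next
  case (Suc d)
  let ?K = "Poly_Mapping.keys p" and ?c = "Poly_Mapping.lookup p"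
  define T where "T = {w \<in> ?K. length (letters w) = d}"
  have T: "finite T" "T \<subseteq> ?K" by (auto simp: T_def)
  have TL: "set (letters w) \<subseteq> L \<and> length (letters w) = d" if "w \<in> T" for w
    using that Suc.prems(1) by (simp add: T_def fa_iff)
  have monom: "Poly_Mapping.single w 1 = word_monom (letters w)" for w :: "(symb \<times> symb) word"
    by (simp add: word_monom_def)
  define q where "q = (\<Sum>w\<in>?K - T. cscale (?c w) (word_monom (letters w)))"
  define r where "r = (\<Sum>w\<in>T. cscale (?c w) (word_monom (letters w) - word_monom (canonical (letters w))))"
  define t where "t = (\<Sum>w\<in>T. cscale (?c w) (word_monom (canonical (letters w))))"
  have "p = (\<Sum>w\<in>?K. cscale (?c w) (word_monom (letters w)))"
    using poly_mapping_sum_single[OF finite_keys subset_refl, of p] by (simp add: monom)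
  also have "\<dots> = q + (\<Sum>w\<in>T. cscale (?c w) (word_monom (letters w)))"
    unfolding q_def using T by (intro sum.subset_diff) auto
  also have "(\<Sum>w\<in>T. cscale (?c w) (word_monom (letters w))) = r + t"
    by (simp add: r_def t_def cvs.scale_right_diff_distrib sum_subtractf)
  finally have p: "p = q + (r + t)" .
  have qL: "q \<in> fa L"
    unfolding q_def using Suc.prems(1) by (intro fa_sum fa_cscale, unfold fa_monom) (auto simp: fa_iff)
  have qd: "length (letters w) < d" if "w \<in> Poly_Mapping.keys q" for w
  proof -
    have "w \<in> (\<Union>w\<in>?K - T. Poly_Mapping.keys (cscale (?c w) (word_monom (letters w))))"
      using that Poly_Mapping.keys_sum unfolding q_def by (rule subsetD[rotated])
    then obtain w' where "w' \<in> ?K - T" "w \<in> Poly_Mapping.keys (cscale (?c w') (word_monom (letters w')))" by blast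
    then have "w \<in> ?K - T" using subsetD[OF keys_cscale] by (fastforce simp: word_monom_def)
    then show ?thesis using Suc.prems(2)[of w] by (auto simp: T_def)
  qed
  have "r \<in> lower d"
    unfolding r_def using TL lower_permuted[OF mset_canonical[symmetric]]
    by (intro lower_sum lower_cscale) metis
  then obtain i l where r: "i \<in> I" "l \<in> fa L" "r = i + l" "\<forall>w\<in>Poly_Mapping.keys l. length (letters w) < d"
    by (rule lowerE)
  have qlL: "q + l \<in> fa L" using qL r(2) by (rule fa_add)
  have qld: "length (letters w) < d" if "w \<in> Poly_Mapping.keys (q + l)" for w
    using subsetD[OF Poly_Mapping.keys_add that] qd r(4) by blast
  have act_p: "act n p m = act n (q + l) m + act n t m" for m
    using act_I[OF r(1), of n m] by (simp add: p r(3) clinear_add[OF clinear_act_left] add_ac)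
  have t0: "t = 0"
    unfolding t_def
  proof (rule canonical_combination_zero[OF T(1) TL])
    fix xs :: "(nat \<times> nat) list" assume xs: "length xs = d"
    have "at_identity (act n (q + l) (shifted_monom xs)) = 0"
      using qlL qld xs by (intro act_low_degree) auto
    moreover have "act n p (shifted_monom xs) = 0" by (rule Suc.prems(3)[OF shifted_monom_vacuum])
    ultimately show "at_identity (act n (\<Sum>w\<in>T. cscale (?c w) (word_monom (canonical (letters w)))) (shifted_monom xs)) = 0"
      using arg_cong[OF act_p[of "shifted_monom xs"], of at_identity]
      by (simp add: clinear_add[OF clinear_at_identity] clinear_0[OF clinear_at_identity] t_def)
  qed
  have "q + l \<in> I"
  proof (rule Suc.IH[OF qlL qld])
    show "act n (q + l) v = 0" if "v \<in> vacuum" for v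
      using act_p[of v] Suc.prems(3)[OF that] by (simp add: t0 clinear_0[OF clinear_act_left])
  qed
  then have "(q + l) + i \<in> I" using r(1) by (rule I_add)
  then show ?case by (simp add: p t0 r(3) add_ac)
qed

theorem faithful_on_vacuum:
  assumes "p \<in> fa L" "\<And>v. v \<in> vacuum \<Longrightarrow> act n p v = 0"
  shows "p \<in> I"
proof (rule faithful[OF assms(1) _ assms(2)])
  show "length (letters w) < Suc (Max ((length \<circ> letters) ` Poly_Mapping.keys p))" if "w \<in> Poly_Mapping.keys p" for w
    using that by (auto simp: less_Suc_eq_le intro!: Max_ge)
qed

end

section \<open>The projection of balanced words\<close>

context gl_super
begin

definition virtual :: "symb set" where
  "virtual = symb_A0 m0 \<union> symb_A1 m1"

text \<open>Weight zero in all virtual symbols. Brackets preserve the weight, so the shorter words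
  produced by reordering are again balanced.\<close>

definition balanced :: "(symb \<times> symb) list \<Rightarrow> bool" where
  "balanced xs \<longleftrightarrow> (\<forall>g\<in>virtual. word_degree g xs = 0)"

definition projectable :: "((symb \<times> symb) word \<Rightarrow>\<^sub>0 complex) \<Rightarrow> bool" where
  "projectable p \<longleftrightarrow> (\<exists>y\<in>fa L. p - y \<in> irr_polys)"

lemma projectable_add:
  assumes "projectable p" "projectable q"
  shows "projectable (p + q)"
proof -
  obtain y z where "y \<in> fa L" "p - y \<in> irr_polys" "z \<in> fa L" "q - z \<in> irr_polys"
    using assms unfolding projectable_def by blast
  then have "y + z \<in> fa L" "(p - y) + (q - z) \<in> irr_polys" by (auto intro: irr_polys_add)
  then show ?thesis unfolding projectable_def by (intro bexI[of _ "y + z"]) (simp_all add: algebra_simps)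
qed

lemma projectable_cscale:
  assumes "projectable p"
  shows "projectable (cscale c p)"
proof -
  obtain y where "y \<in> fa L" "p - y \<in> irr_polys"
    using assms unfolding projectable_def by blast
  then have "cscale c y \<in> fa L" "cscale c (p - y) \<in> irr_polys" by (auto intro: irr_polys_cscale)
  then show ?thesis unfolding projectable_def
    by (intro bexI[of _ "cscale c y"]) (simp_all add: cvs.scale_right_diff_distrib)
qed

lemma projectable_uminus: "projectable p \<Longrightarrow> projectable (- p)"
  using projectable_cscale[of p "-1"] by simp

lemma projectable_irr: "p \<in> irr_polys \<Longrightarrow> projectable p"
  unfolding projectable_def by (intro bexI[of _ 0]) simp_all

lemma projectable_zero: "projectable 0"
  by (rule projectable_irr[OF irr_polys_I[OF I_zero]])

lemma word_degree_append: "word_degree g (xs @ ys) = word_degree g xs + word_degree g ys"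
  and word_degree_Cons: "word_degree g (x # xs) =
    (if fst x = g then 1 else 0) - (if snd x = g then 1 else 0) + word_degree g xs"
  and word_degree_Nil: "word_degree g [] = 0"
  by (simp_all add: word_degree_def)

text \<open>
  A factor \<open>e\<^bsub>a,\<gamma>\<^esub>\<close> with \<open>\<gamma>\<close> virtual is moved to the right end of the word, where it makes the
  word irregular; the brackets arising on the way are balanced words of smaller length.
\<close>

lemma projectable_move:
  assumes IH: "\<And>ys. length ys < N \<Longrightarrow> set ys \<subseteq> G \<Longrightarrow> balanced ys \<Longrightarrow> projectable (word_monom ys)"
    and "length (us @ (a, g) # vs) = N" "set (us @ (a, g) # vs) \<subseteq> G" "balanced (us @ (a, g) # vs)" "g \<in> virtual"
  shows "projectable (word_monom (us @ (a, g) # vs))"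
  using assms(2-)
proof (induction vs arbitrary: us)
  case Nil
  \<comment> \<open>This includes \<open>a = g\<close>: upper indices are counted strictly before
    the factor, lower ones up to and including it.\<close>
  have "irregular m0 m1 [(a, g)]"
  proof -
    have 1: "{j. j \<le> 0 \<and> snd (rev [(a, g)] ! j) = g} = {0::nat}" by auto
    have 2: "{j::nat. j < 0 \<and> fst (rev [(a, g)] ! j) = g} = {}" by auto
    show ?thesis
      unfolding irregular_def
    proof (intro exI[of _ "0::nat"] conjI bexI[of _ g])
      show "card {j. j < 0 \<and> fst (rev [(a, g)] ! j) = g} < card {j. j \<le> 0 \<and> snd (rev [(a, g)] ! j) = g}"
        unfolding 1 2 by simp
      show "g \<in> symb_A0 m0 \<union> symb_A1 m1" using Nil.prems(4) by (simp only: virtual_def)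
    qed simp
  qed
  then have "word_monom [(a, g)] \<in> irr_polys" using Nil.prems(2) by (intro irr_polys_irregular) auto
  then have "word_monom us * word_monom [(a, g)] \<in> irr_polys"
    using Nil.prems(2) by (intro irr_polys_mult) (auto simp: fa_monom)
  then show ?case by (intro projectable_irr) (simp add: word_monom_mult)
next
  case (Cons x vs)
  obtain c d where x: "x = (c, d)" by (cases x)
  have G: "(a, g) \<in> G" "(c, d) \<in> G" "set us \<subseteq> G" "set vs \<subseteq> G" using Cons.prems(2) x by auto
  then have G': "(a, d) \<in> G" "(c, g) \<in> G" by (auto simp: gl_basis_def)
  let ?s = "(-1) ^ (gl_parity (a, g) * gl_parity (c, d)) :: complex"
  have swapped: "projectable (word_monom (us @ (c, d) # (a, g) # vs))"
  proof -
    have "balanced ((us @ [(c, d)]) @ (a, g) # vs)"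
      using Cons.prems(3) unfolding balanced_def x
      by (simp add: word_degree_append word_degree_Cons word_degree_Nil algebra_simps)
    then show ?thesis using Cons.IH[of "us @ [(c, d)]"] Cons.prems G x by auto
  qed
  have br1: "projectable (if g = c then word_monom (us @ (a, d) # vs) else 0)"
  proof (cases "g = c")
    case True
    have "balanced (us @ (a, d) # vs)"
      using Cons.prems(3) unfolding balanced_def x True
      by (simp add: word_degree_append word_degree_Cons word_degree_Nil algebra_simps split: if_splits)
    then show ?thesis using IH[of "us @ (a, d) # vs"] Cons.prems(1) G G' True by simp
  qed (simp add: projectable_zero)
  have br2: "projectable (if a = d then word_monom (us @ (c, g) # vs) else 0)"
  proof (cases "a = d")
    case True
    have "balanced (us @ (c, g) # vs)"
      using Cons.prems(3) unfolding balanced_def x True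
      by (simp add: word_degree_append word_degree_Cons word_degree_Nil algebra_simps split: if_splits)
    then show ?thesis using IH[of "us @ (c, g) # vs"] Cons.prems(1) G G' True by simp
  qed (simp add: projectable_zero)
  have "word_monom us * gl_relation (a, g) (c, d) * word_monom vs \<in> I"
    using G by (intro I_mult_right I_mult_left gl_relation_I) (auto simp: fa_monom)
  then have rel: "projectable (word_monom us * gl_relation (a, g) (c, d) * word_monom vs)"
    by (intro projectable_irr irr_polys_I)
  have "word_monom (us @ (a, g) # x # vs) = word_monom us * gl_relation (a, g) (c, d) * word_monom vs
      + cscale ?s (word_monom (us @ (c, d) # (a, g) # vs))
      + ((if g = c then word_monom (us @ (a, d) # vs) else 0)
        + - cscale ?s (if a = d then word_monom (us @ (c, g) # vs) else 0))"
    unfolding x gl_relation_eq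
    by (simp add: right_diff_distrib left_diff_distrib cscale_mult_left cscale_mult_right word_monom_mult)
  then show ?case
    using projectable_add[OF projectable_add[OF rel projectable_cscale[OF swapped]]
      projectable_add[OF br1 projectable_uminus[OF projectable_cscale[OF br2]]]] by simp
qed

text \<open>Induction on the length. Once no lower index is virtual, balance excludes virtual upper
  indices too, and the word already lies in the algebra of gl(n).\<close>

lemma projectable_balanced:
  assumes "set xs \<subseteq> G" "balanced xs"
  shows "projectable (word_monom xs)"
  using assms
proof (induction "length xs" arbitrary: xs rule: less_induct)
  case less
  show ?case
  proof (cases "\<exists>x\<in>set xs. snd x \<in> virtual")
    case True
    then obtain us a g vs where xs: "xs = us @ (a, g) # vs" and g: "g \<in> virtual"
      by (metis prod.collapse split_list)
    show ?thesis
      unfolding xs by (rule projectable_move[OF less.hyps]) (use less.prems xs g in auto)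
  next
    case False
    have "set xs \<subseteq> L"
    proof
      fix x assume x: "x \<in> set xs"
      have snd: "filter (\<lambda>x. snd x = g) xs = []" if "g \<in> virtual" for g
        using False that by (auto simp: filter_empty_conv)
      have "fst x \<notin> virtual"
      proof
        assume v: "fst x \<in> virtual"
        have "word_degree (fst x) xs = 0" using less.prems(2) v unfolding balanced_def by blast
        then have "filter (\<lambda>y. fst y = fst x) xs = []" unfolding word_degree_def snd[OF v] by simp
        then show False using x by (auto simp: filter_empty_conv)
      qed
      moreover have "snd x \<notin> virtual" using False x by blast
      moreover have "x \<in> G" using less.prems(1) x by blast
      ultimately show "x \<in> L" by (cases x) (auto simp: gl_basis_def virtual_def)
    qed
    then have "word_monom xs \<in> fa L" by (simp add: fa_monom)
    then show ?thesis unfolding projectable_def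
      by (intro bexI[of _ "word_monom xs"]) (simp_all add: irr_polys_I I_zero)
  qed
qed

lemma cls_eq_of_act:
  assumes "y \<in> fa L" "z \<in> fa L" "\<And>v. v \<in> vacuum \<Longrightarrow> act n y v = act n z v"
  shows "cls y = cls z"
proof -
  have "y - z \<in> I"
    using assms by (intro faithful_on_vacuum fa_diff) (simp_all add: clinear_diff[OF clinear_act_left])
  then show ?thesis using cls_eq_iff faL_subset assms(1,2) by blast
qed

text \<open>The definite description needs uniqueness: two candidates differ by an irregular
  element, so they act equally on the vacuum and agree by faithfulness. Here U(gl(n)) is seen to
  meet \<open>Irr\<close> only in 0.\<close>

lemma virt_proj_cls:
  assumes "p \<in> fa G" "y \<in> fa L" "p - y \<in> irr_polys"
  shows "virt_proj m0 m1 n (cls p) = cls y"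
  unfolding virt_proj_def
proof (rule the_equality)
  have yG: "y \<in> fa G" using assms(2) by (rule faL_subset)
  have "cls p = cls y \<oplus>\<^bsub>U\<^esub> cls (p - y)" using cls_add[of y "p - y"] assms yG by (simp add: fa_diff)
  then show "cls y \<in> U_gln m0 m1 n \<and> (\<exists>z\<in>Irr m0 m1 n. cls p = cls y \<oplus>\<^bsub>U\<^esub> z)"
    using assms(2,3) by (auto simp: U_gln_def irr_polys_def)
next
  fix u assume "u \<in> U_gln m0 m1 n \<and> (\<exists>z\<in>Irr m0 m1 n. cls p = u \<oplus>\<^bsub>U\<^esub> z)"
  then obtain y' z where y': "y' \<in> fa L" "u = cls y'" and z: "z \<in> Irr m0 m1 n" "cls p = u \<oplus>\<^bsub>U\<^esub> z"
    by (auto simp: U_gln_def)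
  obtain q where q: "q \<in> fa G" "z = cls q" using z(1) Irr_carrier unfolding carrier_U by blast
  then have qi: "q \<in> irr_polys" using z(1) by (simp add: irr_polys_def)
  have "cls p = cls (y' + q)" using z(2) y' q by (simp add: cls_add faL_subset)
  then have pI: "p - (y' + q) \<in> I"
    using cls_eq_iff[of p "y' + q"] assms(1) fa_add[OF faL_subset[OF y'(1)] q(1)] by blast
  show "u = cls y"
    unfolding y'(2)
  proof (rule cls_eq_of_act[OF y'(1) assms(2)])
    fix v assume v: "v \<in> vacuum"
    have "act n (p - (y' + q)) v = 0" "act n q v = 0" "act n (p - y) v = 0"
      using act_I[OF pI] act_irr_polys[OF qi v] act_irr_polys[OF assms(3) v] by blast+
    then show "act n y' v = act n y v"
      by (simp add: clinear_diff[OF clinear_act_left] clinear_add[OF clinear_act_left])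
  qed
qed

text \<open>The projected element is never computed; it is known through its action on the vacuum,
  which is that of the word.\<close>

theorem virt_proj_balanced:
  assumes "set xs \<subseteq> G" "balanced xs"
  obtains y where "y \<in> fa L" "virt_proj m0 m1 n (cls (word_monom xs)) = cls y"
    "\<forall>v\<in>vacuum. act n y v = act_word n xs v"
proof -
  obtain y where y: "y \<in> fa L" "word_monom xs - y \<in> irr_polys"
    using projectable_balanced[OF assms] unfolding projectable_def by blast
  have "word_monom xs \<in> fa G" using assms(1) by (simp add: fa_monom)
  then have "virt_proj m0 m1 n (cls (word_monom xs)) = cls y" using y by (intro virt_proj_cls)
  moreover have "\<forall>v\<in>vacuum. act n y v = act_word n xs v"
    using act_irr_polys[OF y(2)] by (auto simp: clinear_diff[OF clinear_act_left] act_word_monom)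
  ultimately show ?thesis using y(1) that by blast
qed

end

section \<open>Bitableaux in reading order\<close>

definition cells :: "nat list \<Rightarrow> (nat \<times> nat) list" where
  "cells lam = concat (map (\<lambda>r. map (Pair r) [0..<lam ! r]) [0..<length lam])"

abbreviation cell_row :: "nat list \<Rightarrow> nat \<Rightarrow> nat" where
  "cell_row lam q \<equiv> fst (cells lam ! q)"

abbreviation cell_col :: "nat list \<Rightarrow> nat \<Rightarrow> nat" where
  "cell_col lam q \<equiv> snd (cells lam ! q)"

lemma set_cells: "set (cells lam) = diagram lam"
  by (auto simp: cells_def diagram_def)

lemma length_cells: "length (cells lam) = sum_list lam"
  by (simp add: cells_def length_concat comp_def map_nth)

lemma distinct_cells: "distinct (cells lam)"
  using card_distinct[of "cells lam"] by (simp add: set_cells length_cells card_diagram)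

lemma concat_eq_cells:
  assumes "shape T = lam"
  shows "concat T = map (\<lambda>q. entry T (cells lam ! q)) [0..<sum_list lam]"
proof -
  have len: "length T = length lam" "\<And>r. r < length lam \<Longrightarrow> length (T ! r) = lam ! r"
    using assms by (auto simp: shape_def)
  have "T = map (\<lambda>r. map (entry T) (map (Pair r) [0..<lam ! r])) [0..<length lam]"
  proof (rule nth_equalityI)
    fix r assume "r < length T"
    then show "T ! r = map (\<lambda>r. map (entry T) (map (Pair r) [0..<lam ! r])) [0..<length lam] ! r"
      using len by (auto intro!: nth_equalityI simp: entry_def)
  qed (simp add: len)
  then have "concat T = concat (map (\<lambda>r. map (entry T) (map (Pair r) [0..<lam ! r])) [0..<length lam])"
    by (rule arg_cong)
  also have "\<dots> = map (entry T) (cells lam)"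
    by (simp add: cells_def map_concat comp_def)
  also have "\<dots> = map (\<lambda>q. entry T (cells lam ! q)) [0..<sum_list lam]"
    by (rule nth_equalityI) (simp_all add: length_cells)
  finally show ?thesis .
qed

lemma length_concat_shape: "shape T = lam \<Longrightarrow> length (concat T) = sum_list lam"
  by (simp add: length_concat shape_def)

lemma nth_concat_eq: "shape T = lam \<Longrightarrow> q < sum_list lam \<Longrightarrow> concat T ! q = entry T (cells lam ! q)"
  using arg_cong[OF concat_eq_cells[of T lam], of "\<lambda>l. l ! q"] nth_map[of q "[0..<sum_list lam]" "\<lambda>q. entry T (cells lam ! q)"]
  by (simp del: nth_map)

lemma cell_in: "q < sum_list lam \<Longrightarrow> cells lam ! q \<in> diagram lam"
  using nth_mem[of q "cells lam"] by (simp add: set_cells length_cells)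

lemma concat_tab_C: "concat (tab_C lam) = map (\<lambda>q. Alpha (Suc (cell_row lam q))) [0..<sum_list lam]"
proof -
  have sh: "shape (tab_C lam) = lam" by (simp add: shape_def tab_C_def map_nth comp_def)
  have "entry (tab_C lam) x = Alpha (Suc (fst x))" if "x \<in> diagram lam" for x
    using that by (auto simp: entry_def tab_C_def diagram_def)
  then show ?thesis unfolding concat_eq_cells[OF sh] using cell_in by auto
qed

lemma concat_tab_D: "concat (tab_D lam) = map (\<lambda>q. Beta (Suc (cell_col lam q))) [0..<sum_list lam]"
proof -
  have sh: "shape (tab_D lam) = lam" by (simp add: shape_def tab_D_def comp_def)
  have "entry (tab_D lam) x = Beta (Suc (snd x))" if "x \<in> diagram lam" for x
    using that by (auto simp: entry_def tab_D_def diagram_def)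
  then show ?thesis unfolding concat_eq_cells[OF sh] using cell_in by auto
qed

lemma concat_map_tab_Letter:
  assumes "shape T = lam"
  shows "concat (map_tab Letter T) = map (\<lambda>q. Letter (concat T ! q)) [0..<sum_list lam]"
proof -
  have "concat (map_tab Letter T) = map Letter (concat T)" by (simp add: map_concat)
  also have "\<dots> = map (\<lambda>q. Letter (concat T ! q)) [0..<length (concat T)]"
    by (rule nth_equalityI) simp_all
  finally show ?thesis by (simp only: length_concat_shape[OF assms])
qed

lemma zip_map_same: "zip (map f xs) (map g xs) = map (\<lambda>x. (f x, g x)) xs"
  by (induction xs) simp_all

text \<open>Parts are positive, so there are at most \<open>h\<close> rows; there are at most
  \<open>hd lam\<close> columns. Hence the available alphas and betas suffice for
  \<open>tab_C\<close> and \<open>tab_D\<close>.\<close>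

lemma partition_bounds:
  assumes "partition_of lam h" "(r, c) \<in> diagram lam"
  shows "r < h" "c < hd lam"
proof -
  have pos: "x \<ge> 1" if "x \<in> set lam" for x using assms(1) that by (auto simp: partition_of_def Suc_le_eq)
  have "length lam \<le> sum_list lam"
    using pos by (induction lam) (simp_all, force)
  then show "r < h" using assms by (simp add: diagram_def partition_of_def)
  have r: "r < length lam" "c < lam ! r" using assms(2) by (auto simp: diagram_def)
  have "lam ! r \<le> lam ! 0"
    using assms(1) r sorted_wrt_nth_less[of "(\<ge>)" lam 0 r] by (cases "r = 0") (auto simp: partition_of_def)
  moreover have "hd lam = lam ! 0" using r by (intro hd_conv_nth) auto
  ultimately show "c < hd lam" using r by simp
qed

lemma diagram_down:
  assumes "partition_of lam h" "(r, c) \<in> diagram lam" "r' \<le> r" "c' \<le> c"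
  shows "(r', c') \<in> diagram lam"
  using assms sorted_wrt_nth_less[of "(\<ge>)" lam r' r]
  by (cases "r' = r") (auto simp: diagram_def partition_of_def)

lemma young_cells_positions:
  assumes "partition_of lam h"
  shows "young_cells {..<h} (cell_row lam) (cell_col lam)"
proof
  have h: "h = sum_list lam" using assms by (simp add: partition_of_def)
  show "finite {..<h}" by simp
  show "x = y" if "x \<in> {..<h}" "y \<in> {..<h}" "cell_row lam x = cell_row lam y" "cell_col lam x = cell_col lam y" for x y
    using that nth_eq_iff_index_eq[OF distinct_cells, of x lam y] by (simp add: length_cells h prod_eq_iff)
  show "\<exists>y\<in>{..<h}. cell_row lam y = r \<and> cell_col lam y = c"
    if "x \<in> {..<h}" "r \<le> cell_row lam x" "c \<le> cell_col lam x" for x r c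
  proof -
    have "cells lam ! x \<in> diagram lam" using that(1) by (intro cell_in) (simp add: h)
    then have "(r, c) \<in> diagram lam"
      using diagram_down[OF assms, of "cell_row lam x" "cell_col lam x" r c] that by simp
    then obtain y where "y < length (cells lam)" "cells lam ! y = (r, c)"
      unfolding set_cells[symmetric] in_set_conv_nth by blast
    then show ?thesis by (intro bexI[of _ y]) (simp_all add: length_cells h)
  qed
qed

section \<open>Bitableaux as classes with known action on the vacuum\<close>

context gl_super
begin

lemma Letter_L: "a \<in> {1..n} \<Longrightarrow> Letter a \<in> symb_L n"
  by (simp add: symb_L_def)

lemma virtual_not_Letter: "g \<in> virtual \<Longrightarrow> Letter a \<noteq> g"
  by (auto simp: virtual_def symb_A0_def symb_A1_def)

lemma word_degree_map: "word_degree g (map (\<lambda>q. (f q, k q)) xs) =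
    int (length (filter (\<lambda>q. f q = g) xs)) - int (length (filter (\<lambda>q. k q = g) xs))"
  by (simp add: word_degree_def filter_map comp_def)

lemma filter_Letter: "g \<in> virtual \<Longrightarrow> filter (\<lambda>q. Letter (s q) = g) xs = []"
  by (simp add: filter_empty_conv virtual_not_Letter)

lemma young_capelli_cls:
  assumes lam: "partition_of lam h" "h \<le> m0" "hd lam \<le> m1"
    and S: "shape S = lam" "set (concat S) \<subseteq> {1..n}" and T: "shape T = lam" "set (concat T) \<subseteq> {1..n}"
  shows "\<exists>y\<in>fa L. young_capelli_bitab m0 m1 n S T = cls y \<and> (\<forall>v\<in>vacuum. act n y v =
    cscale (wick_sign True h) (\<Sum>r\<in>line_perms {..<h} (cell_row lam). \<Sum>c\<in>line_perms {..<h} (cell_col lam).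
      cscale (char1 True r) (normal_op n h (Letter \<circ> (!) (concat S)) (Letter \<circ> (!) (concat T) \<circ> c \<circ> r) v)))"
proof -
  have h: "sum_list lam = h" using lam(1) by (simp add: partition_of_def)
  let ?s = "(!) (concat S)" and ?t = "(!) (concat T)"
  let ?w1 = "map (\<lambda>q. (Letter (?s q), Alpha (Suc (cell_row lam q)))) [0..<h]"
  let ?w2 = "map (\<lambda>q. (Alpha (Suc (cell_row lam q)), Beta (Suc (cell_col lam q)))) [0..<h]"
  let ?w3 = "map (\<lambda>q. (Beta (Suc (cell_col lam q)), Letter (?t q))) [0..<h]"
  have lenS: "length (concat S) = h" "length (concat T) = h"
    using length_concat_shape[OF S(1)] length_concat_shape[OF T(1)] h by auto
  have Ls: "Letter (?s q) \<in> symb_L n" "Letter (?t q) \<in> symb_L n" if "q < h" for q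
    using that S(2) T(2) nth_mem[of q "concat S"] nth_mem[of q "concat T"] lenS by (auto intro!: Letter_L)
  have AB: "Alpha (Suc (cell_row lam q)) \<in> symb_A0 m0" "Beta (Suc (cell_col lam q)) \<in> symb_A1 m1" if "q < h" for q
    using partition_bounds[OF lam(1), of "cell_row lam q" "cell_col lam q"] cell_in[of q lam] that lam(2,3) h
    by (auto simp: symb_A0_def symb_A1_def)
  have wG: "set ?w1 \<subseteq> G" "set ?w2 \<subseteq> G" "set ?w3 \<subseteq> G" using Ls AB by (auto simp: gl_basis_def)
  \<comment> \<open>The lower indices of each block of factors are the upper indices of the next
    one.\<close>
  have bal: "balanced (?w1 @ ?w2 @ ?w3)"
    unfolding balanced_def by (simp add: word_degree_append word_degree_map filter_Letter)
  have sub: "set (?w1 @ ?w2 @ ?w3) \<subseteq> G" using wG by simp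
  obtain y where y: "y \<in> fa L" "virt_proj m0 m1 n (cls (word_monom (?w1 @ ?w2 @ ?w3))) = cls y"
    "\<forall>v\<in>vacuum. act n y v = act_word n (?w1 @ ?w2 @ ?w3) v"
    by (rule virt_proj_balanced[OF sub bal])
  have "young_capelli_bitab m0 m1 n S T = virt_proj m0 m1 n (cls (word_monom (?w1 @ ?w2 @ ?w3)))"
    unfolding young_capelli_bitab_def e_bitab_def S(1) concat_tab_C concat_tab_D
      concat_map_tab_Letter[OF S(1)] concat_map_tab_Letter[OF T(1)] zip_map_same h
    using wG by (simp add: cls_mult fa_monom word_monom_mult fa_mult del: map_append)
  moreover have "act_word n (?w1 @ ?w2 @ ?w3) v = cscale (wick_sign True h)
      (\<Sum>r\<in>line_perms {..<h} (cell_row lam). \<Sum>c\<in>line_perms {..<h} (cell_col lam).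
        cscale (char1 True r) (normal_op n h (Letter \<circ> ?s) (Letter \<circ> ?t \<circ> c \<circ> r) v))" if "v \<in> vacuum" for v
    by (rule act_young_word[OF that])
  ultimately show ?thesis using y(1,3) by (intro bexI[of _ y] conjI ballI) (simp_all only: y(2) simp_thms bspec[OF y(3)])
qed

lemma column_capelli_cls:
  assumes m0: "h \<le> m0" and a: "\<And>k. k \<in> {1..h} \<Longrightarrow> a k \<in> {1..n}" and b: "\<And>k. k \<in> {1..h} \<Longrightarrow> b k \<in> {1..n}"
  shows "\<exists>y\<in>fa L. capelli_bitab m0 m1 n (column_tab h a) (column_tab h b) = cls y \<and> (\<forall>v\<in>vacuum. act n y v =
    cscale (wick_sign True h) (normal_op n h (Letter \<circ> (a \<circ> Suc)) (Letter \<circ> (b \<circ> Suc)) v))"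
proof -
  let ?w1 = "map (\<lambda>q. (Letter (a (Suc q)), Alpha (Suc q))) [0..<h]"
  let ?w2 = "map (\<lambda>q. (Alpha (Suc q), Letter (b (Suc q)))) [0..<h]"
  have col: "concat (map_tab Letter (column_tab h a)) = map (\<lambda>q. Letter (a (Suc q))) [0..<h]" for a
  proof -
    have "concat (map_tab Letter (column_tab h a)) = map (\<lambda>k. Letter (a k)) [1..<Suc h]"
      by (simp add: column_tab_def comp_def del: upt_Suc)
    also have "[1..<Suc h] = map Suc [0..<h]" by (simp add: map_Suc_upt)
    finally show ?thesis by (simp add: comp_def)
  qed
  have sh: "shape (column_tab h a) = map (\<lambda>_. 1) [0..<h]"
    by (rule nth_equalityI) (simp_all add: shape_def column_tab_def del: upt_Suc)
  have C: "concat (tab_C (map (\<lambda>_. 1) [0..<h])) = map (\<lambda>q. Alpha (Suc q)) [0..<h]"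
    unfolding tab_C_def by (subst map_cong[OF refl, of _ _ "\<lambda>r. [Alpha (Suc r)]"]) simp_all
  have wG: "set ?w1 \<subseteq> G" "set ?w2 \<subseteq> G"
    using a b m0 by (auto simp: gl_basis_def symb_A0_def intro!: Letter_L)
  have bal: "balanced (?w1 @ ?w2)"
    unfolding balanced_def by (simp add: word_degree_append word_degree_map filter_Letter)
  have sub: "set (?w1 @ ?w2) \<subseteq> G" using wG by simp
  obtain y where y: "y \<in> fa L" "virt_proj m0 m1 n (cls (word_monom (?w1 @ ?w2))) = cls y"
    "\<forall>v\<in>vacuum. act n y v = act_word n (?w1 @ ?w2) v"
    by (rule virt_proj_balanced[OF sub bal])
  have "capelli_bitab m0 m1 n (column_tab h a) (column_tab h b) = virt_proj m0 m1 n (cls (word_monom (?w1 @ ?w2)))"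
    unfolding capelli_bitab_def e_bitab_def sh C col zip_map_same
    using wG by (simp add: cls_mult fa_monom word_monom_mult del: map_append)
  moreover have "act_word n (?w1 @ ?w2) v =
      cscale (wick_sign True h) (normal_op n h (Letter \<circ> (a \<circ> Suc)) (Letter \<circ> (b \<circ> Suc)) v)" if "v \<in> vacuum" for v
    using act_column_word[OF that, of n "a \<circ> Suc" h "b \<circ> Suc"] by (simp add: comp_def)
  ultimately show ?thesis using y by (intro bexI[of _ y]) simp_all
qed

end

section \<open>Young sums\<close>

lemma char1_False [simp]: "char1 False p = 1"
  by (simp add: char1_def)

lemma sum_line_perms_inv:
  "(\<Sum>p\<in>line_perms D line. f (finv p)) = (\<Sum>p\<in>line_perms D line. f p)"
proof (rule sum.reindex_bij_witness[of _ finv finv])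
  fix p assume p: "p \<in> line_perms D line"
  show "finv (finv p) = p" using line_perms_permutes[OF p] by (intro inv_inv_eq) (rule permutes_bij)
  show "finv (finv p) = p" using line_perms_permutes[OF p] by (intro inv_inv_eq) (rule permutes_bij)
qed (auto intro: line_perms_inv)

text \<open>Conjugation by a bijection that matches the lines. It leads from the entries of a
  numbering, counted from 1, to the cell positions, counted from 0.\<close>

lemma sum_line_perms_conj:
  assumes b: "bij_betw f D E" and line: "\<And>q. q \<in> D \<Longrightarrow> line' (f q) = line q"
  shows "(\<Sum>p\<in>line_perms E line'. g p) = (\<Sum>p\<in>line_perms D line. g (map_permutation D f p))"
proof (rule sum.reindex_bij_witness[of _ "map_permutation D f" "map_permutation E (inv_into D f)"])
  have inj: "inj_on f D" and im: "f ` D = E" using b by (auto simp: bij_betw_def)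
  have b': "bij_betw (inv_into D f) E D" using b by (rule bij_betw_inv_into)
  have fi: "f (inv_into D f x) = x" if "x \<in> E" for x using that im by (simp add: f_inv_into_f)
  have inD: "inv_into D f x \<in> D" if "x \<in> E" for x using that im by (metis inv_into_into)
  {
    fix p assume p: "p \<in> line_perms E line'"
    have pE: "p permutes E" using p by (rule line_perms_permutes)
    show eq: "map_permutation D f (map_permutation E (inv_into D f) p) = p"
      by (rule map_permutation_compose_inv[OF b' pE]) (rule fi)
    have perm: "map_permutation E (inv_into D f) p permutes D" by (rule map_permutation_permutes[OF b' pE])
    have "line (map_permutation E (inv_into D f) p q) = line q" if q: "q \<in> D" for q
    proof -
      have fq: "f q \<in> E" using q im by blast
      have "f (map_permutation E (inv_into D f) p q) = p (f q)"
        using map_permutation_apply[OF inj q, of "map_permutation E (inv_into D f) p"] eq by simp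
      moreover have "map_permutation E (inv_into D f) p q \<in> D" using permutes_in_image[OF perm] q by simp
      ultimately have "line (map_permutation E (inv_into D f) p q) = line' (p (f q))" using line by metis
      then show ?thesis using p fq line[OF q] by (simp add: line_perms_def)
    qed
    then show "map_permutation E (inv_into D f) p \<in> line_perms D line" using perm by (simp add: line_perms_def)
    show "g (map_permutation D f (map_permutation E (inv_into D f) p)) = g p" by (simp only: eq)
  }
  {
    fix p assume p: "p \<in> line_perms D line"
    have pD: "p permutes D" using p by (rule line_perms_permutes)
    show "map_permutation E (inv_into D f) (map_permutation D f p) = p"
      using inj by (intro map_permutation_compose_inv[OF b pD]) simp
    have perm: "map_permutation D f p permutes E" by (rule map_permutation_permutes[OF b pD])
    have "line' (map_permutation D f p x) = line' x" if x: "x \<in> E" for x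
    proof -
      let ?q = "inv_into D f x"
      have q: "?q \<in> D" "f ?q = x" using inD fi x by auto
      have "map_permutation D f p x = f (p ?q)" using map_permutation_apply[OF inj q(1), of p] q(2) by simp
      moreover have "p ?q \<in> D" using permutes_in_image[OF pD] q(1) by simp
      ultimately show ?thesis using line p q by (simp add: line_perms_def) (metis line q)
    qed
    then show "map_permutation D f p \<in> line_perms E line'" using perm by (simp add: line_perms_def)
  }
qed

text \<open>What the matrix coefficients of \<open>normal_op\<close> have in common: they see only
  the first \<open>h\<close> letters of either sequence, and permuting the pairs changes nothing
  because the modes of letters commute.\<close>

definition kernel_perm :: "nat \<Rightarrow> ((nat \<Rightarrow> nat) \<Rightarrow> (nat \<Rightarrow> nat) \<Rightarrow> complex) \<Rightarrow> bool" where
  "kernel_perm h N \<longleftrightarrow>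
     (\<forall>a b a' b'. (\<forall>q<h. a q = a' q \<and> b q = b' q) \<longrightarrow> N a b = N a' b') \<and>
     (\<forall>a b p. p permutes {..<h} \<longrightarrow> N (a \<circ> p) (b \<circ> p) = N a b)"

text \<open>Up to \<open>wick_sign True h\<close>, a matrix coefficient of a Young-Capelli bitableau
  with fillings \<open>S\<close> and \<open>T\<close>.\<close>

definition young_sum ::
    "nat \<Rightarrow> nat list \<Rightarrow> ((nat \<Rightarrow> nat) \<Rightarrow> (nat \<Rightarrow> nat) \<Rightarrow> complex) \<Rightarrow> (nat \<Rightarrow> nat) \<Rightarrow> (nat \<Rightarrow> nat) \<Rightarrow> complex" where
  "young_sum h lam N S T =
     (\<Sum>r\<in>line_perms {..<h} (cell_row lam). \<Sum>c\<in>line_perms {..<h} (cell_col lam).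
        char1 True r * N S (T \<circ> c \<circ> r))"

lemma kernel_perm_cong:
  "kernel_perm h N \<Longrightarrow> (\<And>q. q < h \<Longrightarrow> a q = a' q) \<Longrightarrow> (\<And>q. q < h \<Longrightarrow> b q = b' q) \<Longrightarrow> N a b = N a' b'"
  unfolding kernel_perm_def by blast

lemma kernel_perm_permute: "kernel_perm h N \<Longrightarrow> p permutes {..<h} \<Longrightarrow> N (a \<circ> p) (b \<circ> p) = N a b"
  unfolding kernel_perm_def by blast

text \<open>Any two ways of listing the \<open>h\<close> pairs differ by a permutation of the pairs,
  which \<open>N\<close> does not notice.\<close>

lemma kernel_perm_bij:
  assumes N: "kernel_perm h N" and f: "bij_betw f {..<h} {1..h}"
  shows "N (a \<circ> f) (b \<circ> f) = N (a \<circ> Suc) (b \<circ> Suc)"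
proof -
  define p where "p = (\<lambda>q. if q < h then f q - 1 else q)"
  have f1: "f q \<in> {1..h}" if "q < h" for q using f that by (auto simp: bij_betw_def)
  have inj: "inj_on p {..<h}"
  proof (rule inj_onI)
    fix x y assume xy: "x \<in> {..<h}" "y \<in> {..<h}" "p x = p y"
    then have "f x = f y" using f1[of x] f1[of y] by (auto simp: p_def)
    then show "x = y" using f xy by (auto simp: bij_betw_def inj_on_def)
  qed
  moreover have "p ` {..<h} \<subseteq> {..<h}"
  proof (rule image_subsetI)
    fix x assume "x \<in> {..<h}"
    then show "p x \<in> {..<h}" using f1[of x] by (auto simp: p_def)
  qed
  ultimately have "bij_betw p {..<h} {..<h}" by (simp add: bij_betw_def endo_inj_surj)
  then have p: "p permutes {..<h}" by (rule bij_imp_permutes) (simp add: p_def)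
  have Sp: "Suc (p q) = f q" if "q < h" for q using that f1[OF that] by (simp add: p_def)
  have "N (a \<circ> f) (b \<circ> f) = N ((a \<circ> Suc) \<circ> p) ((b \<circ> Suc) \<circ> p)"
    by (rule kernel_perm_cong[OF N]) (simp_all add: Sp)
  then show ?thesis by (simp only: kernel_perm_permute[OF N p])
qed

text \<open>Next to \<open>T\<close> stands the unsigned column group, so for the right tableau the
  columns take the role of the rows.\<close>

lemma young_sum_right: "young_sum h lam N S T = symmetrized {..<h} (cell_col lam) (cell_row lam) False (N S) T"
  unfolding young_sum_def symmetrized_def by (subst sum.swap) simp

text \<open>Permuting all pairs moves both groups from \<open>T\<close> to \<open>S\<close>, as
  inverses and in reversed order: now the signed row group stands next to the filling.\<close>

lemma young_sum_left:
  assumes N: "kernel_perm h N"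
  shows "young_sum h lam N S T = symmetrized {..<h} (cell_row lam) (cell_col lam) True (\<lambda>a. N a T) S"
proof -
  let ?R = "line_perms {..<h} (cell_row lam)" and ?C = "line_perms {..<h} (cell_col lam)"
  have move: "N S (T \<circ> c \<circ> r) = N (S \<circ> finv r \<circ> finv c) T" if "r \<in> ?R" "c \<in> ?C" for r c
  proof -
    have r: "r permutes {..<h}" and c: "c permutes {..<h}" using that by (auto intro: line_perms_permutes)
    have "N (S \<circ> finv r \<circ> finv c) T = N ((S \<circ> finv r \<circ> finv c) \<circ> (c \<circ> r)) (T \<circ> (c \<circ> r))"
      using kernel_perm_permute[OF N permutes_compose[OF r c]] by metis
    also have "(S \<circ> finv r \<circ> finv c) \<circ> (c \<circ> r) = S"
      by (simp add: fun_eq_iff permutes_inverses[OF r] permutes_inverses[OF c])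
    finally show ?thesis by (simp only: comp_assoc)
  qed
  have "young_sum h lam N S T = (\<Sum>r\<in>?R. \<Sum>c\<in>?C. char1 True (finv r) * N (S \<circ> finv r \<circ> finv c) T)"
    unfolding young_sum_def
    by (intro sum.cong refl) (simp add: move char1_inv[OF finite_lessThan line_perms_permutes])
  also have "\<dots> = (\<Sum>r\<in>?R. \<Sum>c\<in>?C. char1 True r * N (S \<circ> r \<circ> finv c) T)"
    by (rule sum_line_perms_inv)
  also have "\<dots> = (\<Sum>r\<in>?R. \<Sum>c\<in>?C. char1 True r * N (S \<circ> r \<circ> c) T)"
    by (intro sum.cong refl sum_line_perms_inv)
  also have "\<dots> = symmetrized {..<h} (cell_row lam) (cell_col lam) True (\<lambda>a. N a T) S"
    by (simp add: symmetrized_def)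
  finally show ?thesis .
qed

definition std_fillings :: "nat \<Rightarrow> nat \<Rightarrow> nat list \<Rightarrow> (nat \<Rightarrow> nat) set" where
  "std_fillings n h lam = {S \<in> PiE {..<h} (\<lambda>_. {1..n}). std_filling {..<h} (cell_row lam) (cell_col lam) True S}"

text \<open>The relations for one tableau leave the other untouched, so the two are straightened one
  after the other and the coefficients multiply.\<close>

lemma young_sum_straighten:
  assumes lam: "partition_of lam h"
    and S: "S \<in> PiE {..<h} (\<lambda>_. {1..n})" and T: "T \<in> PiE {..<h} (\<lambda>_. {1..n})"
  shows "\<exists>\<rho>. \<forall>N. kernel_perm h N \<longrightarrow> young_sum h lam N S T =
    (\<Sum>S'\<in>std_fillings n h lam. \<Sum>T'\<in>std_fillings n h lam. \<rho> S' T' * young_sum h lam N S' T')"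
proof -
  interpret Y: young_cells "{..<h}" "cell_row lam" "cell_col lam" by (rule young_cells_positions[OF lam])
  interpret Y': young_cells "{..<h}" "cell_col lam" "cell_row lam" by (rule Y.transposed)
  have tr: "std_filling {..<h} (cell_col lam) (cell_row lam) False S =
      std_filling {..<h} (cell_row lam) (cell_col lam) True S" for S
    by (auto simp: std_filling_def)
  obtain \<alpha> where \<alpha>: "\<And>N. symmetrized {..<h} (cell_row lam) (cell_col lam) True N S =
      (\<Sum>S'\<in>std_fillings n h lam. \<alpha> S' * symmetrized {..<h} (cell_row lam) (cell_col lam) True N S')"
    using Y.straightening[OF S, of True] unfolding Y.reducible_def std_fillings_def by blast
  obtain \<beta> where \<beta>: "\<And>N. symmetrized {..<h} (cell_col lam) (cell_row lam) False N T =
      (\<Sum>T'\<in>std_fillings n h lam. \<beta> T' * symmetrized {..<h} (cell_col lam) (cell_row lam) False N T')"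
    using Y'.straightening[OF T, of False] unfolding Y'.reducible_def std_fillings_def tr by blast
  have "young_sum h lam N S T =
    (\<Sum>S'\<in>std_fillings n h lam. \<Sum>T'\<in>std_fillings n h lam. \<alpha> S' * \<beta> T' * young_sum h lam N S' T')"
    if N: "kernel_perm h N" for N
  proof -
    have "young_sum h lam N S T = (\<Sum>S'\<in>std_fillings n h lam. \<alpha> S' * young_sum h lam N S' T)"
      unfolding young_sum_left[OF N] by (rule \<alpha>)
    also have "\<dots> = (\<Sum>S'\<in>std_fillings n h lam. \<alpha> S' *
        (\<Sum>T'\<in>std_fillings n h lam. \<beta> T' * young_sum h lam N S' T'))"
      unfolding young_sum_right by (intro sum.cong refl arg_cong2[of _ _ _ _ "(*)"] \<beta>)
    finally show ?thesis by (simp add: sum_distrib_left mult.assoc)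
  qed
  then show ?thesis by (intro exI[of _ "\<lambda>S' T'. \<alpha> S' * \<beta> T'"]) blast
qed

section \<open>Conjugate partitions\<close>

lemma nth_filter_decreasing:
  assumes "sorted_wrt (\<ge>) (lam :: nat list)"
  shows "r < length (filter (\<lambda>x. c < x) lam) \<longleftrightarrow> r < length lam \<and> c < lam ! r"
  using assms
proof (induction lam arbitrary: r)
  case (Cons x lam)
  show ?case
  proof (cases "c < x")
    case True
    then show ?thesis using Cons by (cases r) auto
  next
    case False
    then have none: "\<not> c < y" if "y \<in> set lam" for y using Cons.prems that by (auto dest: leD)
    then have "filter (\<lambda>x. c < x) (x # lam) = []" using False by (auto simp: filter_empty_conv)
    moreover have "\<not> c < (x # lam) ! r" if "r < length (x # lam)"
      using nth_mem[OF that] none False by auto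
    ultimately show ?thesis by auto
  qed
qed simp

lemma diagram_conjugate:
  assumes "partition_of lam h"
  shows "diagram (conjugate_partition lam) = prod.swap ` diagram lam"
proof -
  have srt: "sorted_wrt (\<ge>) lam" using assms by (simp add: partition_of_def)
  have "(c, r) \<in> diagram (conjugate_partition lam) \<longleftrightarrow> (r, c) \<in> diagram lam" for c r
  proof -
    have "(c, r) \<in> diagram (conjugate_partition lam) \<longleftrightarrow>
        lam \<noteq> [] \<and> c < hd lam \<and> r < length (filter (\<lambda>x. c < x) lam)"
      by (auto simp: diagram_def conjugate_partition_def)
    also have "\<dots> \<longleftrightarrow> (r, c) \<in> diagram lam"
      using nth_filter_decreasing[OF srt, of r c] partition_bounds(2)[OF assms, of r c]
      by (auto simp: diagram_def)
    finally show ?thesis .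
  qed
  then show ?thesis by (force simp: image_iff)
qed

lemma partition_of_conjugate:
  assumes "partition_of lam h"
  shows "partition_of (conjugate_partition lam) h"
  unfolding partition_of_def
proof (intro conjI ballI)
  show "sorted_wrt (\<ge>) (conjugate_partition lam)"
    unfolding sorted_wrt_iff_nth_less
  proof (intro allI impI)
    fix c c' assume c: "c < c'" "c' < length (conjugate_partition lam)"
    have "length (filter (\<lambda>x. c' < x) lam) \<le> length (filter (\<lambda>x. c < x) lam)"
      using c(1) by (induction lam) auto
    then show "conjugate_partition lam ! c \<ge> conjugate_partition lam ! c'"
      using c by (simp add: conjugate_partition_def split: if_splits)
  qed
  show "x > 0" if "x \<in> set (conjugate_partition lam)" for x
    using that by (cases lam) (auto simp: conjugate_partition_def)
  have "sum_list (conjugate_partition lam) = card (prod.swap ` diagram lam)"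
    by (simp add: card_diagram flip: diagram_conjugate[OF assms])
  also have "\<dots> = card (diagram lam)" by (rule card_image) (rule inj_on_subset[OF inj_swap subset_UNIV])
  finally show "sum_list (conjugate_partition lam) = h"
    using assms by (simp add: card_diagram partition_of_def)
qed

text \<open>Replacing \<open>t\<close> by its image under the column permutation \<open>p\<close>
  keeps the column group and conjugates the row group by \<open>p\<close>, which turns
  \<open>s \<circ> p\<close> into \<open>p \<circ> s\<close>. The second order fits the immanant,
  where \<open>s\<close> is composed to the right of \<open>i\<close>.\<close>

lemma character_reindexed:
  assumes s: "s permutes {1..h}"
  shows "(\<Sum>t\<in>{t. numbering h mu t}. \<Sum>p\<in>line_perms {1..h} (col_of mu t).
       if s \<circ> p \<in> line_perms {1..h} (row_of mu t) then of_int (sign p) else (0::complex)) =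
    (\<Sum>t\<in>{t. numbering h mu t}. \<Sum>p\<in>line_perms {1..h} (col_of mu t).
       if p \<circ> s \<in> line_perms {1..h} (row_of mu t) then of_int (sign p) else 0)"
proof -
  let ?I = "{1..h}" and ?Num = "{t. numbering h mu t}"
  let ?C = "\<lambda>t. line_perms ?I (col_of mu t)" and ?R = "\<lambda>t. line_perms ?I (row_of mu t)"
  have closed: "p \<in> ?C (map_tab q t) \<and> numbering h mu (map_tab q t)"
    if t: "numbering h mu t" and p: "p \<in> ?C t" and q: "q \<in> ?C t" for t p q
  proof -
    interpret t: numbered_tableau h mu t using t by unfold_locales
    have qI: "q permutes ?I" and pI: "p permutes ?I" using p q by (auto intro: line_perms_permutes)
    have col: "col_of mu (map_tab q t) x = col_of mu t x" if x: "x \<in> ?I" for x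
    proof -
      have y: "finv q x \<in> ?I" using permutes_in_image[OF permutes_inv[OF qI]] x by simp
      have "col_of mu (map_tab q t) (q (finv q x)) = col_of mu t (finv q x)" by (rule t.col_of_map[OF qI y])
      also have "\<dots> = col_of mu t (q (finv q x))" using q y by (simp add: line_perms_def)
      finally show ?thesis by (simp add: permutes_inverses(1)[OF qI])
    qed
    have "p \<in> ?C (map_tab q t)"
      using p permutes_in_image[OF pI] by (simp add: line_perms_def col)
    then show ?thesis using t.permuted[OF qI] by (simp add: numbered_tableau_def)
  qed
  have fin: "finite (?C t)" for t by (simp add: finite_line_perms)
  have inv_tab: "map_tab p (map_tab (finv p) t) = t" "map_tab (finv p) (map_tab p t) = t" if "p permutes ?I" for p and t
    by (simp_all add: comp_def permutes_inverses[OF that])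
  have "(\<Sum>(t, p)\<in>Sigma ?Num ?C. if s \<circ> p \<in> ?R t then of_int (sign p) else (0::complex)) =
      (\<Sum>(t, p)\<in>Sigma ?Num ?C. if p \<circ> s \<in> ?R t then of_int (sign p) else 0)"
  proof (rule sum.reindex_bij_witness[of _ "\<lambda>(t, p). (map_tab (finv p) t, p)" "\<lambda>(t, p). (map_tab p t, p)"])
    fix x assume "x \<in> Sigma ?Num ?C"
    then obtain t p where x: "x = (t, p)" and t: "numbering h mu t" and p: "p \<in> ?C t" by auto
    interpret t: numbered_tableau h mu t using t by unfold_locales
    have pI: "p permutes ?I" using p by (rule line_perms_permutes)
    have pin: "p a \<in> ?I \<longleftrightarrow> a \<in> ?I" for a by (rule permutes_in_image[OF pI])
    show "(case case x of (t, p) \<Rightarrow> (map_tab p t, p) of (t, p) \<Rightarrow> (map_tab (finv p) t, p)) = x"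
      using inv_tab[OF pI] by (simp add: x)
    show "(case case x of (t, p) \<Rightarrow> (map_tab (finv p) t, p) of (t, p) \<Rightarrow> (map_tab p t, p)) = x"
      using inv_tab[OF pI] by (simp add: x)
    show "(case x of (t, p) \<Rightarrow> (map_tab p t, p)) \<in> Sigma ?Num ?C"
      using closed[OF t p p] by (simp add: x)
    show "(case x of (t, p) \<Rightarrow> (map_tab (finv p) t, p)) \<in> Sigma ?Num ?C"
      using closed[OF t p line_perms_inv[OF p]] by (simp add: x)
    have row: "row_of mu (map_tab p t) (p a) = row_of mu t a" if "a \<in> ?I" for a
      by (rule t.row_of_map[OF pI that])
    have sI: "s a \<in> ?I \<longleftrightarrow> a \<in> ?I" for a by (rule permutes_in_image[OF s])
    have "p \<circ> s \<in> ?R (map_tab p t) \<longleftrightarrow> s \<circ> p \<in> ?R t"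
    proof -
      have all: "(\<forall>a\<in>?I. P a) \<longleftrightarrow> (\<forall>a\<in>?I. P (p a))" for P
      proof -
        have "(\<forall>a\<in>p ` ?I. P a) \<longleftrightarrow> (\<forall>a\<in>?I. P (p a))" by blast
        then show ?thesis unfolding permutes_image[OF pI] .
      qed
      have "p \<circ> s \<in> ?R (map_tab p t) \<longleftrightarrow>
          (\<forall>a\<in>?I. row_of mu (map_tab p t) (p (s a)) = row_of mu (map_tab p t) a)"
        using permutes_compose[OF s pI] by (simp add: line_perms_def)
      also have "\<dots> \<longleftrightarrow> (\<forall>a\<in>?I. row_of mu (map_tab p t) (p (s (p a))) = row_of mu (map_tab p t) (p a))"
        by (rule all)
      also have "\<dots> \<longleftrightarrow> (\<forall>a\<in>?I. row_of mu t (s (p a)) = row_of mu t a)"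
        by (intro ball_cong refl) (simp only: row sI pin)
      also have "\<dots> \<longleftrightarrow> s \<circ> p \<in> ?R t"
        using permutes_compose[OF pI s] by (simp add: line_perms_def)
      finally show ?thesis .
    qed
    then show "(case case x of (t, p) \<Rightarrow> (map_tab p t, p) of (t, p) \<Rightarrow> if p \<circ> s \<in> ?R t then of_int (sign p) else (0::complex)) =
        (case x of (t, p) \<Rightarrow> if s \<circ> p \<in> ?R t then of_int (sign p) else 0)"
      by (simp add: x)
  qed
  moreover have "(\<Sum>t\<in>?Num. \<Sum>p\<in>?C t. g t p) = (\<Sum>(t, p)\<in>Sigma ?Num ?C. g t p)" for g :: "_ \<Rightarrow> _ \<Rightarrow> complex"
    by (rule sum.Sigma[OF finite_numberings]) (intro ballI fin)
  ultimately show ?thesis by (simp only:)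
qed

text \<open>A numbering \<open>t\<close> of the conjugate diagram, read along the cells of
  \<open>lam\<close>, is the arrangement \<open>f\<close>. Rows of \<open>t\<close> are columns of
  \<open>lam\<close>, so the alternating column group of \<open>t\<close> becomes the alternating
  row group of \<open>lam\<close>, and one numbering contributes one Young sum.\<close>

lemma young_sum_numbering:
  assumes lam: "partition_of lam h" and t: "numbering h (conjugate_partition lam) t" and N: "kernel_perm h N"
  defines "f \<equiv> \<lambda>q. entry t (prod.swap (cells lam ! q))" and "mu \<equiv> conjugate_partition lam"
  shows "(\<Sum>p\<in>line_perms {1..h} (col_of mu t). \<Sum>s\<in>{s. s permutes {1..h}}.
      (if p \<circ> s \<in> line_perms {1..h} (row_of mu t) then of_int (sign p) else 0) * N (i \<circ> s \<circ> Suc) (j \<circ> Suc)) =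
    young_sum h lam N (i \<circ> f) (j \<circ> f)"
    and "bij_betw f {..<h} {1..h}"
proof -
  interpret t: numbered_tableau h mu t using t unfolding mu_def by unfold_locales
  let ?I = "{1..h}" and ?D = "{..<h}"
  let ?C = "line_perms ?I (col_of mu t)" and ?R = "line_perms ?I (row_of mu t)"
  have h: "sum_list lam = h" using lam by (simp add: partition_of_def)
  have "bij_betw ((!) (cells lam)) {..<length (cells lam)} (set (cells lam))"
    by (rule bij_betw_nth[OF distinct_cells]) simp_all
  then have b1: "bij_betw ((!) (cells lam)) ?D (diagram lam)" by (simp add: length_cells set_cells h)
  have b2: "bij_betw prod.swap (diagram lam) (diagram mu)"
    unfolding mu_def diagram_conjugate[OF lam] bij_betw_def by (simp add: inj_on_subset[OF inj_swap subset_UNIV])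
  show bij: "bij_betw f ?D ?I"
    using bij_betw_trans[OF b1 bij_betw_trans[OF b2 t.entry_bij]] by (simp add: f_def comp_def)
  have in_mu: "prod.swap (cells lam ! q) \<in> diagram mu" if "q \<in> ?D" for q
    using cell_in[of q lam] that by (simp add: h mu_def diagram_conjugate[OF lam])
  have row: "row_of mu t (f q) = cell_col lam q" and col: "col_of mu t (f q) = cell_row lam q" if "q \<in> ?D" for q
    using t.row_of_entry[OF in_mu[OF that]] t.col_of_entry[OF in_mu[OF that]] by (simp_all add: f_def)
  have inj: "inj_on f ?D" using bij by (simp add: bij_betw_def)
  let ?N = "\<lambda>a b. N (a \<circ> Suc) (b \<circ> Suc)"
  have bS: "bij_betw Suc ?D ?I"
    by (rule bij_betw_byWitness[of _ "\<lambda>x. x - 1"]) auto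
  have Nperm: "?N (a \<circ> p) (b \<circ> p) = ?N a b" if "p permutes ?I" for a b p
  proof -
    have "bij_betw (p \<circ> Suc) ?D ?I" by (rule bij_betw_trans[OF bS permutes_imp_bij[OF that]])
    from kernel_perm_bij[OF N this, of a b] show ?thesis by (simp only: comp_assoc)
  qed
  \<comment> \<open>Substitute \<open>s = finv p \<circ> r\<close> with \<open>r\<close> in the row
    group, then permute all pairs by \<open>finv r\<close> and by \<open>p\<close>: both
    permutations pass to the lower sequence.\<close>
  have inner: "(\<Sum>s\<in>{s. s permutes ?I}. (if p \<circ> s \<in> ?R then of_int (sign p) else 0) * ?N (i \<circ> s) j) =
      (\<Sum>r\<in>?R. of_int (sign p) * ?N i (j \<circ> r \<circ> p))" if p: "p \<in> ?C" for p
  proof -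
    have pI: "p permutes ?I" using p by (rule line_perms_permutes)
    have "(\<Sum>s\<in>{s. s permutes ?I}. (if p \<circ> s \<in> ?R then of_int (sign p) else 0) * ?N (i \<circ> s) j) =
        (\<Sum>s\<in>{s\<in>{s. s permutes ?I}. p \<circ> s \<in> ?R}. of_int (sign p) * ?N (i \<circ> s) j)"
      by (subst sum.inter_filter) (auto simp: finite_permutations intro!: sum.cong)
    also have "\<dots> = (\<Sum>r\<in>?R. of_int (sign p) * ?N (i \<circ> (finv p \<circ> r)) j)"
    proof (rule sum.reindex_bij_witness[of _ "\<lambda>r. finv p \<circ> r" "\<lambda>s. p \<circ> s"])
      have 1: "finv p \<circ> (p \<circ> s) = s" "p \<circ> (finv p \<circ> s) = s" for s
        by (simp_all add: fun_eq_iff permutes_inverses[OF pI])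
      show "finv p \<circ> (p \<circ> s) = s" "p \<circ> (finv p \<circ> s) = s" for s by (rule 1)+
      show "finv p \<circ> r \<in> {s\<in>{s. s permutes ?I}. p \<circ> s \<in> ?R}" if "r \<in> ?R" for r
        using permutes_compose[OF line_perms_permutes[OF that] permutes_inv[OF pI]] that by (simp add: 1)
      show "of_int (sign p) * ?N (i \<circ> (finv p \<circ> (p \<circ> s))) j = of_int (sign p) * ?N (i \<circ> s) j" for s
        by (simp only: 1)
    qed auto
    also have "\<dots> = (\<Sum>r\<in>?R. of_int (sign p) * ?N i (j \<circ> finv r \<circ> p))"
    proof (rule sum.cong[OF refl])
      fix r assume "r \<in> ?R"
      then have rI: "r permutes ?I" by (rule line_perms_permutes)
      have "?N (i \<circ> (finv p \<circ> r)) j = ?N ((i \<circ> finv p) \<circ> r) ((j \<circ> finv r) \<circ> r)"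
        by (simp only: comp_assoc permutes_inv_o(2)[OF rI] comp_id)
      also have "\<dots> = ?N (i \<circ> finv p) (j \<circ> finv r)" by (rule Nperm[OF rI])
      also have "\<dots> = ?N ((i \<circ> finv p) \<circ> p) ((j \<circ> finv r) \<circ> p)" by (rule Nperm[OF pI, symmetric])
      also have "(i \<circ> finv p) \<circ> p = i" by (simp only: comp_assoc permutes_inv_o(2)[OF pI] comp_id)
      finally have e: "?N (i \<circ> (finv p \<circ> r)) j = ?N i (j \<circ> finv r \<circ> p)" .
      show "of_int (sign p) * ?N (i \<circ> (finv p \<circ> r)) j = of_int (sign p) * ?N i (j \<circ> finv r \<circ> p)"
        by (simp only: e)
    qed
    also have "\<dots> = (\<Sum>r\<in>?R. of_int (sign p) * ?N i (j \<circ> r \<circ> p))"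
      by (rule sum_line_perms_inv)
    finally show ?thesis .
  qed
  let ?m = "map_permutation ?D f"
  have "(\<Sum>p\<in>?C. \<Sum>s\<in>{s. s permutes ?I}. (if p \<circ> s \<in> ?R then of_int (sign p) else 0) * ?N (i \<circ> s) j) =
      (\<Sum>p\<in>?C. \<Sum>r\<in>?R. of_int (sign p) * ?N i (j \<circ> r \<circ> p))"
    by (intro sum.cong refl inner)
  also have "\<dots> = (\<Sum>p\<in>line_perms ?D (cell_row lam). \<Sum>r\<in>?R. of_int (sign (?m p)) * ?N i (j \<circ> r \<circ> ?m p))"
    by (rule sum_line_perms_conj[where line = "cell_row lam" and line' = "col_of mu t" and f = f, OF bij col])
  also have "\<dots> = (\<Sum>p\<in>line_perms ?D (cell_row lam). \<Sum>r\<in>line_perms ?D (cell_col lam).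
      of_int (sign (?m p)) * ?N i (j \<circ> ?m r \<circ> ?m p))"
    by (intro sum.cong refl sum_line_perms_conj[where line = "cell_col lam" and line' = "row_of mu t" and f = f, OF bij row])
  also have "\<dots> = (\<Sum>p\<in>line_perms ?D (cell_row lam). \<Sum>r\<in>line_perms ?D (cell_col lam).
      char1 True p * N (i \<circ> f) (j \<circ> f \<circ> r \<circ> p))"
  proof (intro sum.cong refl)
    fix p r assume "p \<in> line_perms ?D (cell_row lam)" "r \<in> line_perms ?D (cell_col lam)"
    then have p: "p permutes ?D" and r: "r permutes ?D" by (auto intro: line_perms_permutes)
    have sgn: "sign (?m p) = sign p" using inj p by (intro sign_map_permutation) auto
    have "?N i (j \<circ> ?m r \<circ> ?m p) = N (i \<circ> f) ((j \<circ> ?m r \<circ> ?m p) \<circ> f)"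
      by (rule kernel_perm_bij[OF N bij, symmetric])
    also have "\<dots> = N (i \<circ> f) (j \<circ> f \<circ> r \<circ> p)"
    proof (rule kernel_perm_cong[OF N])
      fix q assume q: "q < h"
      have pq: "p q \<in> ?D" using permutes_in_image[OF p] q by simp
      show "(j \<circ> ?m r \<circ> ?m p \<circ> f) q = (j \<circ> f \<circ> r \<circ> p) q"
        using map_permutation_apply[OF inj, of q p] map_permutation_apply[OF inj pq, of r] q by simp
    qed simp
    finally show "of_int (sign (?m p)) * ?N i (j \<circ> ?m r \<circ> ?m p) = char1 True p * N (i \<circ> f) (j \<circ> f \<circ> r \<circ> p)"
      by (simp add: sgn char1_def)
  qed
  also have "\<dots> = young_sum h lam N (i \<circ> f) (j \<circ> f)" by (simp only: young_sum_def)
  finally show "(\<Sum>p\<in>?C. \<Sum>s\<in>{s. s permutes ?I}.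
      (if p \<circ> s \<in> ?R then of_int (sign p) else 0) * N (i \<circ> s \<circ> Suc) (j \<circ> Suc)) =
    young_sum h lam N (i \<circ> f) (j \<circ> f)" by (simp only: comp_assoc)
qed

text \<open>Dividing the character formula by \<open>d\<close> makes the immanant a combination of
  Young sums, one for each numbering, with fillings that need not be standard; each of these is then
  straightened with coefficients independent of \<open>N\<close>.\<close>

lemma immanant_straighten:
  assumes lam: "partition_of lam h"
    and i: "i \<in> {1..h} \<rightarrow> {1..n}" and j: "j \<in> {1..h} \<rightarrow> {1..n}"
  shows "\<exists>\<rho>. \<forall>N. kernel_perm h N \<longrightarrow>
    (\<Sum>s\<in>{s. s permutes {1..h}}. irr_character h lam s * N (i \<circ> s \<circ> Suc) (j \<circ> Suc)) =
    (\<Sum>S\<in>std_fillings n h lam. \<Sum>T\<in>std_fillings n h lam. \<rho> S T * young_sum h lam N S T)"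
proof -
  let ?mu = "conjugate_partition lam" and ?P = "{s. s permutes {1..h}}"
  let ?Num = "{t. numbering h ?mu t}" and ?Std = "std_fillings n h lam"
  define f where "f t = (\<lambda>q. entry t (prod.swap (cells lam ! q)))" for t :: "nat list list"
  \<comment> \<open>Restricted to the \<open>h\<close> positions because straightening is stated for
    extensional fillings.\<close>
  define fill where "fill k t = restrict (k \<circ> f t) {..<h}" for k :: "nat \<Rightarrow> nat" and t
  obtain d where d: "d \<noteq> 0" "\<And>s. s permutes {1..h} \<Longrightarrow> d * specht_character h ?mu s =
    (\<Sum>t\<in>?Num. \<Sum>p\<in>line_perms {1..h} (col_of ?mu t).
       if s \<circ> p \<in> line_perms {1..h} (row_of ?mu t) then of_int (sign p) else 0)"
    by (rule specht_character_formula[OF partition_of_conjugate[OF lam]]) blast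
  have fill: "fill k t \<in> PiE {..<h} (\<lambda>_. {1..n})" if t: "t \<in> ?Num" and k: "k \<in> {1..h} \<rightarrow> {1..n}" for k t
  proof -
    have "bij_betw (f t) {..<h} {1..h}"
      unfolding f_def using young_sum_numbering(2)[OF lam, of t "\<lambda>_ _. 0"] t by (simp add: kernel_perm_def)
    then have "f t q \<in> {1..h}" if "q \<in> {..<h}" for q using that by (auto simp: bij_betw_def)
    then show ?thesis using k by (auto simp: fill_def)
  qed
  have "\<forall>t\<in>?Num. \<exists>\<rho>. \<forall>N. kernel_perm h N \<longrightarrow> young_sum h lam N (fill i t) (fill j t) =
    (\<Sum>S\<in>?Std. \<Sum>T\<in>?Std. \<rho> S T * young_sum h lam N S T)"
    by (intro ballI young_sum_straighten[OF lam] fill i j)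
  from bchoice[OF this] obtain \<rho> where \<rho>: "\<And>t N. t \<in> ?Num \<Longrightarrow> kernel_perm h N \<Longrightarrow>
      young_sum h lam N (fill i t) (fill j t) = (\<Sum>S\<in>?Std. \<Sum>T\<in>?Std. \<rho> t S T * young_sum h lam N S T)"
    by blast
  have "(\<Sum>s\<in>?P. irr_character h lam s * N (i \<circ> s \<circ> Suc) (j \<circ> Suc)) =
      (\<Sum>S\<in>?Std. \<Sum>T\<in>?Std. (\<Sum>t\<in>?Num. \<rho> t S T / d) * young_sum h lam N S T)" if N: "kernel_perm h N" for N
  proof -
    have "d * (\<Sum>s\<in>?P. irr_character h lam s * N (i \<circ> s \<circ> Suc) (j \<circ> Suc)) =
        (\<Sum>s\<in>?P. (\<Sum>t\<in>?Num. \<Sum>p\<in>line_perms {1..h} (col_of ?mu t).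
          if p \<circ> s \<in> line_perms {1..h} (row_of ?mu t) then of_int (sign p) else 0) * N (i \<circ> s \<circ> Suc) (j \<circ> Suc))"
      unfolding sum_distrib_left
    proof (rule sum.cong[OF refl])
      fix s assume "s \<in> ?P"
      then have s: "s permutes {1..h}" by simp
      show "d * (irr_character h lam s * N (i \<circ> s \<circ> Suc) (j \<circ> Suc)) =
        (\<Sum>t\<in>?Num. \<Sum>p\<in>line_perms {1..h} (col_of ?mu t).
          if p \<circ> s \<in> line_perms {1..h} (row_of ?mu t) then of_int (sign p) else 0) * N (i \<circ> s \<circ> Suc) (j \<circ> Suc)"
        unfolding mult.assoc[symmetric] irr_character_def d(2)[OF s] character_reindexed[OF s] ..
    qed
    also have "\<dots> = (\<Sum>t\<in>?Num. \<Sum>p\<in>line_perms {1..h} (col_of ?mu t). \<Sum>s\<in>?P.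
          (if p \<circ> s \<in> line_perms {1..h} (row_of ?mu t) then of_int (sign p) else 0) * N (i \<circ> s \<circ> Suc) (j \<circ> Suc))"
      unfolding sum_distrib_right
      by (subst sum.swap, rule sum.cong[OF refl], rule sum.swap)
    also have "\<dots> = (\<Sum>t\<in>?Num. young_sum h lam N (i \<circ> f t) (j \<circ> f t))"
      unfolding f_def by (intro sum.cong refl young_sum_numbering(1)[OF lam _ N]) simp
    also have "\<dots> = (\<Sum>t\<in>?Num. young_sum h lam N (fill i t) (fill j t))"
    proof (rule sum.cong[OF refl])
      fix t
      have "N (i \<circ> f t) (j \<circ> f t \<circ> c \<circ> r) = N (fill i t) (fill j t \<circ> c \<circ> r)"
        if "r \<in> line_perms {..<h} (cell_row lam)" "c \<in> line_perms {..<h} (cell_col lam)" for r c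
      proof (rule kernel_perm_cong[OF N])
        fix q assume q: "q < h"
        show "(i \<circ> f t) q = fill i t q" using q by (simp add: fill_def)
        have "c (r q) < h"
          using permutes_in_image[OF line_perms_permutes[OF that(1)], of q]
            permutes_in_image[OF line_perms_permutes[OF that(2)], of "r q"] q by simp
        then show "(j \<circ> f t \<circ> c \<circ> r) q = (fill j t \<circ> c \<circ> r) q" by (simp add: fill_def)
      qed
      then show "young_sum h lam N (i \<circ> f t) (j \<circ> f t) = young_sum h lam N (fill i t) (fill j t)"
        unfolding young_sum_def by (intro sum.cong refl) (simp only:)
    qed
    also have "\<dots> = (\<Sum>t\<in>?Num. \<Sum>S\<in>?Std. \<Sum>T\<in>?Std. \<rho> t S T * young_sum h lam N S T)"
      by (intro sum.cong refl \<rho> N)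
    also have "\<dots> = (\<Sum>S\<in>?Std. \<Sum>T\<in>?Std. \<Sum>t\<in>?Num. \<rho> t S T * young_sum h lam N S T)"
      by (subst sum.swap, rule sum.cong[OF refl], rule sum.swap)
    also have "\<dots> = d * (\<Sum>S\<in>?Std. \<Sum>T\<in>?Std. (\<Sum>t\<in>?Num. \<rho> t S T / d) * young_sum h lam N S T)"
      using d(1) by (simp add: sum_distrib_left sum_distrib_right)
    finally show ?thesis using d(1) by simp
  qed
  then show ?thesis by (intro exI[of _ "\<lambda>S T. \<Sum>t\<in>?Num. \<rho> t S T / d"]) blast
qed

section \<open>Standard tableaux as standard extensional fillings\<close>

definition filling_of :: "nat \<Rightarrow> nat list list \<Rightarrow> nat \<Rightarrow> nat" where
  "filling_of h T = restrict ((!) (concat T)) {..<h}"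

lemma filling_of_bij:
  assumes lam: "partition_of lam h"
  shows "bij_betw (filling_of h) (standard_tableaux n lam) (std_fillings n h lam)"
proof -
  have h: "sum_list lam = h" using lam by (simp add: partition_of_def)
  have pos: "\<exists>q<h. cells lam ! q = x" if "x \<in> diagram lam" for x
    using that unfolding set_cells[symmetric] in_set_conv_nth by (auto simp: length_cells h)
  have cell: "cells lam ! q \<in> diagram lam" if "q < h" for q using that by (intro cell_in) (simp add: h)
  have fill_entry: "filling_of h T q = entry T (cells lam ! q)" if "shape T = lam" "q < h" for T q
    using nth_concat_eq[OF that(1)] that(2) by (simp add: filling_of_def h)
  have std: "std_filling {..<h} (cell_row lam) (cell_col lam) True (filling_of h T) \<longleftrightarrow> standard_tableau T"
    if sh: "shape T = lam" for T
  proof -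
    have len: "length T = length lam" "\<And>r. r < length lam \<Longrightarrow> length (T ! r) = lam ! r"
      using sh by (auto simp: shape_def)
    have rows: "(\<forall>row\<in>set T. sorted_wrt (<) row) \<longleftrightarrow>
        (\<forall>x\<in>diagram lam. \<forall>y\<in>diagram lam. fst x = fst y \<and> snd x < snd y \<longrightarrow> entry T x < entry T y)"
      by (auto simp: all_set_conv_all_nth len sorted_wrt_iff_nth_less diagram_def entry_def)
    have cols: "(\<forall>r r' c. r < r' \<and> r' < length T \<and> c < length (T ! r) \<and> c < length (T ! r') \<longrightarrow> T ! r ! c \<le> T ! r' ! c) \<longleftrightarrow>
        (\<forall>x\<in>diagram lam. \<forall>y\<in>diagram lam. snd x = snd y \<and> fst x < fst y \<longrightarrow> entry T x \<le> entry T y)"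
      by (auto simp: len diagram_def entry_def)
    have all: "(\<forall>x\<in>diagram lam. P x) \<longleftrightarrow> (\<forall>q\<in>{..<h}. P (cells lam ! q))" for P
      using pos cell by (metis lessThan_iff)
    show ?thesis
      unfolding standard_tableau_def rows cols std_filling_def all if_True
      using fill_entry[OF sh] by simp
  qed
  show ?thesis
    unfolding bij_betw_def
  proof
    show "inj_on (filling_of h) (standard_tableaux n lam)"
    proof (rule inj_onI)
      fix S T assume "S \<in> standard_tableaux n lam" "T \<in> standard_tableaux n lam" and eq: "filling_of h S = filling_of h T"
      then have sh: "shape S = lam" "shape T = lam" by (auto simp: standard_tableaux_def)
      have e: "entry S x = entry T x" if x: "x \<in> diagram lam" for x
      proof -
        obtain q where q: "q < h" "cells lam ! q = x" using pos[OF x] by blast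
        show ?thesis using fill_entry[OF sh(1) q(1)] fill_entry[OF sh(2) q(1)] q(2) eq by simp
      qed
      have len': "length X = length lam" "\<And>r. r < length lam \<Longrightarrow> length (X ! r) = lam ! r"
        if "shape X = lam" for X :: "nat list list" using that by (auto simp: shape_def)
      note len = len'[OF sh(1)] len'[OF sh(2)]
      show "S = T"
      proof (rule nth_equalityI)
        fix r assume "r < length S"
        then have r: "r < length lam" by (simp add: len)
        show "S ! r = T ! r"
          by (rule nth_equalityI) (use e[of "(r, _)"] r len in \<open>auto simp: diagram_def entry_def\<close>)
      qed (simp add: len)
    qed
    show "filling_of h ` standard_tableaux n lam = std_fillings n h lam"
    proof (intro equalityI subsetI)
      fix u assume "u \<in> filling_of h ` standard_tableaux n lam"
      then obtain T where T: "u = filling_of h T" "shape T = lam" "set (concat T) \<subseteq> {1..n}" "standard_tableau T"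
        by (auto simp: standard_tableaux_def)
      have "concat T ! q \<in> {1..n}" if "q < h" for q
        using T(3) nth_mem[of q "concat T"] length_concat_shape[OF T(2)] that h by auto
      then have "u \<in> PiE {..<h} (\<lambda>_. {1..n})" by (auto simp: T(1) filling_of_def)
      then show "u \<in> std_fillings n h lam" using T std[OF T(2)] by (simp add: std_fillings_def)
    next
      fix u assume u: "u \<in> std_fillings n h lam"
      define pos' where "pos' x = (SOME q. q < h \<and> cells lam ! q = x)" for x
      have pos': "pos' x < h" "cells lam ! pos' x = x" if "x \<in> diagram lam" for x
        using someI_ex[OF pos[OF that]] by (auto simp: pos'_def)
      define T where "T = map (\<lambda>r. map (\<lambda>c. u (pos' (r, c))) [0..<lam ! r]) [0..<length lam]"
      have sh: "shape T = lam" by (simp add: T_def shape_def comp_def map_nth)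
      have ent: "entry T x = u (pos' x)" if "x \<in> diagram lam" for x
        using that by (auto simp: T_def entry_def diagram_def)
      have same: "pos' (cells lam ! q) = q" if "q < h" for q
        using pos'[OF cell[OF that]] nth_eq_iff_index_eq[OF distinct_cells, of "pos' (cells lam ! q)" lam q] that
        by (simp add: length_cells h)
      have "filling_of h T = u"
      proof (rule PiE_ext)
        show "filling_of h T \<in> PiE {..<h} (\<lambda>_. UNIV)" by (simp add: filling_of_def)
        show "u \<in> PiE {..<h} (\<lambda>_. UNIV)" using u by (auto simp: std_fillings_def PiE_def)
        fix q assume "q \<in> {..<h}"
        then show "filling_of h T q = u q" using fill_entry[OF sh] ent[OF cell] same by simp
      qed
      moreover have "set (concat T) \<subseteq> {1..n}"
      proof
        fix z assume "z \<in> set (concat T)"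
        then obtain x where "x \<in> diagram lam" "z = entry T x" unfolding set_concat_entry[OF sh] by blast
        then have "z = u (pos' x)" "pos' x < h" using ent pos' by auto
        then show "z \<in> {1..n}" using u by (auto simp: std_fillings_def PiE_def)
      qed
      ultimately show "u \<in> filling_of h ` standard_tableaux n lam"
        using std[OF sh] u sh by (intro image_eqI[of _ _ T]) (auto simp: std_fillings_def standard_tableaux_def)
    qed
  qed
qed

lemma kernel_perm_normal_op: "kernel_perm h (\<lambda>a b. Poly_Mapping.lookup (normal_op n h (Letter \<circ> a) (Letter \<circ> b) v) s)"
  unfolding kernel_perm_def
proof (intro conjI allI impI)
  fix a b a' b' :: "nat \<Rightarrow> nat" assume "\<forall>q<h. a q = a' q \<and> b q = b' q"
  then have "normal_op n h (Letter \<circ> a) (Letter \<circ> b) v = normal_op n h (Letter \<circ> a') (Letter \<circ> b') v"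
    by (intro normal_op_cong) simp_all
  then show "Poly_Mapping.lookup (normal_op n h (Letter \<circ> a) (Letter \<circ> b) v) s =
      Poly_Mapping.lookup (normal_op n h (Letter \<circ> a') (Letter \<circ> b') v) s" by simp
next
  fix a b p assume "p permutes {..<h}"
  then have "normal_op n h ((Letter \<circ> a) \<circ> p) ((Letter \<circ> b) \<circ> p) v = normal_op n h (Letter \<circ> a) (Letter \<circ> b) v"
    by (intro normal_op_permute) (simp_all add: is_alpha_def)
  then show "Poly_Mapping.lookup (normal_op n h (Letter \<circ> (a \<circ> p)) (Letter \<circ> (b \<circ> p)) v) s =
      Poly_Mapping.lookup (normal_op n h (Letter \<circ> a) (Letter \<circ> b) v) s" by (simp only: comp_assoc)
qed

theorem theorem5p1:
  fixes m0 m1 n h :: nat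
    and lam :: "nat list"
    and i j :: "nat \<Rightarrow> nat"
  assumes "n \<ge> 1" and "h \<ge> 1"
    and "partition_of lam h"
    and "i \<in> {1..h} \<rightarrow> {1..n}" and "j \<in> {1..h} \<rightarrow> {1..n}"
    and "m0 \<ge> h" and "m1 \<ge> hd lam"
  shows "\<exists>\<rho> :: nat list list \<Rightarrow> nat list list \<Rightarrow> complex.
    Cimm m0 m1 n h lam i j =
      (\<Oplus>\<^bsub>U_gl m0 m1 n\<^esub>S\<in>standard_tableaux n lam.
         \<Oplus>\<^bsub>U_gl m0 m1 n\<^esub>T\<in>standard_tableaux n lam.
         U_smult m0 m1 n (\<rho> S T) (young_capelli_bitab m0 m1 n S T))"
proof -
  interpret gl_super m0 m1 n .
  interpret U: ring U by (rule ring_U)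
  let ?P = "{s. s permutes {1..h}}" and ?T = "standard_tableaux n lam" and ?w = "wick_sign True h"
  let ?\<chi> = "irr_character h lam"
  note lam = assms(3)
  obtain \<rho> where \<rho>: "\<And>N. kernel_perm h N \<Longrightarrow>
    (\<Sum>s\<in>?P. ?\<chi> s * N (i \<circ> s \<circ> Suc) (j \<circ> Suc)) =
    (\<Sum>S\<in>std_fillings n h lam. \<Sum>T\<in>std_fillings n h lam. \<rho> S T * young_sum h lam N S T)"
    using immanant_straighten[OF lam assms(4,5)] by blast
  define \<sigma> where "\<sigma> S T = \<rho> (filling_of h S) (filling_of h T)" for S T
  have finT: "finite ?T" by (rule finite_standard_tableaux)
  have finP: "finite ?P" by (simp add: finite_permutations)
  have "\<forall>s\<in>?P. \<exists>y. y \<in> fa L \<and> capelli_bitab m0 m1 n (column_tab h (i \<circ> s)) (column_tab h j) = cls y \<and>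
    (\<forall>v\<in>vacuum. act n y v = cscale ?w (normal_op n h (Letter \<circ> (i \<circ> s \<circ> Suc)) (Letter \<circ> (j \<circ> Suc)) v))"
  proof
    fix s assume "s \<in> ?P"
    then have "s k \<in> {1..h}" if "k \<in> {1..h}" for k using permutes_in_image[of s "{1..h}" k] that by blast
    then show "\<exists>y. y \<in> fa L \<and> capelli_bitab m0 m1 n (column_tab h (i \<circ> s)) (column_tab h j) = cls y \<and>
      (\<forall>v\<in>vacuum. act n y v = cscale ?w (normal_op n h (Letter \<circ> (i \<circ> s \<circ> Suc)) (Letter \<circ> (j \<circ> Suc)) v))"
      using column_capelli_cls[of h "i \<circ> s" j] assms(4-6) by (auto simp: Pi_def Bex_def)
  qed
  from bchoice[OF this] obtain y where y: "\<And>s. s \<in> ?P \<Longrightarrow> y s \<in> fa L"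
    "\<And>s. s \<in> ?P \<Longrightarrow> capelli_bitab m0 m1 n (column_tab h (i \<circ> s)) (column_tab h j) = cls (y s)"
    "\<And>s v. s \<in> ?P \<Longrightarrow> v \<in> vacuum \<Longrightarrow>
      act n (y s) v = cscale ?w (normal_op n h (Letter \<circ> (i \<circ> s \<circ> Suc)) (Letter \<circ> (j \<circ> Suc)) v)" by blast
  have "\<forall>x\<in>?T \<times> ?T. \<exists>z. z \<in> fa L \<and> young_capelli_bitab m0 m1 n (fst x) (snd x) = cls z \<and> (\<forall>v\<in>vacuum. act n z v =
    cscale ?w (\<Sum>r\<in>line_perms {..<h} (cell_row lam). \<Sum>c\<in>line_perms {..<h} (cell_col lam).
      cscale (char1 True r) (normal_op n h (Letter \<circ> (!) (concat (fst x))) (Letter \<circ> (!) (concat (snd x)) \<circ> c \<circ> r) v)))"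
  proof
    fix x assume "x \<in> ?T \<times> ?T"
    then have "shape (fst x) = lam" "set (concat (fst x)) \<subseteq> {1..n}" "shape (snd x) = lam" "set (concat (snd x)) \<subseteq> {1..n}"
      by (simp_all add: standard_tableaux_def mem_Times_iff)
    from young_capelli_cls[OF lam assms(6,7) this]
    show "\<exists>z. z \<in> fa L \<and> young_capelli_bitab m0 m1 n (fst x) (snd x) = cls z \<and> (\<forall>v\<in>vacuum. act n z v =
      cscale ?w (\<Sum>r\<in>line_perms {..<h} (cell_row lam). \<Sum>c\<in>line_perms {..<h} (cell_col lam).
        cscale (char1 True r) (normal_op n h (Letter \<circ> (!) (concat (fst x))) (Letter \<circ> (!) (concat (snd x)) \<circ> c \<circ> r) v)))"
      unfolding Bex_def .
  qed
  from bchoice[OF this] obtain z' where z': "\<forall>x\<in>?T \<times> ?T. z' x \<in> fa L \<and> young_capelli_bitab m0 m1 n (fst x) (snd x) = cls (z' x) \<and>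
    (\<forall>v\<in>vacuum. act n (z' x) v =
    cscale ?w (\<Sum>r\<in>line_perms {..<h} (cell_row lam). \<Sum>c\<in>line_perms {..<h} (cell_col lam).
      cscale (char1 True r) (normal_op n h (Letter \<circ> (!) (concat (fst x))) (Letter \<circ> (!) (concat (snd x)) \<circ> c \<circ> r) v)))" ..
  define z where "z S T = z' (S, T)" for S T
  have z: "z S T \<in> fa L" "young_capelli_bitab m0 m1 n S T = cls (z S T)"
    "\<And>v. v \<in> vacuum \<Longrightarrow> act n (z S T) v =
      cscale ?w (\<Sum>r\<in>line_perms {..<h} (cell_row lam). \<Sum>c\<in>line_perms {..<h} (cell_col lam).
        cscale (char1 True r) (normal_op n h (Letter \<circ> (!) (concat S)) (Letter \<circ> (!) (concat T) \<circ> c \<circ> r) v))"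
    if "S \<in> ?T" "T \<in> ?T" for S T
    using bspec[OF z', of "(S, T)"] that unfolding z_def by simp_all
  let ?A = "\<Sum>s\<in>?P. cscale (?\<chi> s) (y s)" and ?B = "\<Sum>S\<in>?T. \<Sum>T\<in>?T. cscale (\<sigma> S T) (z S T)"
  have AL: "?A \<in> fa L" using y(1) by (intro fa_sum fa_cscale)
  have BL: "?B \<in> fa L" using z(1) by (intro fa_sum fa_cscale)
  have yz_G: "y s \<in> fa G" "z S T \<in> fa G" if "s \<in> ?P" "S \<in> ?T" "T \<in> ?T" for s S T
    using faL_subset y(1) z(1) that by blast+
  have "Cimm m0 m1 n h lam i j = (\<Oplus>\<^bsub>U\<^esub>s\<in>?P. cls (cscale (?\<chi> s) (y s)))"
    unfolding Cimm_def
    by (rule U.finsum_cong') (auto simp: y(2) cls_smult faL_subset[OF y(1)] intro!: cls_carrier fa_cscale)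
  also have "\<dots> = cls ?A"
    using y(1) by (intro cls_finsum finP fa_cscale faL_subset)
  finally have left: "Cimm m0 m1 n h lam i j = cls ?A" .
  have inner: "(\<Oplus>\<^bsub>U\<^esub>T\<in>?T. U_smult m0 m1 n (\<sigma> S T) (young_capelli_bitab m0 m1 n S T)) =
      cls (\<Sum>T\<in>?T. cscale (\<sigma> S T) (z S T))" if S: "S \<in> ?T" for S
  proof -
    have "(\<Oplus>\<^bsub>U\<^esub>T\<in>?T. U_smult m0 m1 n (\<sigma> S T) (young_capelli_bitab m0 m1 n S T)) =
        (\<Oplus>\<^bsub>U\<^esub>T\<in>?T. cls (cscale (\<sigma> S T) (z S T)))"
      by (rule U.finsum_cong') (auto simp: z(2)[OF S] cls_smult faL_subset[OF z(1)[OF S]] intro!: cls_carrier fa_cscale)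
    also have "\<dots> = cls (\<Sum>T\<in>?T. cscale (\<sigma> S T) (z S T))"
      using z(1)[OF S] by (intro cls_finsum finT fa_cscale faL_subset)
    finally show ?thesis .
  qed
  have "(\<Oplus>\<^bsub>U\<^esub>S\<in>?T. \<Oplus>\<^bsub>U\<^esub>T\<in>?T. U_smult m0 m1 n (\<sigma> S T) (young_capelli_bitab m0 m1 n S T)) =
      (\<Oplus>\<^bsub>U\<^esub>S\<in>?T. cls (\<Sum>T\<in>?T. cscale (\<sigma> S T) (z S T)))"
    using z(1) by (intro U.finsum_cong') (auto simp: inner intro!: cls_carrier fa_sum fa_cscale faL_subset)
  also have "\<dots> = cls ?B"
    using z(1) by (intro cls_finsum finT fa_sum fa_cscale faL_subset)
  finally have right: "(\<Oplus>\<^bsub>U\<^esub>S\<in>?T. \<Oplus>\<^bsub>U\<^esub>T\<in>?T. U_smult m0 m1 n (\<sigma> S T) (young_capelli_bitab m0 m1 n S T)) = cls ?B" .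
  \<comment> \<open>Both representatives involve only the generators of gl(n), so comparing their
    actions on the vacuum, coefficient by coefficient, is enough.\<close>
  have eq: "cls ?A = cls ?B"
  proof (rule cls_eq_of_act[OF AL BL])
    fix v assume v: "v \<in> vacuum"
    show "act n ?A v = act n ?B v"
    proof (rule poly_mapping_eqI)
      fix u
      \<comment> \<open>Each choice of \<open>v\<close> and \<open>u\<close> gives one admissible
        functional; \<open>\<rho>\<close> was fixed before, so the same coefficients serve all of
        them.\<close>
      define N where "N a b = Poly_Mapping.lookup (normal_op n h (Letter \<circ> a) (Letter \<circ> b) v) u" for a b
      have N: "kernel_perm h N" unfolding N_def by (rule kernel_perm_normal_op)
      have actz: "Poly_Mapping.lookup (act n (z S T) v) u = ?w * young_sum h lam N (filling_of h S) (filling_of h T)"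
        if "S \<in> ?T" "T \<in> ?T" for S T
      proof -
        have "Poly_Mapping.lookup (act n (z S T) v) u = ?w * young_sum h lam N ((!) (concat S)) ((!) (concat T))"
          unfolding z(3)[OF that v] young_sum_def N_def by (simp add: lookup_sum comp_assoc)
        also have "young_sum h lam N ((!) (concat S)) ((!) (concat T)) =
            young_sum h lam N (filling_of h S) (filling_of h T)"
          unfolding young_sum_def
        proof (intro sum.cong refl arg_cong2[of _ _ _ _ "(*)"] kernel_perm_cong[OF N])
          fix r c q
          assume r: "r \<in> line_perms {..<h} (cell_row lam)" and c: "c \<in> line_perms {..<h} (cell_col lam)" and q: "q < h"
          show "concat S ! q = filling_of h S q" using q by (simp add: filling_of_def)
          have "c (r q) < h"
            using permutes_in_image[OF line_perms_permutes[OF r], of q]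
              permutes_in_image[OF line_perms_permutes[OF c], of "r q"] q by simp
          then show "((!) (concat T) \<circ> c \<circ> r) q = (filling_of h T \<circ> c \<circ> r) q" by (simp add: filling_of_def)
        qed
        finally show ?thesis .
      qed
      have "Poly_Mapping.lookup (act n ?A v) u = (\<Sum>s\<in>?P. ?\<chi> s * Poly_Mapping.lookup (act n (y s) v) u)"
        by (simp add: clinear_sum[OF clinear_act_left] clinear_cscale[OF clinear_act_left] lookup_sum)
      also have "\<dots> = (\<Sum>s\<in>?P. ?w * (?\<chi> s * N (i \<circ> s \<circ> Suc) (j \<circ> Suc)))"
        using y(3)[OF _ v] by (intro sum.cong refl) (simp add: N_def comp_assoc)
      also have "\<dots> = ?w * (\<Sum>s\<in>?P. ?\<chi> s * N (i \<circ> s \<circ> Suc) (j \<circ> Suc))"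
        by (rule sum_distrib_left[symmetric])
      also have "\<dots> = ?w * (\<Sum>S\<in>std_fillings n h lam. \<Sum>T\<in>std_fillings n h lam. \<rho> S T * young_sum h lam N S T)"
        by (simp only: \<rho>[OF N])
      also have "\<dots> = ?w * (\<Sum>S\<in>?T. \<Sum>T\<in>?T. \<sigma> S T * young_sum h lam N (filling_of h S) (filling_of h T))"
        unfolding \<sigma>_def
        by (simp only: sum.reindex_bij_betw[OF filling_of_bij[OF lam], symmetric])
      also have "\<dots> = (\<Sum>S\<in>?T. \<Sum>T\<in>?T. \<sigma> S T * Poly_Mapping.lookup (act n (z S T) v) u)"
        unfolding sum_distrib_left by (intro sum.cong refl) (simp add: actz)
      also have "\<dots> = Poly_Mapping.lookup (act n ?B v) u"
        by (simp add: clinear_sum[OF clinear_act_left] clinear_cscale[OF clinear_act_left] lookup_sum)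
      finally show "Poly_Mapping.lookup (act n ?A v) u = Poly_Mapping.lookup (act n ?B v) u" .
    qed
  qed
  show ?thesis
    by (rule exI[of _ \<sigma>]) (rule trans[OF left trans[OF eq right[symmetric]]])
qed

end
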